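(* Let $c\ge 1$, let $z_1<z_2<\cdots<z_c$ be positive integers, let $m\ge 2$ be an integer, and put $s_i=mz_i$ for $i=1,\dots,c$. Let $r\ge 0$ and $R_1,\dots,R_c\ge 0$ be integers. Let $\{Y_t,\ t=0,\pm1,\pm2,\ldots\}$ satisfy the difference equation $$\phi(B)(1-B)^{r+d}\prod_{j=1}^{c}\Phi_j(B^{s_j})(1-B^{s_j})^{R_j+D_j}Y_t=\theta(B)\prod_{j=1}^{c}\Theta_j(B^{s_j})\varepsilon_t ,$$ meaning that $(1-B)^{r}\prod_{j=1}^c(1-B^{s_j})^{R_j}Y_t$ is a stationary SARFIMA process with parameters $d,D_1,\dots,D_c$, polynomials $\phi,\theta,\Phi_j,\Theta_j$, periods $s_1,\dots,s_c$ and innovation variance $\sigma^2$ (see context). Let $X_T^m=\sum_{k=m(T-1)+1}^{mT}Y_k$ be the non-overlapping $m$-temporal aggregates of $\{Y_t\}$. Write $R=(r,R_1,\dots,R_c)$ and let $\xi$ denote the vector consisting of $d$, $D_j$ ($1\le j\le c$), and the coefficients of $\Phi_j$ and $\Theta_j$ ($1\le j\le c$). (a) If $m=2h+1$ is odd, the spectral density function of $\{\nabla^{r}\nabla_{z_1}^{R_1}\cdots\nabla_{z_c}^{R_c}X_T^{m}\}_T$ is, for $-\pi<\omega\le\pi$, $$f_{\xi,R,m}(\omega)=\frac1m\Bigl|2\sin\bigl(\tfrac{\omega}{2}\bigr)\Bigr|^{2r+2}\prod_{j=1}^c\Bigl|2\sin\bigl(\tfrac{z_j\omega}{2}\bigr)\Bigr|^{-2D_j}\prod_{j=1}^c\left|\frac{\Theta_j(e^{\mathrm{i}z_j\omega})}{\Phi_j(e^{\mathrm{i}z_j\omega})}\right|^2\sum_{k=-h}^{h}\Bigl|2\sin\bigl(\tfrac{\omega+2k\pi}{2m}\bigr)\Bigr|^{-2r-2d-2}g\Bigl(\frac{\omega+2k\pi}{m}\Bigr),$$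 where $g(\omega)=\dfrac{\sigma^2}{2\pi}\,\dfrac{|\theta(e^{\mathrm{i}\omega})|^2}{|\phi(e^{\mathrm{i}\omega})|^{2}}$. If $m=2h$ is even, the spectral density is given by the same formula, with the summation over $k$ ranging from $-h+1$ to $h$ for $-\pi<\omega\le 0$ and from $-h$ to $h-1$ for $0<\omega\le\pi$. (b) Let $m\to\infty$ with $z_1,\dots,z_c$, $R$, $\xi$, $\phi$, $\theta$, $\sigma^2$ held fixed (so $s_i=mz_i$ varies with $m$, and for each $m$ the process $\{Y_t\}$ is such that $(1-B)^{r}\prod_{j=1}^c(1-B^{mz_j})^{R_j}Y_t$ is a stationary SARFIMA process with parameters $d,D_1,\dots,D_c$, polynomials $\phi,\theta,\Phi_j,\Theta_j$, periods $mz_1,\dots,mz_c$ and innovation variance $\sigma^2$). Then the normalized spectral density function of $\{\nabla^{r}\nabla_{z_1}^{R_1}\cdots\nabla_{z_c}^{R_c}X_T^{m}\}_T$, i.e. $f_{\xi,R,m}(\omega)\big/\int_{-\pi}^{\pi}f_{\xi,R,m}(u)\,du$, converges pointwise (at every $\omega\in(-\pi,\pi]$ with $\omega\neq0$ and $z_j\omega\notin 2\pi\mathbb{Z}$ for all $j$) to $f_{\xi,R}(\omega)=K_{\xi,R}f^{*}_{\xi,R}(\omega)$, where $$f^{*}_{\xi,R}(\omega)=\Bigl|\sin\bigl(\tfrac{\omega}{2}\bigr)\Bigr|^{2r+2}\prod_{j=1}^c\Bigl|\sin\bigl(\tfrac{z_j\omega}{2}\bigr)\Bigr|^{-2D_j}\prod_{j=1}^c\left|\frac{\Theta_j(e^{\mathrm{i}z_j\omega})}{\Phi_j(e^{\mathrm{i}z_j\omega})}\right|^2\sum_{k=-\infty}^{\infty}|\omega+2k\pi|^{-2r-2d-2}$$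 and $K_{\xi,R}$ is the normalization constant ensuring $\int_{-\pi}^{\pi}f_{\xi,R}(\omega)\,d\omega=1$.
   Context: $B$ is the backward shift operator, $\nabla=1-B$ and $\nabla_s=1-B^s$; when applied to the aggregate series $\{X_T^m\}_T$ they act on the index $T$. For real $d$, $(1-B)^d=\sum_{k\ge0}\frac{\Gamma(k-d)}{\Gamma(k+1)\Gamma(-d)}B^k$ (binomial series). Stationary SARFIMA process with periods $1<s_1<\cdots<s_c$ (integers): a weakly stationary, finite-variance process $\{U_t\}$ with $$\phi(B)(1-B)^{d}\prod_{i=1}^c\Phi_i(B^{s_i})(1-B^{s_i})^{D_i}U_t=\theta(B)\prod_{i=1}^c\Theta_i(B^{s_i})\varepsilon_t ,$$ where $\{\varepsilon_t\}$ is an uncorrelated sequence of zero-mean random variables with common finite variance $\sigma^2>0$; $\phi(z)=1-\phi_1z-\cdots-\phi_pz^p$, $\theta(z)=1+\theta_1z+\cdots+\theta_qz^q$, $\Phi_i(z)=1-\Phi_{i,1}z-\cdots-\Phi_{i,P_i}z^{P_i}$, $\Theta_i(z)=1+\Theta_{i,1}z+\cdots+\Theta_{i,Q_i}z^{Q_i}$ are real polynomials. No root of $\phi$ or any $\Phi_i$ coincides with a root of $\theta$ or any $\Theta_i$, and all roots of all these polynomials lie outside the closed unit disc. Its spectral density on $(-\pi,\pi]$ (an integrable function, by stationarity) is $$h(\omega)=\frac{\sigma^2}{2\pi}\left|\frac{\theta(e^{\mathrm{i}\omega})}{\phi(e^{\mathrm{i}\omega})}\right|^2\,|1-e^{\mathrm{i}\omega}|^{-2d}\prod_{j=1}^c\left|\frac{\Theta_j(e^{\mathrm{i}s_j\omega})}{\Phi_j(e^{\mathrm{i}s_j\omega})}\right|^2\prod_{j=1}^c|1-e^{\mathrm{i}s_j\omega}|^{-2D_j}.$$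 Standing assumptions on the real parameters: $0\le D_j<1/2$ for $j=1,\dots,c$, and $0\le d+D_1+\cdots+D_c<1/2$ (note that $d$ itself may be negative). *)

theory Defs
  imports "HOL-Probability.Probability" "HOL-Computational_Algebra.Computational_Algebra"
begin

definition cov :: "'a measure \<Rightarrow> ('a \<Rightarrow> real) \<Rightarrow> ('a \<Rightarrow> real) \<Rightarrow> real" where
  "cov M X Y = (\<integral>x. (X x - integral\<^sup>L M X) * (Y x - integral\<^sup>L M Y) \<partial>M)"

definition weakly_stationary :: "'a measure \<Rightarrow> (int \<Rightarrow> 'a \<Rightarrow> real) \<Rightarrow> bool" where
  "weakly_stationary M X \<longleftrightarrow>
     prob_space M \<and>
     (\<forall>t. X t \<in> borel_measurable M \<and> integrable M (\<lambda>x. (X t x)\<^sup>2)) \<and>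
     (\<forall>s t. integral\<^sup>L M (X s) = integral\<^sup>L M (X t)) \<and>
     (\<forall>s t h. cov M (X (s + h)) (X (t + h)) = cov M (X s) (X t))"

definition white_noise :: "'a measure \<Rightarrow> real \<Rightarrow> (int \<Rightarrow> 'a \<Rightarrow> real) \<Rightarrow> bool" where
  "white_noise M v \<epsilon> \<longleftrightarrow>
     prob_space M \<and>
     (\<forall>t. \<epsilon> t \<in> borel_measurable M \<and> integrable M (\<lambda>x. (\<epsilon> t x)\<^sup>2)) \<and>
     (\<forall>t. integral\<^sup>L M (\<epsilon> t) = 0) \<and>
     (\<forall>t. cov M (\<epsilon> t) (\<epsilon> t) = v) \<and>
     (\<forall>s t. s \<noteq> t \<longrightarrow> cov M (\<epsilon> s) (\<epsilon> t) = 0)"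

text \<open>A spectral density is determined only up to a null set, so the following is a relation
  between a process and a function; values outside the interval are irrelevant.\<close>

definition has_spectral_density ::
    "'a measure \<Rightarrow> (int \<Rightarrow> 'a \<Rightarrow> real) \<Rightarrow> (real \<Rightarrow> real) \<Rightarrow> bool" where
  "has_spectral_density M X f \<longleftrightarrow>
     weakly_stationary M X \<and>
     (\<forall>\<omega>\<in>{-pi<..pi}. 0 \<le> f \<omega>) \<and>
     set_integrable lborel {-pi<..pi} f \<and>
     (\<forall>t h. complex_of_real (cov M (X (t + h)) (X t)) =
        (CLBINT \<omega>:{-pi<..pi}. cis (of_int h * \<omega>) * complex_of_real (f \<omega>)))"

definition backshift_poly ::
    "real poly \<Rightarrow> (int \<Rightarrow> 'a \<Rightarrow> real) \<Rightarrow> int \<Rightarrow> 'a \<Rightarrow> real" where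
  "backshift_poly p X t x = (\<Sum>k\<le>degree p. coeff p k * X (t - int k) x)"

text \<open>The relation W = F(B) X for a power series F, the series being convergent in mean square.\<close>

definition ms_filter ::
    "'a measure \<Rightarrow> real fps \<Rightarrow> (int \<Rightarrow> 'a \<Rightarrow> real) \<Rightarrow> (int \<Rightarrow> 'a \<Rightarrow> real) \<Rightarrow> bool" where
  "ms_filter M F X W \<longleftrightarrow>
     (\<forall>t. (\<lambda>n. \<integral>x. ((\<Sum>k<n. fps_nth F k * X (t - int k) x) - W t x)\<^sup>2 \<partial>M) \<longlonglongrightarrow> 0)"

text \<open>The binomial series of (1 - B) to the power a. The quotient of Gamma functions in its
  coefficients is written as a Pochhammer symbol, so that it also makes sense when a is a natural
  number (a pole of the denominator).\<close>

definition frac_diff :: "real \<Rightarrow> real fps" where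
  "frac_diff a = Abs_fps (\<lambda>k. pochhammer (- a) k / fact k)"

lemma frac_diff_nth_Gamma:
  assumes "a \<notin> \<nat>"
  shows "fps_nth (frac_diff a) k = Gamma (real k - a) / (Gamma (real k + 1) * Gamma (- a))"
proof -
  have "- a \<notin> \<int>\<^sub>\<le>\<^sub>0"
    using assms by (metis uminus_in_nonpos_Ints_iff)
  then have "pochhammer (- a) k = Gamma (real k - a) / Gamma (- a)"
    by (simp add: pochhammer_Gamma)
  moreover have "Gamma (real k + 1) = fact k"
    by (simp add: Gamma_fact add.commute)
  ultimately show ?thesis
    by (simp add: frac_diff_def mult.commute)
qed

lemma frac_diff_of_nat: "frac_diff (real n) = (1 - fps_X) ^ n"
proof -
  have "fps_nth ((1 - fps_X) ^ n :: real fps) k = pochhammer (- real n) k / fact k" for k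
  proof -
    have "(1 - fps_X) ^ n = fps_binomial (real n) oo (- fps_X)"
      by (simp add: fps_binomial_of_nat fps_compose_power[symmetric] fps_compose_add_distrib)
    then show ?thesis
      by (simp add: fps_compose_uminus' fps_binomial_def gbinomial_pochhammer
          flip: power_mult_distrib mult.assoc)
  qed
  then show ?thesis
    by (simp add: frac_diff_def fps_eq_iff)
qed

definition diff_poly :: "nat \<Rightarrow> nat \<Rightarrow> (nat \<Rightarrow> nat) \<Rightarrow> (nat \<Rightarrow> nat) \<Rightarrow> real poly" where
  "diff_poly c r R s = [:1, -1:] ^ r * (\<Prod>j=1..c. (1 - monom 1 (s j)) ^ R j)"

definition aggregate :: "nat \<Rightarrow> (int \<Rightarrow> 'a \<Rightarrow> real) \<Rightarrow> int \<Rightarrow> 'a \<Rightarrow> real" where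
  "aggregate m Y T x = (\<Sum>k = int m * (T - 1) + 1..int m * T. Y k x)"

text \<open>The seasonal components are indexed by 1, ..., \<open>n_seas\<close>; values at other
  indices are irrelevant.\<close>

record sarfima_params =
  n_seas :: nat
  ar :: "real poly"                   \<comment> \<open>\<open>\<phi>\<close>\<close>
  ma :: "real poly"                   \<comment> \<open>\<open>\<theta>\<close>\<close>
  sar :: "nat \<Rightarrow> real poly"           \<comment> \<open>\<open>\<Phi>\<close>\<close>
  sma :: "nat \<Rightarrow> real poly"           \<comment> \<open>\<open>\<Theta>\<close>\<close>
  mem :: real                         \<comment> \<open>\<open>d\<close>\<close>
  smem :: "nat \<Rightarrow> real"               \<comment> \<open>\<open>D\<close>\<close>
  innov_var :: real                   \<comment> \<open>\<open>\<sigma>\<^sup>2\<close>\<close>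

definition cpoly :: "real poly \<Rightarrow> complex \<Rightarrow> complex" where
  "cpoly p z = poly (map_poly complex_of_real p) z"

definition ar_polys :: "sarfima_params \<Rightarrow> real poly set" where
  "ar_polys P = insert (ar P) (sar P ` {1..n_seas P})"

definition ma_polys :: "sarfima_params \<Rightarrow> real poly set" where
  "ma_polys P = insert (ma P) (sma P ` {1..n_seas P})"

definition admissible :: "sarfima_params \<Rightarrow> bool" where
  "admissible P \<longleftrightarrow>
     (\<forall>p \<in> ar_polys P \<union> ma_polys P. coeff p 0 = 1 \<and> (\<forall>z. cpoly p z = 0 \<longrightarrow> 1 < cmod z)) \<and>
     (\<forall>p \<in> ar_polys P. \<forall>q \<in> ma_polys P. \<forall>z. \<not> (cpoly p z = 0 \<and> cpoly q z = 0)) \<and>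
     (\<forall>j \<in> {1..n_seas P}. 0 \<le> smem P j \<and> smem P j < 1/2) \<and>
     0 \<le> mem P + (\<Sum>j=1..n_seas P. smem P j) \<and>
     mem P + (\<Sum>j=1..n_seas P. smem P j) < 1/2 \<and>
     0 < innov_var P"

definition sarfima_lhs :: "sarfima_params \<Rightarrow> (nat \<Rightarrow> nat) \<Rightarrow> real fps" where
  "sarfima_lhs P s =
     fps_of_poly (ar P) * frac_diff (mem P) *
     (\<Prod>j=1..n_seas P. (fps_of_poly (sar P j) oo fps_X ^ s j) * (frac_diff (smem P j) oo fps_X ^ s j))"

definition sarfima_rhs :: "sarfima_params \<Rightarrow> (nat \<Rightarrow> nat) \<Rightarrow> real poly" where
  "sarfima_rhs P s = ma P * (\<Prod>j=1..n_seas P. sma P j \<circ>\<^sub>p monom 1 (s j))"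

text \<open>The fractional operators are composed as formal power series before being applied to the
  process: the coefficients of the composite are absolutely summable, whereas for negative d
  those of (1 - B) to the power d are not.
  The existence of some spectral density has to be required: if d + D 1 + ... + D c is positive,
  the difference equation still holds after adding to U a random constant that is uncorrelated
  with U, which creates an atom of the spectral measure at frequency 0.\<close>

definition stationary_sarfima ::
    "'a measure \<Rightarrow> sarfima_params \<Rightarrow> (nat \<Rightarrow> nat) \<Rightarrow> (int \<Rightarrow> 'a \<Rightarrow> real) \<Rightarrow> (int \<Rightarrow> 'a \<Rightarrow> real) \<Rightarrow> bool" where
  "stationary_sarfima M P s \<epsilon> U \<longleftrightarrow>
     (\<forall>j\<in>{1..n_seas P}. 1 < s j) \<and> strict_mono_on {1..n_seas P} s \<and>
     admissible P \<and>
     white_noise M (innov_var P) \<epsilon> \<and>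
     weakly_stationary M U \<and> (\<exists>f. has_spectral_density M U f) \<and>
     ms_filter M (sarfima_lhs P s) U (backshift_poly (sarfima_rhs P s) \<epsilon>)"

definition integrated_sarfima ::
    "'a measure \<Rightarrow> sarfima_params \<Rightarrow> nat \<Rightarrow> (nat \<Rightarrow> nat) \<Rightarrow> (nat \<Rightarrow> nat) \<Rightarrow>
     (int \<Rightarrow> 'a \<Rightarrow> real) \<Rightarrow> (int \<Rightarrow> 'a \<Rightarrow> real) \<Rightarrow> bool" where
  "integrated_sarfima M P r R s \<epsilon> Y \<longleftrightarrow>
     (\<forall>t. Y t \<in> borel_measurable M) \<and>
     stationary_sarfima M P s \<epsilon> (backshift_poly (diff_poly (n_seas P) r R s) Y)"

text \<open>In these formulas \<open>0 powr a = 0\<close> for all \<open>a\<close>, so that their values at the zeros of the sines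
  (finitely many frequencies) are conventional.\<close>

definition short_mem_density :: "sarfima_params \<Rightarrow> real \<Rightarrow> real" where
  "short_mem_density P \<omega> =
     innov_var P / (2 * pi) * ((cmod (cpoly (ma P) (cis \<omega>)))\<^sup>2 / (cmod (cpoly (ar P) (cis \<omega>)))\<^sup>2)"

definition alias_range :: "nat \<Rightarrow> real \<Rightarrow> int set" where
  "alias_range m \<omega> =
     (let h = int (m div 2) in
      if odd m then {-h..h} else if \<omega> \<le> 0 then {-h + 1..h} else {-h..h - 1})"

definition seasonal_ratio :: "sarfima_params \<Rightarrow> (nat \<Rightarrow> nat) \<Rightarrow> real \<Rightarrow> real" where
  "seasonal_ratio P z \<omega> =
     (\<Prod>j=1..n_seas P.
        (cmod (cpoly (sma P j) (cis (real (z j) * \<omega>)) / cpoly (sar P j) (cis (real (z j) * \<omega>))))\<^sup>2)"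

definition agg_density :: "sarfima_params \<Rightarrow> nat \<Rightarrow> (nat \<Rightarrow> nat) \<Rightarrow> nat \<Rightarrow> real \<Rightarrow> real" where
  "agg_density P r z m \<omega> =
     1 / real m * \<bar>2 * sin (\<omega> / 2)\<bar> ^ (2 * r + 2) *
     (\<Prod>j=1..n_seas P. \<bar>2 * sin (real (z j) * \<omega> / 2)\<bar> powr (- 2 * smem P j)) *
     seasonal_ratio P z \<omega> *
     (\<Sum>k\<in>alias_range m \<omega>.
        \<bar>2 * sin ((\<omega> + 2 * of_int k * pi) / (2 * real m))\<bar> powr (- 2 * real r - 2 * mem P - 2) *
        short_mem_density P ((\<omega> + 2 * of_int k * pi) / real m))"

definition limit_kernel :: "sarfima_params \<Rightarrow> nat \<Rightarrow> (nat \<Rightarrow> nat) \<Rightarrow> real \<Rightarrow> real" where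
  "limit_kernel P r z \<omega> =
     \<bar>sin (\<omega> / 2)\<bar> ^ (2 * r + 2) *
     (\<Prod>j=1..n_seas P. \<bar>sin (real (z j) * \<omega> / 2)\<bar> powr (- 2 * smem P j)) *
     seasonal_ratio P z \<omega> *
     (\<Sum>\<^sub>\<infinity>k::int. \<bar>\<omega> + 2 * of_int k * pi\<bar> powr (- 2 * real r - 2 * mem P - 2))"

end

theory Submission
  imports Defs "HOL-Real_Asymp.Real_Asymp"
begin

text \<open>Write \<open>F\<close> for the power series of the autoregressive operator. Its coefficients are absolutely
  summable: since \<open>1 - X\<^sup>s\<close> is the product of \<open>1 - \<zeta> X\<close> over the \<open>s\<close>-th roots of unity \<open>\<zeta>\<close>, all the
  fractional factors can be regrouped into powers of \<open>1 - \<zeta> X\<close> with exponents in \<open>[0, 1/2)\<close>, the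
  exponent at \<open>\<zeta> = 1\<close> being \<open>d + D\<^sub>1 + \<dots> + D\<^sub>c\<close>. Passing to the mean square limit, \<open>|F|\<^sup>2\<close> times the
  spectral density of \<open>U\<close> has the same Fourier coefficients as the spectral density of the moving
  average side, so the two agree almost everywhere; this determines the density of \<open>U\<close>.
  The differenced aggregates are \<open>((1 + B + \<dots> + B\<^bsup>m-1\<^esup>)\<^bsup>r+1\<^esup> U)\<close> sampled at multiples of \<open>m\<close>, and sampling
  folds the spectrum, which gives (a).
  For (b), the existence of the process for \<open>m = 2\<close> forces \<open>D\<^sub>1 + \<dots> + D\<^sub>c < 1/2\<close>, hence \<open>d > -1/2\<close>,
  so the limiting series converges; up to a power of \<open>m\<close>, the densities in (a) are dominated by a
  multiple of the integrable limit kernel, and dominated convergence applies.\<close>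

subsection \<open>Square integrable random variables and covariances\<close>

text \<open>What the hypotheses do not provide shapes the proof. \<open>Y\<close> need not have
  moments, only its differences \<open>U\<close> are stationary; so everything between
  \<open>Y\<close> and \<open>U\<close> rests on pointwise identities between polynomials in B, and
  mean square arguments start with \<open>U\<close>. The difference equation is merely a relation
  satisfied by \<open>U\<close>, with no moving average representation, so the filter is not
  inverted: densities are compared, and dividing by |F|^2 is allowed because F has only finitely
  many zeros on the unit circle. Admissibility bounds d + D_1 + ... + D_c, while a negative d leaves
  the sum of the D_j alone uncontrolled; this is why (b) must draw a bound from the existence of a
  process. In the limit kernel the factor |sin(\<omega>/2)|^(2r+2) cancels the pole of the alias k =
  0 down to order 2d. Integrability at frequency 0 is then governed by d + D_1 + ... + D_c and at
  the other zeros of the sines by the D_j alone. The bound |sin y| >= |y|/2 for |y| <= pi/2 serves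
  twice: it controls these poles, and it bounds the rescaled aliased sums by the limiting
  series.\<close>

definition square_integrable :: "'a measure \<Rightarrow> ('a \<Rightarrow> real) \<Rightarrow> bool" where
  "square_integrable M X \<longleftrightarrow> X \<in> borel_measurable M \<and> integrable M (\<lambda>x. (X x)\<^sup>2)"

lemma square_integrable_mult:
  assumes "square_integrable M X" "square_integrable M Y"
  shows "integrable M (\<lambda>x. X x * Y x)"
proof (rule Bochner_Integration.integrable_bound)
  show "integrable M (\<lambda>x. (X x)\<^sup>2 + (Y x)\<^sup>2)"
    using assms by (auto simp: square_integrable_def)
  show "(\<lambda>x. X x * Y x) \<in> borel_measurable M"
    using assms by (auto simp: square_integrable_def)
  have "\<bar>a * b\<bar> \<le> a\<^sup>2 + b\<^sup>2" for a b :: real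
  proof -
    have "2 * \<bar>a\<bar> * \<bar>b\<bar> \<le> a\<^sup>2 + b\<^sup>2" using sum_squares_bound[of "\<bar>a\<bar>" "\<bar>b\<bar>"] by simp
    moreover have "0 \<le> \<bar>a\<bar> * \<bar>b\<bar>" by simp
    ultimately show ?thesis unfolding abs_mult by linarith
  qed
  then show "AE x in M. norm (X x * Y x) \<le> norm ((X x)\<^sup>2 + (Y x)\<^sup>2)"
    by (intro AE_I2) simp
qed

lemma square_integrable_cmult:
  "square_integrable M X \<Longrightarrow> square_integrable M (\<lambda>x. c * X x)"
  by (auto simp: square_integrable_def power_mult_distrib)

lemma square_integrable_add:
  assumes "square_integrable M X" "square_integrable M Y"
  shows "square_integrable M (\<lambda>x. X x + Y x)"
  using assms square_integrable_mult[OF assms]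
  by (auto simp: square_integrable_def power2_sum mult.assoc)

lemma square_integrable_diff:
  assumes "square_integrable M X" "square_integrable M Y"
  shows "square_integrable M (\<lambda>x. X x - Y x)"
  using square_integrable_add[OF assms(1) square_integrable_cmult[OF assms(2), of "-1"]] by simp

lemma square_integrable_sum:
  "(\<And>i. i \<in> A \<Longrightarrow> square_integrable M (X i)) \<Longrightarrow> square_integrable M (\<lambda>x. \<Sum>i\<in>A. X i x)"
proof (induction A rule: infinite_finite_induct)
  case (insert i A)
  then show ?case by (simp add: square_integrable_add)
qed (auto simp: square_integrable_def)

lemma (in prob_space) square_integrable_integrable:
  "square_integrable M X \<Longrightarrow> integrable M X"
  using square_integrable_mult[of M X "\<lambda>_. 1"] by (simp add: square_integrable_def)

lemma (in prob_space) cov_eq: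
  assumes "square_integrable M X" "square_integrable M Y"
  shows "cov M X Y = expectation (\<lambda>x. X x * Y x) - expectation X * expectation Y"
proof -
  note [simp] = assms[THEN square_integrable_integrable] square_integrable_mult[OF assms] prob_space
  show ?thesis
    unfolding cov_def by (simp add: algebra_simps)
qed

lemma (in prob_space) cov_sum:
  assumes X: "\<And>i. i \<in> A \<Longrightarrow> square_integrable M (X i)"
    and Y: "\<And>j. j \<in> B \<Longrightarrow> square_integrable M (Y j)"
  shows "cov M (\<lambda>x. \<Sum>i\<in>A. a i * X i x) (\<lambda>x. \<Sum>j\<in>B. b j * Y j x) =
    (\<Sum>i\<in>A. \<Sum>j\<in>B. a i * b j * cov M (X i) (Y j))"
proof -
  have e: "expectation (\<lambda>x. \<Sum>i\<in>A. a i * X i x) = (\<Sum>i\<in>A. a i * expectation (X i))"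
    using X by (subst Bochner_Integration.integral_sum) (auto intro: square_integrable_integrable)
  have e': "expectation (\<lambda>x. \<Sum>i\<in>B. b i * Y i x) = (\<Sum>i\<in>B. b i * expectation (Y i))"
    using Y by (subst Bochner_Integration.integral_sum) (auto intro: square_integrable_integrable)
  have i: "integrable M (\<lambda>x. a i * X i x * (b j * Y j x))" if "i \<in> A" "j \<in> B" for i j
    using X Y that by (intro square_integrable_mult square_integrable_cmult) auto
  have "expectation (\<lambda>x. (\<Sum>i\<in>A. a i * X i x) * (\<Sum>j\<in>B. b j * Y j x)) =
      (\<Sum>i\<in>A. \<Sum>j\<in>B. expectation (\<lambda>x. a i * X i x * (b j * Y j x)))"
    unfolding sum_product using i by (simp add: Bochner_Integration.integral_sum)
  also have "\<dots> = (\<Sum>i\<in>A. \<Sum>j\<in>B. a i * b j * expectation (\<lambda>x. X i x * Y j x))"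
    by (intro sum.cong refl) (simp flip: Bochner_Integration.integral_mult_right_zero add: mult_ac)
  finally have "cov M (\<lambda>x. \<Sum>i\<in>A. a i * X i x) (\<lambda>x. \<Sum>j\<in>B. b j * Y j x) =
    (\<Sum>i\<in>A. \<Sum>j\<in>B. a i * b j * expectation (\<lambda>x. X i x * Y j x)) -
    (\<Sum>i\<in>A. a i * expectation (X i)) * (\<Sum>i\<in>B. b i * expectation (Y i))"
    using X Y by (subst cov_eq) (auto intro!: square_integrable_sum square_integrable_cmult simp: e e')
  also have "\<dots> = (\<Sum>i\<in>A. \<Sum>j\<in>B. a i * b j * (expectation (\<lambda>x. X i x * Y j x) - expectation (X i) * expectation (Y j)))"
    unfolding sum_product sum_subtractf[symmetric] by (intro sum.cong refl) (simp add: algebra_simps)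
  also have "\<dots> = (\<Sum>i\<in>A. \<Sum>j\<in>B. a i * b j * cov M (X i) (Y j))"
    using X Y by (intro sum.cong refl) (simp add: cov_eq)
  finally show ?thesis .
qed

text \<open>The quadratic t -> integral of (X + t Y)^2 is nonnegative; one suitable value of t gives
  the bound on \<open>r\<close> squared.\<close>

lemma integral_Cauchy_Schwarz:
  assumes X: "square_integrable M X" and Y: "square_integrable M Y"
  shows "\<bar>\<integral>x. X x * Y x \<partial>M\<bar> \<le> sqrt (\<integral>x. (X x)\<^sup>2 \<partial>M) * sqrt (\<integral>x. (Y x)\<^sup>2 \<partial>M)"
proof -
  define p q r where "p = (\<integral>x. (X x)\<^sup>2 \<partial>M)" and "q = (\<integral>x. (Y x)\<^sup>2 \<partial>M)" and "r = (\<integral>x. X x * Y x \<partial>M)"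
  have *: "0 \<le> p + 2 * t * r + t\<^sup>2 * q" for t
  proof -
    have "0 \<le> (\<integral>x. (X x + t * Y x)\<^sup>2 \<partial>M)" by simp
    also have "\<dots> = (\<integral>x. (X x)\<^sup>2 + 2 * t * (X x * Y x) + t\<^sup>2 * (Y x)\<^sup>2 \<partial>M)"
      by (intro Bochner_Integration.integral_cong) (auto simp: power2_eq_square algebra_simps)
    also have "\<dots> = p + 2 * t * r + t\<^sup>2 * q"
      using X Y square_integrable_mult[OF X Y]
      by (simp add: p_def q_def r_def square_integrable_def)
    finally show ?thesis .
  qed
  have "r\<^sup>2 \<le> p * q"
  proof (cases "q = 0")
    case True
    have "r = 0"
    proof (rule ccontr)
      assume "r \<noteq> 0"
      \<comment> \<open>With \<open>q = 0\<close> the quadratic is affine in t and takes the value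
        -1 at this point.\<close>
      then show False using *[of "- (p + 1) / (2 * r)"] True by (simp add: field_simps)
    qed
    then show ?thesis using True by simp
  next
    case False
    have "0 \<le> q" by (simp add: q_def)
    with False have "0 < q" by simp
    \<comment> \<open>This t is the minimizer of the quadratic.\<close>
    then show ?thesis using *[of "- r / q"] by (simp add: field_simps power2_eq_square)
  qed
  then have "\<bar>r\<bar> \<le> sqrt (p * q)"
    by (simp add: real_le_rsqrt[of "\<bar>r\<bar>"])
  then show ?thesis by (simp add: p_def q_def r_def real_sqrt_mult)
qed

text \<open>A_n B_n - A' B' is the sum of (A_n - A')(B_n - B'), (A_n - A') B' and A' (B_n - B');
  Cauchy-Schwarz bounds each integral by a null sequence.\<close>

lemma mean_square_tendsto_product:
  assumes A: "\<And>n. square_integrable M (A n)" "square_integrable M A'"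
    and B: "\<And>n. square_integrable M (B n)" "square_integrable M B'"
    and lim: "(\<lambda>n. \<integral>x. (A n x - A' x)\<^sup>2 \<partial>M) \<longlonglongrightarrow> 0" "(\<lambda>n. \<integral>x. (B n x - B' x)\<^sup>2 \<partial>M) \<longlonglongrightarrow> 0"
  shows "(\<lambda>n. \<integral>x. A n x * B n x \<partial>M) \<longlonglongrightarrow> (\<integral>x. A' x * B' x \<partial>M)"
proof -
  define a b where "a n = sqrt (\<integral>x. (A n x - A' x)\<^sup>2 \<partial>M)" and "b n = sqrt (\<integral>x. (B n x - B' x)\<^sup>2 \<partial>M)" for n
  define \<alpha> \<beta> where "\<alpha> = sqrt (\<integral>x. (A' x)\<^sup>2 \<partial>M)" and "\<beta> = sqrt (\<integral>x. (B' x)\<^sup>2 \<partial>M)"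
  have "(\<lambda>n. a n) \<longlonglongrightarrow> 0" "(\<lambda>n. b n) \<longlonglongrightarrow> 0"
    using tendsto_real_sqrt[OF lim(1)] tendsto_real_sqrt[OF lim(2)] unfolding a_def b_def by simp_all
  then have z: "(\<lambda>n. a n * b n + a n * \<beta> + \<alpha> * b n) \<longlonglongrightarrow> 0"
    using tendsto_add[OF tendsto_add[OF tendsto_mult[of a 0 _ b 0] tendsto_mult_left_zero[of a _ \<beta>]] tendsto_mult_right_zero[of b _ \<alpha>]]
    by simp
  have "norm ((\<integral>x. A n x * B n x \<partial>M) - (\<integral>x. A' x * B' x \<partial>M)) \<le> a n * b n + a n * \<beta> + \<alpha> * b n" for n
  proof -
    note d = square_integrable_diff[OF A(1)[of n] A(2)] square_integrable_diff[OF B(1)[of n] B(2)]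
    have "(\<integral>x. A n x * B n x \<partial>M) - (\<integral>x. A' x * B' x \<partial>M) =
        (\<integral>x. A n x * B n x - A' x * B' x \<partial>M)"
      using A B by (simp add: square_integrable_mult)
    also have "\<dots> = (\<integral>x. (A n x - A' x) * (B n x - B' x) + (A n x - A' x) * B' x + A' x * (B n x - B' x) \<partial>M)"
      by (intro Bochner_Integration.integral_cong) (auto simp: algebra_simps)
    also have "\<dots> = (\<integral>x. (A n x - A' x) * (B n x - B' x) \<partial>M) + (\<integral>x. (A n x - A' x) * B' x \<partial>M)
        + (\<integral>x. A' x * (B n x - B' x) \<partial>M)"
      using square_integrable_mult[OF d] square_integrable_mult[OF d(1) B(2)] square_integrable_mult[OF A(2) d(2)]
      by simp
    finally show ?thesis
      using integral_Cauchy_Schwarz[OF d] integral_Cauchy_Schwarz[OF d(1) B(2)] integral_Cauchy_Schwarz[OF A(2) d(2)]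
      unfolding a_def b_def \<alpha>_def \<beta>_def real_norm_def by linarith
  qed
  then show ?thesis
    by (intro LIM_zero_cancel[OF Lim_null_comparison[OF always_eventually z]]) blast
qed

lemma (in prob_space) cov_tendsto:
  assumes A: "\<And>n. square_integrable M (A n)" "square_integrable M A'"
    and B: "\<And>n. square_integrable M (B n)" "square_integrable M B'"
    and lim: "(\<lambda>n. \<integral>x. (A n x - A' x)\<^sup>2 \<partial>M) \<longlonglongrightarrow> 0" "(\<lambda>n. \<integral>x. (B n x - B' x)\<^sup>2 \<partial>M) \<longlonglongrightarrow> 0"
  shows "(\<lambda>n. cov M (A n) (B n)) \<longlonglongrightarrow> cov M A' B'"
proof -
  \<comment> \<open>Expectations are inner products with the constant 1, which is square integrable
    on a probability space, so their limits follow from the same product lemma.\<close>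
  have 1: "square_integrable M (\<lambda>_. 1)" by (simp add: square_integrable_def)
  have "(\<lambda>n. expectation (A n)) \<longlonglongrightarrow> expectation A'" "(\<lambda>n. expectation (B n)) \<longlonglongrightarrow> expectation B'"
    using mean_square_tendsto_product[of M A A' "\<lambda>_ _. 1" "\<lambda>_. 1"] mean_square_tendsto_product[of M B B' "\<lambda>_ _. 1" "\<lambda>_. 1"]
    by (auto simp: assms 1)
  then show ?thesis
    using mean_square_tendsto_product[OF assms] by (auto simp: cov_eq A B intro!: tendsto_intros)
qed

lemma square_integrable_weakly_stationary:
  "weakly_stationary M X \<Longrightarrow> square_integrable M (X t)"
  by (simp add: weakly_stationary_def square_integrable_def)

subsection \<open>Spectral densities of linear filters\<close>

text \<open>A spectral density is constrained on the interval only, so \<open>f\<close> itself may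
  fail to be Borel measurable. The indicator therefore stays attached to \<open>f\<close> when
  measurability of the product is shown.\<close>

lemma set_integrable_bounded_mult:
  fixes f :: "real \<Rightarrow> real" and b :: "real \<Rightarrow> 'a :: {banach, second_countable_topology, real_normed_field}"
  assumes f: "set_integrable lborel S f" and b: "b \<in> borel_measurable borel" "\<And>x. x \<in> S \<Longrightarrow> norm (b x) \<le> C"
  shows "set_integrable lborel S (\<lambda>x. b x * of_real (f x))"
  unfolding set_integrable_def
proof (rule Bochner_Integration.integrable_bound)
  show "integrable lborel (\<lambda>x. C *\<^sub>R (indicator S x *\<^sub>R f x))"
    using f unfolding set_integrable_def by simp
  have "(\<lambda>x. indicator S x * f x) \<in> borel_measurable borel"
    using f by (simp add: set_integrable_def)
  then have "(\<lambda>x. b x * of_real (indicator S x * f x)) \<in> borel_measurable borel"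
    by (intro borel_measurable_times[OF b(1)] measurable_compose[OF _ borel_measurable_continuous_onI[OF continuous_on_of_real_id]])
  then show "(\<lambda>x. indicator S x *\<^sub>R (b x * of_real (f x))) \<in> borel_measurable lborel"
    by (simp add: mult_ac scaleR_conv_of_real)
  have "norm (indicator S x *\<^sub>R (b x * of_real (f x))) \<le> norm (C *\<^sub>R (indicator S x *\<^sub>R f x))" for x
  proof (cases "x \<in> S")
    case True
    have "norm (b x) * \<bar>f x\<bar> \<le> \<bar>C\<bar> * \<bar>f x\<bar>"
      using b(2)[OF True] by (intro mult_right_mono) auto
    then show ?thesis using True by (simp add: norm_mult abs_mult)
  qed simp
  then show "AE x in lborel. norm (indicator S x *\<^sub>R (b x * of_real (f x))) \<le> norm (C *\<^sub>R (indicator S x *\<^sub>R f x))"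
    by (intro AE_I2)
qed

lemma set_integrable_finite_sum:
  fixes f :: "'i \<Rightarrow> 'a \<Rightarrow> 'b :: {banach, second_countable_topology}"
  assumes "\<And>i. i \<in> A \<Longrightarrow> set_integrable M S (f i)"
  shows "set_integrable M S (\<lambda>x. \<Sum>i\<in>A. f i x)"
  using assms unfolding set_integrable_def scaleR_sum_right by (rule Bochner_Integration.integrable_sum)

lemma set_integral_finite_sum:
  fixes f :: "'i \<Rightarrow> 'a \<Rightarrow> 'b :: {banach, second_countable_topology}"
  assumes "\<And>i. i \<in> A \<Longrightarrow> set_integrable M S (f i)"
  shows "(LINT x:S|M. \<Sum>i\<in>A. f i x) = (\<Sum>i\<in>A. LINT x:S|M. f i x)"
  using assms unfolding set_integrable_def set_lebesgue_integral_def scaleR_sum_right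
  by (rule Bochner_Integration.integral_sum)

text \<open>The covariance of the filtered process at lag \<open>h\<close> is the sum of
  \<open>a i * a j\<close> times the covariance of \<open>U\<close> at lag \<open>h - i + j\<close>.
  Under the integral the phase of lag \<open>h - i + j\<close> splits into that of lag
  \<open>h\<close> and the phases of the transfer function and of its conjugate.\<close>

lemma has_spectral_density_filter:
  assumes U: "has_spectral_density M U f"
  shows "has_spectral_density M (\<lambda>t x. \<Sum>k<n. a k * U (t - int k) x)
    (\<lambda>\<omega>. (cmod (\<Sum>k<n. complex_of_real (a k) * cis (real k * \<omega>)))\<^sup>2 * f \<omega>)"
    (is "has_spectral_density M ?V ?g")
proof -
  have ws: "weakly_stationary M U" and f0: "\<And>\<omega>. \<omega> \<in> {-pi<..pi} \<Longrightarrow> 0 \<le> f \<omega>"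
    and fi: "set_integrable lborel {-pi<..pi} f"
    and c: "\<And>t h. complex_of_real (cov M (U (t + h)) (U t)) =
        (CLBINT \<omega>:{-pi<..pi}. cis (of_int h * \<omega>) * complex_of_real (f \<omega>))"
    using U by (auto simp: has_spectral_density_def)
  interpret prob_space M using ws by (simp add: weakly_stationary_def)
  note sq = square_integrable_weakly_stationary[OF ws]
  have cov: "cov M (?V s) (?V t) = (\<Sum>i<n. \<Sum>j<n. a i * a j * cov M (U (s - int i)) (U (t - int j)))" for s t
    by (rule cov_sum) (rule sq)+
  have stat: "cov M (U (s + h)) (U (t + h)) = cov M (U s) (U t)" for s t h
    using ws by (auto simp: weakly_stationary_def)
  have E: "expectation (?V s) = (\<Sum>k<n. a k * expectation (U (s - int k)))" for s
    by (subst Bochner_Integration.integral_sum) (auto intro: square_integrable_integrable sq)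
  have wsV: "weakly_stationary M ?V"
    unfolding weakly_stationary_def
  proof (intro conjI allI)
    show "prob_space M" by (fact prob_space_axioms)
    fix t
    have "square_integrable M (?V t)"
      by (intro square_integrable_sum square_integrable_cmult sq)
    then show "?V t \<in> borel_measurable M" "integrable M (\<lambda>x. (?V t x)\<^sup>2)"
      by (auto simp: square_integrable_def)
    show "expectation (?V s) = expectation (?V t)" for s
      unfolding E using ws by (intro sum.cong refl) (auto simp: weakly_stationary_def)
    show "cov M (?V (s + h)) (?V (t + h)) = cov M (?V s) (?V t)" for s h
      unfolding cov
    proof (intro sum.cong refl arg_cong2[where f = "(*)"])
      fix i j show "cov M (U (s + h - int i)) (U (t + h - int j)) = cov M (U (s - int i)) (U (t - int j))"
        using stat[of "s - int i" h "t - int j"] by (simp add: algebra_simps)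
    qed
  qed
  have gi: "set_integrable lborel {-pi<..pi} ?g"
  proof -
    have "(cmod (\<Sum>k<n. complex_of_real (a k) * cis (real k * x)))\<^sup>2 \<le> (\<Sum>k<n. \<bar>a k\<bar>)\<^sup>2" for x
      by (intro power_mono order_trans[OF norm_sum] sum_mono) (auto simp: norm_mult)
    then show ?thesis
      using set_integrable_bounded_mult[OF fi, of "\<lambda>x. (cmod (\<Sum>k<n. complex_of_real (a k) * cis (real k * x)))\<^sup>2" "(\<Sum>k<n. \<bar>a k\<bar>)\<^sup>2"]
      by (simp add: borel_measurable_continuous_onI continuous_intros)
  qed
  have ci: "set_integrable lborel {-pi<..pi} (\<lambda>\<omega>. cis (of_int h * \<omega>) * complex_of_real (f \<omega>))" for h
    by (rule set_integrable_bounded_mult[OF fi, where C = 1]) (auto intro!: borel_measurable_continuous_onI continuous_intros)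
  have "complex_of_real (cov M (?V (t + h)) (?V t)) = (CLBINT \<omega>:{-pi<..pi}. cis (of_int h * \<omega>) * complex_of_real (?g \<omega>))" for t h
  proof -
    have "complex_of_real (cov M (?V (t + h)) (?V t)) =
      (\<Sum>i<n. \<Sum>j<n. complex_of_real (a i * a j) * complex_of_real (cov M (U ((t - int j) + (h - int i + int j))) (U (t - int j))))"
      unfolding cov of_real_sum of_real_mult
    proof (intro sum.cong refl arg_cong2[where f = "(*)"] arg_cong[where f = of_real])
      fix i j
      have "t + h - int i = t - int j + (h - int i + int j)" by simp
      then show "cov M (U (t + h - int i)) (U (t - int j)) = cov M (U (t - int j + (h - int i + int j))) (U (t - int j))"
        by (simp only:)
    qed
    also have "\<dots> = (\<Sum>i<n. \<Sum>j<n. complex_of_real (a i * a j) *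
        (CLBINT \<omega>:{-pi<..pi}. cis (of_int (h - int i + int j) * \<omega>) * complex_of_real (f \<omega>)))"
      by (intro sum.cong refl arg_cong2[where f = "(*)"] c)
    also have "\<dots> = (\<Sum>i<n. \<Sum>j<n. 
        (CLBINT \<omega>:{-pi<..pi}. complex_of_real (a i * a j) * (cis (of_int (h - int i + int j) * \<omega>) * complex_of_real (f \<omega>))))"
      by (intro sum.cong refl set_integral_mult_right[symmetric])
    also have "\<dots> = (CLBINT \<omega>:{-pi<..pi}. (\<Sum>i<n. \<Sum>j<n. complex_of_real (a i * a j) * (cis (of_int (h - int i + int j) * \<omega>) * complex_of_real (f \<omega>))))"
      by (subst set_integral_finite_sum, intro set_integrable_finite_sum set_integrable_mult_right ci)
        (intro sum.cong refl set_integral_finite_sum[symmetric] set_integrable_mult_right ci)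
    also have "\<dots> = (CLBINT \<omega>:{-pi<..pi}. cis (of_int h * \<omega>) * complex_of_real (?g \<omega>))"
    proof (intro set_lebesgue_integral_cong allI impI)
      fix \<omega> :: real
      have "cis (of_int h * \<omega>) * complex_of_real (?g \<omega>) =
        cis (of_int h * \<omega>) * (cnj (\<Sum>k<n. complex_of_real (a k) * cis (real k * \<omega>)) * (\<Sum>k<n. complex_of_real (a k) * cis (real k * \<omega>))) * complex_of_real (f \<omega>)"
        unfolding of_real_mult complex_norm_square by (simp add: mult_ac)
      also have "\<dots> = (\<Sum>i<n. \<Sum>j<n. cis (of_int h * \<omega>) * (complex_of_real (a i) * cis (- (real i * \<omega>)) * (complex_of_real (a j) * cis (real j * \<omega>))) * complex_of_real (f \<omega>))"
        unfolding cnj_sum sum_product sum_distrib_left sum_distrib_right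
        by (simp add: cis_cnj, subst sum.swap, rule refl)
      also have "\<dots> = (\<Sum>i<n. \<Sum>j<n. complex_of_real (a i * a j) * (cis (of_int (h - int i + int j) * \<omega>) * complex_of_real (f \<omega>)))"
      proof (intro sum.cong refl)
        fix i j
        have e: "cis (of_int h * \<omega>) * cis (- (real i * \<omega>)) * cis (real j * \<omega>) = cis (of_int (h - int i + int j) * \<omega>)"
          unfolding cis_mult by (intro arg_cong[where f = cis]) (simp add: algebra_simps)
        have *: "x * (u * y * (v * w)) * k = u * v * (x * y * w * k)" for x u y v w k :: complex
          by (simp only: mult_ac)
        show "cis (of_int h * \<omega>) * (complex_of_real (a i) * cis (- (real i * \<omega>)) * (complex_of_real (a j) * cis (real j * \<omega>))) * complex_of_real (f \<omega>)
           = complex_of_real (a i * a j) * (cis (of_int (h - int i + int j) * \<omega>) * complex_of_real (f \<omega>))"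
          unfolding * e of_real_mult ..
      qed
      finally show "(\<Sum>i<n. \<Sum>j<n. complex_of_real (a i * a j) * (cis (of_int (h - int i + int j) * \<omega>) * complex_of_real (f \<omega>))) = cis (of_int h * \<omega>) * complex_of_real (?g \<omega>)" ..
    qed auto
    finally show ?thesis .
  qed
  then show ?thesis
    unfolding has_spectral_density_def using wsV gi f0 by auto
qed

lemma cpoly_altdef: "cpoly p z = (\<Sum>k\<le>degree p. complex_of_real (coeff p k) * z ^ k)"
  unfolding cpoly_def poly_altdef by (simp add: coeff_map_poly degree_map_poly)

lemma has_spectral_density_backshift_poly:
  assumes "has_spectral_density M U f"
  shows "has_spectral_density M (backshift_poly p U) (\<lambda>\<omega>. (cmod (cpoly p (cis \<omega>)))\<^sup>2 * f \<omega>)"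
proof -
  have "backshift_poly p U = (\<lambda>t x. \<Sum>k<Suc (degree p). coeff p k * U (t - int k) x)"
    by (intro ext) (simp only: backshift_poly_def lessThan_Suc_atMost)
  moreover have "cpoly p (cis \<omega>) = (\<Sum>k<Suc (degree p). complex_of_real (coeff p k) * cis (real k * \<omega>))" for \<omega>
    by (simp only: cpoly_altdef lessThan_Suc_atMost Complex.DeMoivre)
  ultimately show ?thesis
    using has_spectral_density_filter[OF assms, of "coeff p" "Suc (degree p)"] by (simp only:)
qed

lemma CLBINT_cis:
  "(CLBINT \<omega>:{-pi<..pi}. cis (of_int h * \<omega>)) = (if h = 0 then 2 * pi else 0)"
proof -
  \<comment> \<open>The fundamental theorem of calculus is applied on a closed interval; the added
    endpoint is a null set.\<close>
  have "(CLBINT \<omega>:{-pi<..pi}. cis (of_int h * \<omega>)) = (CLBINT \<omega>:{-pi..pi}. cis (of_int h * \<omega>))"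
    by (rule set_integral_discrete_difference[where X = "{-pi}"]) auto
  also have "\<dots> = (if h = 0 then 2 * pi else 0)"
  proof (cases "h = 0")
    case True
    then show ?thesis by (simp add: set_lebesgue_integral_def scaleR_conv_of_real)
  next
    case False
    have "(CLBINT \<omega>:{-pi..pi}. cis (of_int h * \<omega>)) =
      cis (of_int h * pi) / (\<i> * of_int h) - cis (of_int h * (- pi)) / (\<i> * of_int h)"
      unfolding set_lebesgue_integral_def
    proof (rule integral_FTC_Icc)
      fix x
      have "((\<lambda>z. exp (\<i> * of_int h * z) / (\<i> * of_int h)) has_field_derivative exp (\<i> * of_int h * of_real x)) (at (of_real x))"
        using False by (auto intro!: derivative_eq_intros)
      from has_vector_derivative_real_field[OF this]
      show "((\<lambda>x. cis (of_int h * x) / (\<i> * of_int h)) has_vector_derivative cis (of_int h * x)) (at x within {-pi..pi})"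
        by (simp add: cis_conv_exp mult.assoc)
    qed (auto intro!: continuous_intros)
    also have "\<dots> = 0"
    proof -
      have "cis (of_int h * pi) = cis (of_int h * (- pi))"
        using sin_npi_int[of h] by (simp add: complex_eq_iff mult.commute)
      then show ?thesis by simp
    qed
    finally show ?thesis using False by simp
  qed
  finally show ?thesis .
qed

lemma has_spectral_density_white_noise:
  assumes "white_noise M v \<epsilon>"
  shows "has_spectral_density M \<epsilon> (\<lambda>_. v / (2 * pi))"
proof -
  have c: "cov M (\<epsilon> s) (\<epsilon> t) = (if s = t then v else 0)" for s t
    using assms by (auto simp: white_noise_def)
  \<comment> \<open>\<open>white_noise\<close> does not state a sign for \<open>v\<close>; it is
    nonnegative as a variance.\<close>
  have "0 \<le> cov M (\<epsilon> 0) (\<epsilon> 0)"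
    unfolding cov_def by (intro Bochner_Integration.integral_nonneg) simp
  then have "0 \<le> v" using c[of 0 0] by simp
  moreover have "weakly_stationary M \<epsilon>"
    using assms unfolding weakly_stationary_def c by (auto simp: white_noise_def)
  moreover have "set_integrable lborel {-pi<..pi} (\<lambda>_. v / (2 * pi))"
    by (simp add: set_integrable_def)
  moreover have "complex_of_real (cov M (\<epsilon> (t + h)) (\<epsilon> t)) =
     (CLBINT \<omega>:{-pi<..pi}. cis (of_int h * \<omega>) * complex_of_real (v / (2 * pi)))" for t h
    unfolding c by (subst set_integral_mult_left) (simp add: CLBINT_cis)
  ultimately show ?thesis
    by (simp add: has_spectral_density_def)
qed

subsection \<open>Uniqueness of Fourier coefficients\<close>

definition trig_poly :: "(real \<Rightarrow> complex) \<Rightarrow> bool" where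
  "trig_poly p \<longleftrightarrow> (\<exists>A c. finite A \<and> (\<forall>t. p t = (\<Sum>h\<in>A. c h * cis (of_int h * t))))"

lemma trig_poly_cis: "trig_poly (\<lambda>t. c * cis (of_int h * t))"
  unfolding trig_poly_def by (intro exI[of _ "{h}"] exI[of _ "\<lambda>_. c"]) simp

lemma trig_poly_add:
  assumes "trig_poly p" "trig_poly q"
  shows "trig_poly (\<lambda>t. p t + q t)"
proof -
  obtain A c where A: "finite A" "\<And>t. p t = (\<Sum>h\<in>A. c h * cis (of_int h * t))"
    using assms(1) by (auto simp: trig_poly_def)
  obtain B d where B: "finite B" "\<And>t. q t = (\<Sum>h\<in>B. d h * cis (of_int h * t))"
    using assms(2) by (auto simp: trig_poly_def)
  have "p t + q t = (\<Sum>h\<in>A\<union>B. ((if h \<in> A then c h else 0) + (if h \<in> B then d h else 0)) * cis (of_int h * t))" for t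
    unfolding A(2) B(2) distrib_right sum.distrib using A(1) B(1)
    by (intro arg_cong2[where f = "(+)"] sum.mono_neutral_cong_left) auto
  then show ?thesis
    unfolding trig_poly_def using A(1) B(1) by (intro exI[of _ "A \<union> B"] exI conjI) auto
qed

lemma trig_poly_sum:
  "finite A \<Longrightarrow> (\<And>i. i \<in> A \<Longrightarrow> trig_poly (p i)) \<Longrightarrow> trig_poly (\<lambda>t. \<Sum>i\<in>A. p i t)"
proof (induction A rule: finite_induct)
  case empty
  show ?case unfolding trig_poly_def by (intro exI[of _ "{}"]) simp
qed (simp add: trig_poly_add)

lemma trig_poly_mult:
  assumes "trig_poly p" "trig_poly q"
  shows "trig_poly (\<lambda>t. p t * q t)"
proof -
  obtain A c where A: "finite A" "\<And>t. p t = (\<Sum>h\<in>A. c h * cis (of_int h * t))"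
    using assms(1) by (auto simp: trig_poly_def)
  obtain B d where B: "finite B" "\<And>t. q t = (\<Sum>h\<in>B. d h * cis (of_int h * t))"
    using assms(2) by (auto simp: trig_poly_def)
  have "p t * q t = (\<Sum>h\<in>A. \<Sum>k\<in>B. (c h * d k) * cis (of_int (h + k) * t))" for t
    unfolding A(2) B(2) sum_product by (intro sum.cong refl) (simp add: cis_mult[symmetric] algebra_simps)
  moreover have "trig_poly (\<lambda>t. \<Sum>h\<in>A. \<Sum>k\<in>B. (c h * d k) * cis (of_int (h + k) * t))"
    using A(1) B(1) by (intro trig_poly_sum trig_poly_cis)
  ultimately show ?thesis by simp
qed

text \<open>This translates the polynomials delivered by the Stone-Weierstrass theorem into
  functions whose integrals against \<open>f\<close> and \<open>g\<close> are determined by Fourier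
  coefficients. A real linear form on the plane restricts to a combination of cos and sin on the
  circle; sums and products preserve the class.\<close>

lemma trig_poly_real_polynomial_function:
  fixes g :: "complex \<Rightarrow> real"
  assumes "real_polynomial_function g"
  shows "trig_poly (\<lambda>t. complex_of_real (g (cis t)))"
  using assms
proof (induction g rule: real_polynomial_function.induct)
  case (linear f)
  interpret bounded_linear f by fact
  have "f (cis t) = cos t * f 1 + sin t * f \<i>" for t
  proof -
    have "cis t = cos t *\<^sub>R 1 + sin t *\<^sub>R \<i>" by (simp add: complex_eq_iff)
    then have "f (cis t) = f (cos t *\<^sub>R 1 + sin t *\<^sub>R \<i>)" by (rule arg_cong)
    then show ?thesis by (simp add: add scale)
  qed
  \<comment> \<open>Euler's formulas for cos and sin; the two coefficients are conjugate because the
    value is real.\<close>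
  then have e: "complex_of_real (f (cis t)) =
      Complex (f 1 / 2) (- f \<i> / 2) * cis (of_int 1 * t) + Complex (f 1 / 2) (f \<i> / 2) * cis (of_int (-1) * t)" for t
    by (simp add: complex_eq_iff)
  show ?case
    unfolding e by (rule trig_poly_add[OF trig_poly_cis trig_poly_cis])
next
  case (const c)
  then show ?case using trig_poly_cis[of "of_real c" 0] by simp
next
  case (add f g)
  then show ?case using trig_poly_add by simp
next
  case (mult f g)
  then show ?case using trig_poly_mult by simp
qed

context
  fixes f g :: "real \<Rightarrow> real"
  assumes f: "set_integrable lborel {-pi<..pi} f" and g: "set_integrable lborel {-pi<..pi} g"
    and fourier: "\<And>h. (CLBINT \<omega>:{-pi<..pi}. cis (of_int h * \<omega>) * complex_of_real (f \<omega>)) =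
      (CLBINT \<omega>:{-pi<..pi}. cis (of_int h * \<omega>) * complex_of_real (g \<omega>))"
begin

lemma set_integral_trig_poly_eq:
  assumes "trig_poly p"
  shows "(CLBINT \<omega>:{-pi<..pi}. p \<omega> * complex_of_real (f \<omega>)) = (CLBINT \<omega>:{-pi<..pi}. p \<omega> * complex_of_real (g \<omega>))"
proof -
  obtain A c where A: "finite A" "\<And>t. p t = (\<Sum>h\<in>A. c h * cis (of_int h * t))"
    using assms by (auto simp: trig_poly_def)
  have *: "(CLBINT \<omega>:{-pi<..pi}. p \<omega> * complex_of_real (k \<omega>)) =
     (\<Sum>h\<in>A. c h * (CLBINT \<omega>:{-pi<..pi}. cis (of_int h * \<omega>) * complex_of_real (k \<omega>)))"
    if k: "set_integrable lborel {-pi<..pi} k" for k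
  proof -
    have i: "set_integrable lborel {-pi<..pi} (\<lambda>\<omega>. cis (of_int h * \<omega>) * complex_of_real (k \<omega>))" for h
      by (rule set_integrable_bounded_mult[OF k, where C = 1])
        (auto intro!: borel_measurable_continuous_onI continuous_intros)
    have "(CLBINT \<omega>:{-pi<..pi}. p \<omega> * complex_of_real (k \<omega>)) =
      (CLBINT \<omega>:{-pi<..pi}. (\<Sum>h\<in>A. c h * (cis (of_int h * \<omega>) * complex_of_real (k \<omega>))))"
      unfolding A(2) sum_distrib_right by (simp add: mult.assoc)
    also have "\<dots> = (\<Sum>h\<in>A. (CLBINT \<omega>:{-pi<..pi}. c h * (cis (of_int h * \<omega>) * complex_of_real (k \<omega>))))"
      by (intro set_integral_finite_sum set_integrable_mult_right i)
    also have "\<dots> = (\<Sum>h\<in>A. c h * (CLBINT \<omega>:{-pi<..pi}. cis (of_int h * \<omega>) * complex_of_real (k \<omega>)))"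
      by (intro sum.cong refl set_integral_mult_right) 
    finally show ?thesis .
  qed
  show ?thesis unfolding *[OF f] *[OF g] fourier ..
qed

text \<open>Test functions are taken on the circle, so they agree at the two ends of the interval. A
  uniform approximation by trigonometric polynomials with error \<open>e\<close> changes the two
  integrals by at most \<open>e\<close> times the sum \<open>N\<close> of the L1 norms.\<close>

lemma set_integral_continuous_circle_eq:
  fixes k :: "complex \<Rightarrow> real"
  assumes k: "continuous_on UNIV k"
  shows "(LBINT \<omega>:{-pi<..pi}. k (cis \<omega>) * f \<omega>) = (LBINT \<omega>:{-pi<..pi}. k (cis \<omega>) * g \<omega>)"
proof -
  define N where "N = (LBINT \<omega>:{-pi<..pi}. \<bar>f \<omega>\<bar>) + (LBINT \<omega>:{-pi<..pi}. \<bar>g \<omega>\<bar>)"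
  have N0: "0 \<le> N" 
    unfolding N_def set_lebesgue_integral_def by (intro add_nonneg_nonneg integral_nonneg) auto
  have b: "bounded (k ` sphere 0 1)"
    using k by (intro compact_imp_bounded compact_continuous_image) (auto intro: continuous_on_subset)
  have approx: "\<bar>(LBINT \<omega>:{-pi<..pi}. k (cis \<omega>) * f \<omega>) - (LBINT \<omega>:{-pi<..pi}. k (cis \<omega>) * g \<omega>)\<bar> \<le> e * N" if e: "e > 0" for e
  proof -
    obtain p where p: "real_polynomial_function p" "\<And>z. z \<in> sphere 0 1 \<Longrightarrow> \<bar>k z - p z\<bar> < e"
      using Stone_Weierstrass_real_polynomial_function[of "sphere 0 1 :: complex set" k e] k e
      by (metis compact_sphere continuous_on_subset subset_UNIV)
    have pc: "continuous_on UNIV p"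
      using p(1) real_polynomial_function_eq continuous_on_polymonial_function by blast
    have pe: "(LBINT \<omega>:{-pi<..pi}. p (cis \<omega>) * f \<omega>) = (LBINT \<omega>:{-pi<..pi}. p (cis \<omega>) * g \<omega>)"
      using set_integral_trig_poly_eq[OF trig_poly_real_polynomial_function[OF p(1)]]
      unfolding of_real_mult[symmetric] set_integral_complex_of_real by simp
    have bm: "(\<lambda>\<omega>. q (cis \<omega>)) \<in> borel_measurable borel" if "continuous_on UNIV q" for q :: "complex \<Rightarrow> real"
      by (intro borel_measurable_continuous_onI continuous_on_compose2[OF that] continuous_intros) auto
    have bd: "\<exists>C. \<forall>\<omega>. norm (q (cis \<omega>)) \<le> C" if "continuous_on UNIV q" for q :: "complex \<Rightarrow> real"
    proof -
      have "bounded (q ` sphere 0 1)"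
        using that by (intro compact_imp_bounded compact_continuous_image) (auto intro: continuous_on_subset)
      then obtain C where "\<And>z. z \<in> sphere 0 1 \<Longrightarrow> norm (q z) \<le> C" unfolding bounded_iff by blast
      then show ?thesis by (intro exI[of _ C]) simp
    qed
    have i: "set_integrable lborel {-pi<..pi} (\<lambda>\<omega>. q (cis \<omega>) * u \<omega>)"
      if "continuous_on UNIV q" "set_integrable lborel {-pi<..pi} u" for q :: "complex \<Rightarrow> real" and u
      using bd[OF that(1)] set_integrable_bounded_mult[OF that(2) bm[OF that(1)]] by fastforce
    have one: "\<bar>(LBINT \<omega>:{-pi<..pi}. k (cis \<omega>) * u \<omega>) - (LBINT \<omega>:{-pi<..pi}. p (cis \<omega>) * u \<omega>)\<bar> \<le> e * (LBINT \<omega>:{-pi<..pi}. \<bar>u \<omega>\<bar>)"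
      if u: "set_integrable lborel {-pi<..pi} u" for u
    proof -
      have "(LBINT \<omega>:{-pi<..pi}. k (cis \<omega>) * u \<omega>) - (LBINT \<omega>:{-pi<..pi}. p (cis \<omega>) * u \<omega>) =
         (LBINT \<omega>:{-pi<..pi}. (k (cis \<omega>) - p (cis \<omega>)) * u \<omega>)"
        by (simp add: left_diff_distrib set_integral_diff(2)[OF i[OF k u] i[OF pc u]])
      also have "\<bar>\<dots>\<bar> \<le> (LBINT \<omega>:{-pi<..pi}. e * \<bar>u \<omega>\<bar>)"
        unfolding set_lebesgue_integral_def real_norm_def[symmetric]
      proof (rule Bochner_Integration.integral_norm_bound_integral)
        show "integrable lborel (\<lambda>x. indicat_real {-pi<..pi} x *\<^sub>R ((k (cis x) - p (cis x)) * u x))"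
          using i[OF continuous_on_diff[OF k pc] u] by (simp add: set_integrable_def)
        show "integrable lborel (\<lambda>x. indicat_real {-pi<..pi} x *\<^sub>R (e * norm (u x)))"
          using set_integrable_mult_right[OF set_integrable_abs[OF u], of e] by (simp add: set_integrable_def)
        fix x show "norm (indicat_real {-pi<..pi} x *\<^sub>R ((k (cis x) - p (cis x)) * u x)) \<le> indicat_real {-pi<..pi} x *\<^sub>R (e * norm (u x))"
          using p(2)[of "cis x"] by (auto simp: indicator_def abs_mult intro!: mult_right_mono)
      qed
      finally show ?thesis by simp
    qed
    show ?thesis
      using one[OF f] one[OF g] pe unfolding N_def by (simp add: algebra_simps)
  qed
  have "\<bar>(LBINT \<omega>:{-pi<..pi}. k (cis \<omega>) * f \<omega>) - (LBINT \<omega>:{-pi<..pi}. k (cis \<omega>) * g \<omega>)\<bar> \<le> 0"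
  proof (rule field_le_epsilon)
    fix e :: real assume e: "0 < e"
    \<comment> \<open>\<open>N + 1\<close> replaces \<open>N\<close> so that the quotient makes
      sense when \<open>N\<close> is 0.\<close>
    have "e / (N + 1) * N \<le> e" using N0 e by (simp add: field_simps)
    then show "\<bar>(LBINT \<omega>:{-pi<..pi}. k (cis \<omega>) * f \<omega>) - (LBINT \<omega>:{-pi<..pi}. k (cis \<omega>) * g \<omega>)\<bar> \<le> 0 + e"
      using approx[of "e / (N + 1)"] N0 e by simp
  qed
  then show ?thesis by simp
qed

text \<open>The indicator of an open arc is the pointwise limit of the continuous functions min 1 (n
  dist(., A)) with \<open>A\<close> the complementary closed arc; dominated convergence carries the
  equality over.\<close>

lemma set_integral_arc_eq:
  assumes x: "-pi \<le> x" "x < pi"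
  shows "(LBINT \<omega>:{x<..pi}. f \<omega>) = (LBINT \<omega>:{x<..pi}. g \<omega>)"
proof -
  \<comment> \<open>\<open>A\<close> contains -1, the image of both -pi and pi. The limit is
    therefore the indicator of the open interval from \<open>x\<close> to pi, which differs from the
    half-open one by a null set.\<close>
  define A where "A = cis ` {-pi..x}"
  have A: "closed A" "A \<noteq> {}"
    using x unfolding A_def by (auto intro!: compact_imp_closed compact_continuous_image continuous_intros)
  define k where "k n z = min 1 (real n * infdist z A)" for n z
  have k: "continuous_on UNIV (k n)" for n
    unfolding k_def by (intro continuous_intros)
  have k01: "norm (k n z) \<le> 1" for n z
    by (simp add: k_def infdist_nonneg)
  have lim: "(\<lambda>n. k n (cis \<omega>)) \<longlonglongrightarrow> indicator {x<..<pi} \<omega>" if \<omega>: "\<omega> \<in> {-pi<..pi}" for \<omega>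
  proof (cases "cis \<omega> \<in> A")
    case True
    have "\<omega> \<notin> {x<..<pi}"
    proof
      assume o: "\<omega> \<in> {x<..<pi}"
      from True obtain t where t: "t \<in> {-pi..x}" "cis \<omega> = cis t" by (auto simp: A_def)
      have "cis (\<omega> - t) = 1" using t(2) by (simp flip: cis_divide)
      then have "cos (\<omega> - t) = 1" by (simp add: complex_eq_iff)
      then obtain n :: int where n: "\<omega> - t = of_int n * 2 * pi"
        by (auto simp: cos_one_2pi_int)
      have "0 < \<omega> - t" "\<omega> - t < 2 * pi"
        using o t(1) by auto
      then have "0 < real_of_int n" "real_of_int n * (2 * pi) < 1 * (2 * pi)"
        unfolding n by (simp_all add: zero_less_mult_iff)
      then have "0 < n" "n < 1" by (simp_all add: mult_less_cancel_right)
      then show False by simp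
    qed
    then show ?thesis using True by (simp add: k_def)
  next
    case False
    then have "0 < infdist (cis \<omega>) A"
      using A infdist_pos_not_in_closed by blast
    moreover have "\<omega> \<in> {x<..<pi}"
    proof -
      have "cis pi \<in> A" unfolding A_def using x by (intro image_eqI[of _ _ "-pi"]) (auto simp: complex_eq_iff)
      then have "\<omega> \<noteq> pi" using False by auto
      moreover have "\<not> \<omega> \<le> x" using False \<omega> by (auto simp: A_def)
      ultimately show ?thesis using \<omega> by auto
    qed
    moreover have "eventually (\<lambda>n. 1 \<le> real n * infdist (cis \<omega>) A) sequentially"
      using \<open>0 < infdist (cis \<omega>) A\<close> by real_asymp
    ultimately show ?thesis
      by (intro tendsto_eventually) (auto simp: k_def elim!: eventually_mono)
  qed
  have key: "(\<lambda>n. LBINT \<omega>:{-pi<..pi}. k n (cis \<omega>) * u \<omega>) \<longlonglongrightarrow> (LBINT \<omega>:{x<..pi}. u \<omega>)"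
    if u: "set_integrable lborel {-pi<..pi} u" for u
  proof -
    have um: "(\<lambda>\<omega>. indicator {-pi<..pi} \<omega> * u \<omega>) \<in> borel_measurable borel"
      using u by (simp add: set_integrable_def)
    have "(\<lambda>n. LBINT \<omega>:{-pi<..pi}. k n (cis \<omega>) * u \<omega>) \<longlonglongrightarrow> (LBINT \<omega>:{-pi<..pi}. indicator {x<..<pi} \<omega> * u \<omega>)"
      unfolding set_lebesgue_integral_def
    proof (rule integral_dominated_convergence[where w = "\<lambda>\<omega>. norm (indicator {-pi<..pi} \<omega> *\<^sub>R u \<omega>)"])
      have "(\<lambda>\<omega>. indicator {x<..<pi} \<omega> * (indicator {-pi<..pi} \<omega> * u \<omega>)) \<in> borel_measurable borel"
        using um by simp
      then show "(\<lambda>\<omega>. indicator {-pi<..pi} \<omega> *\<^sub>R (indicator {x<..<pi} \<omega> * u \<omega>)) \<in> borel_measurable lborel"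
        by (simp add: mult_ac)
      have "(\<lambda>\<omega>. k n (cis \<omega>) * (indicator {-pi<..pi} \<omega> * u \<omega>)) \<in> borel_measurable borel" for n
        by (intro borel_measurable_times[OF _ um]) (auto intro!: borel_measurable_continuous_onI continuous_on_compose2[OF k] continuous_intros)
      then show "(\<lambda>\<omega>. indicator {-pi<..pi} \<omega> *\<^sub>R (k n (cis \<omega>) * u \<omega>)) \<in> borel_measurable lborel" for n
        by (simp add: mult_ac)
      show "integrable lborel (\<lambda>\<omega>. norm (indicator {-pi<..pi} \<omega> *\<^sub>R u \<omega>))"
        using u unfolding set_integrable_def by (rule integrable_norm)
      show "AE \<omega> in lborel. (\<lambda>n. indicator {-pi<..pi} \<omega> *\<^sub>R (k n (cis \<omega>) * u \<omega>)) \<longlonglongrightarrow> indicator {-pi<..pi} \<omega> *\<^sub>R (indicator {x<..<pi} \<omega> * u \<omega>)"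
      proof (intro AE_I2)
        fix \<omega> show "(\<lambda>n. indicator {-pi<..pi} \<omega> *\<^sub>R (k n (cis \<omega>) * u \<omega>)) \<longlonglongrightarrow> indicator {-pi<..pi} \<omega> *\<^sub>R (indicator {x<..<pi} \<omega> * u \<omega>)"
          using lim[of \<omega>] by (cases "\<omega> \<in> {-pi<..pi}") (auto intro!: tendsto_intros)
      qed
      show "AE \<omega> in lborel. norm (indicator {-pi<..pi} \<omega> *\<^sub>R (k n (cis \<omega>) * u \<omega>)) \<le> norm (indicator {-pi<..pi} \<omega> *\<^sub>R u \<omega>)" for n
        using k01[of n] by (intro AE_I2) (auto simp: indicator_def abs_mult intro!: mult_left_le_one_le)
    qed
    also have "(LBINT \<omega>:{-pi<..pi}. indicator {x<..<pi} \<omega> * u \<omega>) = (LBINT \<omega>:{x<..<pi}. u \<omega>)"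
      unfolding set_lebesgue_integral_def using x
      by (intro Bochner_Integration.integral_cong) (auto simp: indicator_def)
    also have "\<dots> = (LBINT \<omega>:{x<..pi}. u \<omega>)"
      by (rule set_integral_discrete_difference[where X = "{pi}"]) auto
    finally show ?thesis .
  qed
  show ?thesis
    using key[OF f] key[OF g] LIMSEQ_unique unfolding set_integral_continuous_circle_eq[OF k] by blast
qed

end

text \<open>Being nonnegative and integrable, both functions are densities of finite measures. These
  agree on all half-lines, hence everywhere, and a density is unique up to a null set.\<close>

lemma fourier_coefficients_unique:
  fixes f g :: "real \<Rightarrow> real"
  assumes f: "set_integrable lborel {-pi<..pi} f" and g: "set_integrable lborel {-pi<..pi} g"
    and f0: "\<And>\<omega>. \<omega> \<in> {-pi<..pi} \<Longrightarrow> 0 \<le> f \<omega>" and g0: "\<And>\<omega>. \<omega> \<in> {-pi<..pi} \<Longrightarrow> 0 \<le> g \<omega>"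
    and fourier: "\<And>h. (CLBINT \<omega>:{-pi<..pi}. cis (of_int h * \<omega>) * complex_of_real (f \<omega>)) =
      (CLBINT \<omega>:{-pi<..pi}. cis (of_int h * \<omega>) * complex_of_real (g \<omega>))"
  shows "AE \<omega> in lborel. \<omega> \<in> {-pi<..pi} \<longrightarrow> f \<omega> = g \<omega>"
proof -
  define F G where "F \<omega> = indicator {-pi<..pi} \<omega> * f \<omega>" and "G \<omega> = indicator {-pi<..pi} \<omega> * g \<omega>" for \<omega>
  have [measurable]: "F \<in> borel_measurable borel" "G \<in> borel_measurable borel"
    using f g unfolding F_def[abs_def] G_def[abs_def] by (simp_all add: set_integrable_def)
  \<comment> \<open>Truncating at -pi brings every half-line into the range where equality of the
    arc integrals is available.\<close>
  have em: "emeasure (density lborel U) {x<..} = ennreal (LBINT \<omega>:{max x (-pi)<..pi}. u \<omega>)"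
    if U: "\<And>\<omega>. U \<omega> = indicator {-pi<..pi} \<omega> * u \<omega>" and u: "set_integrable lborel {-pi<..pi} u"
      "\<And>\<omega>. \<omega> \<in> {-pi<..pi} \<Longrightarrow> 0 \<le> u \<omega>" for U u :: "real \<Rightarrow> real" and x
  proof -
    have [measurable]: "(\<lambda>\<omega>. indicator {-pi<..pi} \<omega> * u \<omega>) \<in> borel_measurable borel"
      using u(1) by (simp add: set_integrable_def)
    have Um[measurable]: "U \<in> borel_measurable borel" unfolding U[abs_def] by measurable
    have s: "set_integrable lborel {max x (-pi)<..pi} u"
      by (rule set_integrable_subset[OF u(1)]) auto
    have "emeasure (density lborel U) {x<..} = (\<integral>\<^sup>+\<omega>. ennreal (U \<omega>) * indicator {x<..} \<omega> \<partial>lborel)"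
      by (rule emeasure_density) auto
    also have "\<dots> = (\<integral>\<^sup>+\<omega>. ennreal (indicator {max x (-pi)<..pi} \<omega> *\<^sub>R u \<omega>) \<partial>lborel)"
      by (intro nn_integral_cong) (auto simp: U indicator_def)
    also have "\<dots> = ennreal (LBINT \<omega>:{max x (-pi)<..pi}. u \<omega>)"
      using s unfolding set_lebesgue_integral_def set_integrable_def
      by (intro nn_integral_eq_integral) (auto simp: indicator_def u(2))
    finally show ?thesis .
  qed
  have "density lborel F = density lborel G"
  proof (rule measure_eqI_lessThan)
    fix x
    show "emeasure (density lborel F) {x<..} < \<infinity>"
      by (subst em[OF F_def f f0]) auto
    show "emeasure (density lborel F) {x<..} = emeasure (density lborel G) {x<..}"
    proof (cases "max x (-pi) < pi")
      case True
      then show ?thesis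
        using set_integral_arc_eq[OF f g fourier, of "max x (-pi)"] by (simp only: em[OF F_def f f0] em[OF G_def g g0])
    next
      case False
      then have "{max x (-pi)<..pi} = {}" by auto
      then show ?thesis by (simp only: em[OF F_def f f0] em[OF G_def g g0]) (simp add: set_lebesgue_integral_def)
    qed
  qed auto
  moreover have "integrable lborel F" "integrable lborel G"
    using f g by (simp_all add: set_integrable_def F_def[abs_def] G_def[abs_def])
  ultimately have "AE \<omega> in lborel. ennreal (F \<omega>) = ennreal (G \<omega>)"
    by (intro sigma_finite_measure.density_unique[OF sigma_finite_lborel]) auto
  then show ?thesis
    by (rule AE_mp) (intro AE_I2, auto simp: F_def G_def f0 g0)
qed

subsection \<open>Real powers of formal power series\<close>

text \<open>The binomial series evaluated at F - 1. It behaves as a power when \<open>F\<close> has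
  constant term 1, because only then is the inner series of the composition free of a constant
  term.\<close>

definition fps_powr :: "'a :: field_char_0 fps \<Rightarrow> 'a \<Rightarrow> 'a fps" where
  "fps_powr F a = fps_binomial a oo (F - 1)"

lemma fps_powr_nth_0 [simp]: "fps_nth (fps_powr F a) 0 = 1"
  by (simp add: fps_powr_def)

lemma fps_powr_1 [simp]: "fps_powr 1 a = 1"
  by (simp add: fps_powr_def)

lemma fps_powr_add:
  assumes "fps_nth F 0 = 1"
  shows "fps_powr F (a + b) = fps_powr F a * fps_powr F b"
  using assms by (simp add: fps_powr_def fps_binomial_add_mult fps_compose_mult_distrib)

lemma fps_powr_0 [simp]: "fps_nth F 0 = 1 \<Longrightarrow> fps_powr F 0 = 1"
  using fps_binomial_of_nat[of 0] by (simp add: fps_powr_def)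

lemma fps_powr_sum:
  assumes "fps_nth F 0 = 1"
  shows "fps_powr F (\<Sum>i\<in>A. a i) = (\<Prod>i\<in>A. fps_powr F (a i))"
  using assms by (induction A rule: infinite_finite_induct) (simp_all add: fps_powr_add)

text \<open>Chain rule applied to (1 + X) b' = a b for the binomial series b.\<close>

lemma fps_powr_deriv:
  assumes "fps_nth F 0 = 1"
  shows "F * fps_deriv (fps_powr F a) = fps_const a * fps_deriv F * fps_powr F a"
proof -
  have "(1 + fps_X) * fps_deriv (fps_binomial a) = fps_const a * fps_binomial a"
    unfolding fps_binomial_deriv by (simp add: fps_divide_unit mult.left_commute inverse_mult_eq_1')
  then have "((1 + fps_X) * fps_deriv (fps_binomial a)) oo (F - 1) = (fps_const a * fps_binomial a) oo (F - 1)"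
    by simp
  then have "F * (fps_deriv (fps_binomial a) oo (F - 1)) = fps_const a * fps_powr F a"
    using assms by (simp add: fps_compose_mult_distrib fps_compose_add_distrib fps_powr_def)
  then show ?thesis
    using assms by (simp add: fps_powr_def fps_compose_deriv mult_ac)
qed

text \<open>For the difference w of two solutions, comparing coefficients at X^m expresses (m + 1)
  w_(m+1) through earlier coefficients of w, since \<open>H\<close> has constant term 1. All of them
  vanish by induction.\<close>

lemma fps_linear_ODE_unique:
  fixes H K y z :: "'a :: field_char_0 fps"
  assumes H: "fps_nth H 0 = 1" and y: "H * fps_deriv y = K * y" and z: "H * fps_deriv z = K * z"
    and 0: "fps_nth y 0 = fps_nth z 0"
  shows "y = z"
proof -
  define w where "w = y - z"
  have w: "H * fps_deriv w = K * w"
    using y z by (simp add: w_def algebra_simps)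
  have "fps_nth w n = 0" for n
  proof (induction n rule: less_induct)
    case (less n)
    show ?case
    proof (cases n)
      case 0
      then show ?thesis using assms(4) by (simp add: w_def)
    next
      case (Suc m)
      have "fps_nth (H * fps_deriv w) m = (\<Sum>i=0..m. fps_nth H i * (of_nat (Suc (m - i)) * fps_nth w (Suc (m - i))))"
        by (simp add: fps_mult_nth del: of_nat_Suc)
      also have "\<dots> = (\<Sum>i\<in>{0}. fps_nth H i * (of_nat (Suc (m - i)) * fps_nth w (Suc (m - i))))"
        using less Suc by (intro sum.mono_neutral_right) auto
      also have "\<dots> = of_nat (Suc m) * fps_nth w (Suc m)" using H by simp
      finally have "of_nat (Suc m) * fps_nth w (Suc m) = fps_nth (K * w) m" using w by simp
      also have "\<dots> = 0"
        unfolding fps_mult_nth using less Suc by (intro sum.neutral) auto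
      finally show ?thesis unfolding Suc by (simp del: of_nat_Suc)
    qed
  qed
  then show ?thesis by (simp add: w_def fps_eq_iff)
qed

text \<open>Both sides have constant term 1 and solve the linear equation (F G) y' = a (F G)'
  y.\<close>

lemma fps_powr_mult:
  assumes F: "fps_nth F 0 = 1" and G: "fps_nth G 0 = 1"
  shows "fps_powr (F * G) a = fps_powr F a * fps_powr G a"
proof (rule fps_linear_ODE_unique)
  show "fps_nth (F * G) 0 = 1" using F G by simp
  then show "F * G * fps_deriv (fps_powr (F * G) a) = fps_const a * fps_deriv (F * G) * fps_powr (F * G) a"
    by (rule fps_powr_deriv)
  have "F * G * fps_deriv (fps_powr F a * fps_powr G a) =
    F * fps_deriv (fps_powr F a) * G * fps_powr G a + G * fps_deriv (fps_powr G a) * F * fps_powr F a"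
    by (simp add: algebra_simps)
  also have "\<dots> = fps_const a * fps_deriv (F * G) * (fps_powr F a * fps_powr G a)"
    unfolding fps_powr_deriv[OF F] fps_powr_deriv[OF G] by (simp add: algebra_simps)
  finally show "F * G * fps_deriv (fps_powr F a * fps_powr G a) = fps_const a * fps_deriv (F * G) * (fps_powr F a * fps_powr G a)" .
qed simp

lemma fps_powr_prod:
  assumes "\<And>i. i \<in> A \<Longrightarrow> fps_nth (F i) 0 = 1"
  shows "fps_powr (\<Prod>i\<in>A. F i) a = (\<Prod>i\<in>A. fps_powr (F i) a)"
  using assms
proof (induction A rule: infinite_finite_induct)
  case (insert i A)
  have "fps_nth (\<Prod>i\<in>A. F i) 0 = (\<Prod>i\<in>A. fps_nth (F i) 0)"
    using insert.hyps(1) by (induction A rule: finite_induct) auto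
  then show ?case using insert by (simp add: fps_powr_mult)
qed auto

lemma fps_powr_linear_nth:
  "fps_nth (fps_powr (1 - fps_const c * fps_X) a) k = (a gchoose k) * (- c) ^ k"
proof -
  have "fps_powr (1 - fps_const c * fps_X) a = fps_binomial a oo (fps_const (- c) * fps_X)"
    by (simp add: fps_powr_def flip: fps_const_neg)
  then show ?thesis by (simp only: fps_compose_linear) simp
qed

text \<open>Both sides have degree at most n and agree at n + 1 points: 0 and the n-th roots of
  unity.\<close>

lemma prod_roots_of_unity:
  assumes "0 < n"
  shows "(\<Prod>\<zeta>\<in>{\<zeta>::complex. \<zeta> ^ n = 1}. [:1, - \<zeta>:]) = 1 - monom 1 n"
proof (rule poly_eqI_degree)
  let ?Z = "{\<zeta>::complex. \<zeta> ^ n = 1}"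
  have c: "card ?Z = n" using assms by (rule card_roots_unity_eq)
  have f: "finite ?Z" using c assms by (metis card.infinite less_numeral_extra(3))
  have z0: "0 \<notin> ?Z" using assms by (simp add: zero_power)
  show "card (insert 0 ?Z) > degree (\<Prod>\<zeta>\<in>?Z. [:1, - \<zeta>:])"
  proof -
    have "degree (\<Prod>\<zeta>\<in>?Z. [:1, - \<zeta>:]) \<le> (\<Sum>\<zeta>\<in>?Z. degree [:1, - \<zeta>:])"
      using degree_prod_sum_le[OF f, of "\<lambda>\<zeta>. [:1, - \<zeta>:]"] unfolding o_def .
    also have "\<dots> \<le> (\<Sum>\<zeta>\<in>?Z. 1)" by (intro sum_mono) simp
    finally show ?thesis using c f z0 by simp
  qed
  show "card (insert 0 ?Z) > degree (1 - monom 1 n :: complex poly)"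
    using c f z0 degree_diff_le[of "1 :: complex poly" n "monom 1 n"] by (simp add: degree_monom_eq)
  fix x assume "x \<in> insert 0 ?Z"
  then consider "x = 0" | "x \<noteq> 0" "x ^ n = 1" using z0 by auto
  then show "poly (\<Prod>\<zeta>\<in>?Z. [:1, - \<zeta>:]) x = poly (1 - monom 1 n) x"
  proof cases
    case 1
    then show ?thesis using assms by (simp add: poly_prod poly_monom)
  next
    case 2
    \<comment> \<open>The factor belonging to the inverse of \<open>x\<close> is the one that
      vanishes at \<open>x\<close>.\<close>
    then have "inverse x \<in> ?Z" by (simp add: power_inverse)
    then have "(\<Prod>\<zeta>\<in>?Z. 1 - x * \<zeta>) = 0"
      using f 2 by (intro prod_zero bexI[of _ "inverse x"]) auto
    then show ?thesis using 2 by (simp add: poly_prod poly_monom)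
  qed
qed

lemma fps_powr_one_minus_X_power:
  assumes "0 < n"
  shows "fps_powr (1 - fps_X ^ n) a = (\<Prod>\<zeta>\<in>{\<zeta>::complex. \<zeta> ^ n = 1}. fps_powr (1 - fps_const \<zeta> * fps_X) a)"
proof -
  have "(1 - fps_X ^ n :: complex fps) = fps_of_poly (1 - monom 1 n)"
    by (simp add: fps_of_poly_simps fps_of_poly_monom)
  also have "\<dots> = (\<Prod>\<zeta>\<in>{\<zeta>::complex. \<zeta> ^ n = 1}. 1 - fps_const \<zeta> * fps_X)"
    unfolding prod_roots_of_unity[OF assms, symmetric] fps_of_poly_prod
    by (intro prod.cong refl) (simp add: fps_of_poly_pCons fps_const_neg[symmetric] del: fps_const_neg)
  finally show ?thesis
    by (simp add: fps_powr_prod)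
qed

subsection \<open>Absolutely summable power series on the closed unit disc\<close>

definition fps_abs_summable :: "complex fps \<Rightarrow> bool" where
  "fps_abs_summable F \<longleftrightarrow> summable (\<lambda>k. cmod (fps_nth F k))"

definition fps_value :: "complex fps \<Rightarrow> complex \<Rightarrow> complex" where
  "fps_value F z = (\<Sum>k. fps_nth F k * z ^ k)"

lemma fps_abs_summable_norm:
  assumes "fps_abs_summable F" "cmod z \<le> 1"
  shows "summable (\<lambda>k. cmod (fps_nth F k * z ^ k))"
proof (rule summable_comparison_test')
  show "summable (\<lambda>k. cmod (fps_nth F k))" using assms by (simp add: fps_abs_summable_def)
  show "norm (cmod (fps_nth F k * z ^ k)) \<le> cmod (fps_nth F k)" for k
    using assms(2) by (simp add: norm_mult norm_power power_le_one mult_left_le)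
qed

lemma fps_abs_summable_mult:
  assumes "fps_abs_summable F" "fps_abs_summable G"
  shows "fps_abs_summable (F * G)"
  unfolding fps_abs_summable_def
proof (rule summable_comparison_test')
  show "summable (\<lambda>k. \<Sum>i\<le>k. cmod (fps_nth F i) * cmod (fps_nth G (k - i)))"
    using assms unfolding fps_abs_summable_def by (intro summable_Cauchy_product) auto
  show "norm (cmod (fps_nth (F * G) k)) \<le> (\<Sum>i\<le>k. cmod (fps_nth F i) * cmod (fps_nth G (k - i)))" for k
    unfolding fps_mult_nth by (auto intro!: order_trans[OF norm_sum] sum_mono simp: norm_mult atLeast0AtMost)
qed

lemma fps_value_mult:
  assumes "fps_abs_summable F" "fps_abs_summable G" "cmod z \<le> 1"
  shows "fps_value (F * G) z = fps_value F z * fps_value G z"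
proof -
  have "fps_value F z * fps_value G z = (\<Sum>k. \<Sum>i\<le>k. (fps_nth F i * z ^ i) * (fps_nth G (k - i) * z ^ (k - i)))"
    unfolding fps_value_def using assms by (intro Cauchy_product fps_abs_summable_norm)
  also have "\<dots> = fps_value (F * G) z"
    unfolding fps_value_def fps_mult_nth sum_distrib_right atLeast0AtMost
  proof (intro arg_cong[where f = suminf] ext sum.cong refl)
    fix k i :: nat assume "i \<in> {..k}"
    then have "z ^ k = z ^ i * z ^ (k - i)" by (simp flip: power_add)
    then show "(fps_nth F i * z ^ i) * (fps_nth G (k - i) * z ^ (k - i)) = fps_nth F i * fps_nth G (k - i) * z ^ k"
      by simp
  qed
  finally show ?thesis ..
qed

lemma fps_abs_summable_of_poly: "fps_abs_summable (fps_of_poly p)"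
  unfolding fps_abs_summable_def
  by (rule summable_finite[of "{..degree p}"]) (auto simp: coeff_eq_0)

lemma fps_value_of_poly: "fps_value (fps_of_poly p) z = poly p z"
proof -
  have "fps_value (fps_of_poly p) z = (\<Sum>k\<le>degree p. fps_nth (fps_of_poly p) k * z ^ k)"
    unfolding fps_value_def by (rule suminf_finite) (auto simp: coeff_eq_0)
  then show ?thesis by (simp add: poly_altdef)
qed

lemma fps_abs_summable_prod:
  "(\<And>i. i \<in> A \<Longrightarrow> fps_abs_summable (F i)) \<Longrightarrow> fps_abs_summable (\<Prod>i\<in>A. F i)"
  using fps_abs_summable_of_poly[of 1]
  by (induction A rule: infinite_finite_induct) (auto intro!: fps_abs_summable_mult)

lemma fps_value_prod:
  assumes "\<And>i. i \<in> A \<Longrightarrow> fps_abs_summable (F i)" "cmod z \<le> 1"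
  shows "fps_value (\<Prod>i\<in>A. F i) z = (\<Prod>i\<in>A. fps_value (F i) z)"
  using assms fps_value_of_poly[of 1]
  by (induction A rule: infinite_finite_induct) (auto simp: fps_value_mult fps_abs_summable_prod)

text \<open>For \<open>0 \<le> a \<le> 1\<close> all but the first of the numbers \<open>(-1)\<^sup>k (a gchoose k)\<close> are nonpositive,
  and their partial sums are nonnegative.\<close>

lemma summable_abs_gbinomial:
  fixes a :: real
  assumes "0 \<le> a" "a \<le> 1"
  shows "summable (\<lambda>k. \<bar>a gchoose k\<bar>)"
proof -
  have neg: "(a gchoose Suc k) * (- 1) ^ Suc k \<le> 0" for k
  proof -
    have "(a gchoose Suc k) * (- 1) ^ Suc k = pochhammer (- a) (Suc k) / fact (Suc k)"
      by (simp add: gbinomial_pochhammer mult_ac flip: power_mult_distrib)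
    also have "\<dots> = - a * pochhammer (1 - a) k / fact (Suc k)"
      by (simp add: pochhammer_rec)
    also have "\<dots> \<le> 0"
      using assms by (intro divide_nonpos_pos mult_nonpos_nonneg) (auto simp: pochhammer_prod intro!: prod_nonneg)
    finally show ?thesis .
  qed
  have abs: "\<bar>a gchoose Suc k\<bar> = - ((a gchoose Suc k) * (- 1) ^ Suc k)" for k
  proof -
    have "\<bar>a gchoose Suc k\<bar> = \<bar>(a gchoose Suc k) * (- 1) ^ Suc k\<bar>" by (simp add: abs_mult power_abs)
    then show ?thesis using neg[of k] by linarith
  qed
  have "summable (\<lambda>k. \<bar>a gchoose Suc k\<bar>)"
  proof (rule summableI_nonneg_bounded)
    fix n
    have "(\<Sum>k<n. \<bar>a gchoose Suc k\<bar>) = 1 - (\<Sum>k\<le>n. (a gchoose k) * (- 1) ^ k)"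
      unfolding abs sum_negf by (subst sum.atMost_shift) simp
    also have "\<dots> = 1 - (- 1) ^ n * (a - 1 gchoose n)" by (simp add: gbinomial_sum_lower_neg)
    also have "(- 1) ^ n * (a - 1 gchoose n) = pochhammer (1 - a) n / fact n"
      by (simp add: gbinomial_pochhammer flip: power_mult_distrib mult.assoc)
    also have "1 - pochhammer (1 - a) n / fact n \<le> 1"
      using assms by (simp add: pochhammer_prod prod_nonneg)
    finally show "(\<Sum>k<n. \<bar>a gchoose Suc k\<bar>) \<le> 1" .
  qed simp
  then show ?thesis by (rule summable_Suc_iff[THEN iffD1])
qed

lemma gbinomial_of_real: "(complex_of_real a gchoose k) = of_real (a gchoose k)"
  by (simp add: gbinomial_prod_rev)

lemma fps_abs_summable_powr_linear:
  assumes "0 \<le> a" "a \<le> 1" "cmod \<zeta> = 1"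
  shows "fps_abs_summable (fps_powr (1 - fps_const \<zeta> * fps_X) (complex_of_real a))"
  unfolding fps_abs_summable_def fps_powr_linear_nth
  using summable_abs_gbinomial[OF assms(1,2)] assms(3)
  by (simp add: gbinomial_of_real norm_mult norm_power)

text \<open>An Abel limit: inside the disc the binomial theorem identifies the series, and along the
  radius to the boundary point both sides converge, the series by domination with the summable |a
  gchoose k|. The point \<zeta> z = 1 must be excluded: for a = 0 the series is 1 there, whereas
  \<open>0 powr 0 = 0\<close>.\<close>

lemma norm_fps_value_powr_linear:
  assumes a: "0 \<le> a" "a \<le> 1" and \<zeta>: "cmod \<zeta> = 1" and z: "cmod z = 1" and ne: "\<zeta> * z \<noteq> 1"
  shows "cmod (fps_value (fps_powr (1 - fps_const \<zeta> * fps_X) (complex_of_real a)) z) = cmod (1 - \<zeta> * z) powr a"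
proof -
  define w where "w = - (\<zeta> * z)"
  have w: "cmod w = 1" using \<zeta> z by (simp add: w_def norm_mult)
  have F: "at_left (1::real) \<noteq> bot" by simp
  have ev: "eventually (\<lambda>x. 0 < x \<and> x < 1) (at_left (1::real))"
    using eventually_at_left_real[of 0 1] by simp
  have "((\<lambda>x. \<Sum>k. (complex_of_real a gchoose k) * (of_real x * w) ^ k) \<longlongrightarrow> (\<Sum>k. (complex_of_real a gchoose k) * w ^ k)) (at_left (1::real))"
  proof (rule tannerys_theorem[THEN conjunct2, THEN conjunct2])
    show "((\<lambda>x. (complex_of_real a gchoose k) * (complex_of_real x * w) ^ k) \<longlongrightarrow> (complex_of_real a gchoose k) * w ^ k) (at_left 1)" for k
      by (auto intro!: tendsto_eq_intros)
    show "eventually (\<lambda>(k, x). cmod ((complex_of_real a gchoose k) * (complex_of_real x * w) ^ k) \<le> \<bar>a gchoose k\<bar>) (at_top \<times>\<^sub>F at_left (1::real))"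
    proof (rule eventually_mono[OF eventually_prodI[OF always_eventually[of "\<lambda>_. True"] ev]])
      fix kx :: "nat \<times> real" assume "True \<and> 0 < snd kx \<and> snd kx < 1"
      then obtain k x where kx: "kx = (k, x)" "0 < x" "x < 1" by (cases kx) auto
      have "cmod (of_real x * w) ^ k \<le> 1"
        using kx(2,3) w by (intro power_le_one) (auto simp: norm_mult)
      then have "\<bar>a gchoose k\<bar> * cmod (of_real x * w) ^ k \<le> \<bar>a gchoose k\<bar>"
        by (intro mult_left_le) auto
      then show "case kx of (k, x) \<Rightarrow> cmod ((complex_of_real a gchoose k) * (complex_of_real x * w) ^ k) \<le> \<bar>a gchoose k\<bar>"
        by (simp add: kx(1) norm_mult[of _ "_ ^ k"] norm_power gbinomial_of_real)
    qed simp
  qed (use summable_abs_gbinomial[OF a] in auto)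
  then have lim: "((\<lambda>x. cmod (\<Sum>k. (complex_of_real a gchoose k) * (of_real x * w) ^ k)) \<longlongrightarrow> cmod (\<Sum>k. (complex_of_real a gchoose k) * w ^ k)) (at_left (1::real))"
    by (rule tendsto_norm)
  \<comment> \<open>A nonzero base is what makes \<open>powr\<close> continuous at the limit
    point.\<close>
  have "1 + w \<noteq> 0" using ne by (simp add: w_def)
  then have "((\<lambda>x. cmod (1 + of_real x * w) powr a) \<longlongrightarrow> cmod (1 + w) powr a) (at_left (1::real))"
    by (auto intro!: tendsto_eq_intros)
  moreover have "eventually (\<lambda>x. cmod (1 + of_real x * w) powr a = cmod (\<Sum>k. (complex_of_real a gchoose k) * (of_real x * w) ^ k)) (at_left (1::real))"
    using ev
  proof (rule eventually_mono)
    fix x :: real assume x: "0 < x \<and> x < 1"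
    have "(\<Sum>k. (complex_of_real a gchoose k) * (of_real x * w) ^ k) = (1 + of_real x * w) powr of_real a"
      using gen_binomial_complex[of "of_real x * w" "of_real a"] x w by (simp add: norm_mult sums_iff)
    then show "cmod (1 + of_real x * w) powr a = cmod (\<Sum>k. (complex_of_real a gchoose k) * (of_real x * w) ^ k)"
      by (simp add: norm_powr_real_powr')
  qed
  ultimately have "((\<lambda>x. cmod (\<Sum>k. (complex_of_real a gchoose k) * (of_real x * w) ^ k)) \<longlongrightarrow> cmod (1 + w) powr a) (at_left (1::real))"
    using tendsto_cong by fast
  with lim have "cmod (\<Sum>k. (complex_of_real a gchoose k) * w ^ k) = cmod (1 + w) powr a"
    using tendsto_unique[OF F] by blast
  moreover have "fps_value (fps_powr (1 - fps_const \<zeta> * fps_X) (complex_of_real a)) z = (\<Sum>k. (complex_of_real a gchoose k) * w ^ k)"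
    unfolding fps_value_def fps_powr_linear_nth w_def
    by (simp add: power_mult_distrib[symmetric] mult.assoc)
  ultimately show ?thesis by (simp add: w_def)
qed

subsection \<open>The autoregressive operator of a SARFIMA process\<close>

text \<open>The operators have real coefficients, but 1 - X^s factors into linear terms only over
  the complex numbers.\<close>

definition fps_complex :: "real fps \<Rightarrow> complex fps" where
  "fps_complex F = Abs_fps (\<lambda>n. complex_of_real (fps_nth F n))"

lemma fps_complex_nth [simp]: "fps_nth (fps_complex F) n = complex_of_real (fps_nth F n)"
  by (simp add: fps_complex_def)

lemma fps_complex_1 [simp]: "fps_complex 1 = 1"
  by (simp add: fps_eq_iff)

lemma fps_complex_mult: "fps_complex (F * G) = fps_complex F * fps_complex G"
  by (simp add: fps_eq_iff fps_mult_nth)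

lemma fps_complex_power: "fps_complex (F ^ n) = fps_complex F ^ n"
  by (induction n) (simp_all add: fps_complex_mult)

lemma fps_complex_prod: "fps_complex (\<Prod>i\<in>A. F i) = (\<Prod>i\<in>A. fps_complex (F i))"
  by (induction A rule: infinite_finite_induct) (simp_all add: fps_complex_mult)

lemma fps_complex_compose: "fps_complex (F oo G) = fps_complex F oo fps_complex G"
  by (simp add: fps_eq_iff fps_compose_nth flip: fps_complex_power)

lemma fps_complex_X: "fps_complex fps_X = fps_X"
  by (simp add: fps_eq_iff)

lemma fps_complex_of_poly: "fps_complex (fps_of_poly p) = fps_of_poly (map_poly complex_of_real p)"
  by (simp add: fps_eq_iff coeff_map_poly)

text \<open>The Pochhammer quotient equals (-1)^k (a gchoose k), so \<open>frac_diff a\<close> is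
  the binomial series at -X; substituting X^n for X gives the power of 1 - X^n.\<close>

lemma fps_complex_frac_diff:
  assumes "0 < n"
  shows "fps_complex (frac_diff a oo fps_X ^ n) = fps_powr (1 - fps_X ^ n) (of_real a)"
proof -
  have "fps_complex (frac_diff a) = fps_binomial (of_real a) oo (fps_const (- 1) * fps_X)"
    unfolding fps_compose_linear
    by (simp add: fps_eq_iff frac_diff_def gbinomial_of_real gbinomial_pochhammer pochhammer_of_real flip: power_mult_distrib mult.assoc of_real_minus)
  then have "fps_complex (frac_diff a oo fps_X ^ n) = fps_binomial (of_real a) oo (fps_const (- 1) * fps_X) oo fps_X ^ n"
    by (simp add: fps_complex_compose fps_complex_power fps_complex_X)
  also have "\<dots> = fps_binomial (of_real a) oo ((fps_const (- 1) * fps_X) oo fps_X ^ n)"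
    using assms by (intro fps_compose_assoc[symmetric]) auto
  also have "(fps_const (- 1) * fps_X :: complex fps) oo fps_X ^ n = (1 - fps_X ^ n) - 1"
    using assms by (simp add: fps_compose_mult_distrib fps_compose_uminus flip: fps_const_neg)
  finally show ?thesis by (simp add: fps_powr_def)
qed

lemma fps_complex_sarfima_lhs:
  assumes s: "\<And>j. j \<in> {1..n_seas P} \<Longrightarrow> 0 < s j"
  shows "fps_complex (sarfima_lhs P s) =
    fps_of_poly (map_poly of_real (ar P)) *
    fps_powr (1 - fps_const 1 * fps_X) (of_real (mem P + (\<Sum>j=1..n_seas P. smem P j))) *
    (\<Prod>j=1..n_seas P. fps_of_poly (map_poly of_real (sar P j \<circ>\<^sub>p monom 1 (s j))) *
      (\<Prod>\<zeta>\<in>{\<zeta>. \<zeta> ^ s j = 1} - {1}. fps_powr (1 - fps_const \<zeta> * fps_X) (of_real (smem P j))))"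
proof -
  have f: "fps_complex (frac_diff a) = fps_powr (1 - fps_X) (of_real a)" for a
    using fps_complex_frac_diff[of 1 a] by simp
  \<comment> \<open>The root 1 is split off from every seasonal factor, so that its powers can be
    merged with the one of exponent d, whose coefficients alone need not be summable.\<close>
  have 1: "fps_powr (1 - fps_X ^ s j) (of_real (smem P j)) = fps_powr (1 - fps_X) (of_real (smem P j)) *
      (\<Prod>\<zeta>\<in>{\<zeta>. \<zeta> ^ s j = 1} - {1}. fps_powr (1 - fps_const \<zeta> * fps_X) (complex_of_real (smem P j)))"
    if j: "j \<in> {1..n_seas P}" for j
  proof -
    have "finite {\<zeta>::complex. \<zeta> ^ s j = 1}"
      using card_roots_unity_eq[OF s[OF j]] s[OF j] by (metis card.infinite less_numeral_extra(3))
    then show ?thesis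
      unfolding fps_powr_one_minus_X_power[OF s[OF j]] by (subst prod.remove[of _ 1]) auto
  qed
  have 2: "fps_complex (fps_of_poly (sar P j) oo fps_X ^ s j) = fps_of_poly (map_poly of_real (sar P j \<circ>\<^sub>p monom 1 (s j)))"
    if j: "j \<in> {1..n_seas P}" for j
    using s[OF j] by (simp add: fps_complex_of_poly[symmetric] fps_of_poly_pcompose fps_of_poly_monom)
  have "fps_complex (sarfima_lhs P s) = fps_of_poly (map_poly of_real (ar P)) * fps_powr (1 - fps_X) (of_real (mem P)) *
    (\<Prod>j=1..n_seas P. fps_of_poly (map_poly of_real (sar P j \<circ>\<^sub>p monom 1 (s j))) * (fps_powr (1 - fps_X) (of_real (smem P j)) *
      (\<Prod>\<zeta>\<in>{\<zeta>. \<zeta> ^ s j = 1} - {1}. fps_powr (1 - fps_const \<zeta> * fps_X) (of_real (smem P j)))))"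
    unfolding sarfima_lhs_def fps_complex_mult fps_complex_prod f fps_complex_of_poly
    using s by (intro arg_cong2[where f = "(*)"] refl prod.cong 1 2) (simp_all add: 1 2 fps_complex_frac_diff)
  also have "\<dots> = fps_of_poly (map_poly of_real (ar P)) *
    (fps_powr (1 - fps_X) (of_real (mem P)) * (\<Prod>j=1..n_seas P. fps_powr (1 - fps_X) (of_real (smem P j)))) *
    (\<Prod>j=1..n_seas P. fps_of_poly (map_poly of_real (sar P j \<circ>\<^sub>p monom 1 (s j))) *
      (\<Prod>\<zeta>\<in>{\<zeta>. \<zeta> ^ s j = 1} - {1}. fps_powr (1 - fps_const \<zeta> * fps_X) (of_real (smem P j))))"
    unfolding prod.distrib by (simp add: mult_ac)
  finally show ?thesis
    by (simp add: fps_powr_sum fps_powr_add)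
qed

section \<open>Evaluation of real polynomials at complex points\<close>

lemma cpoly_add: "cpoly (p + q) z = cpoly p z + cpoly q z"
proof -
  have "map_poly complex_of_real (p + q) = map_poly complex_of_real p + map_poly complex_of_real q"
    by (intro poly_eqI) (simp add: coeff_map_poly)
  then show ?thesis by (simp add: cpoly_def)
qed

lemma cpoly_mult: "cpoly (p * q) z = cpoly p z * cpoly q z"
proof -
  have "map_poly complex_of_real (p * q) = map_poly complex_of_real p * map_poly complex_of_real q"
    by (intro poly_eqI) (simp add: coeff_map_poly coeff_mult)
  then show ?thesis by (simp add: cpoly_def)
qed

lemma cpoly_pCons: "cpoly (pCons a p) z = of_real a + z * cpoly p z"
  by (simp add: cpoly_def map_poly_pCons)

lemma cpoly_0 [simp]: "cpoly 0 z = 0"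
  by (simp add: cpoly_def)

lemma cpoly_1 [simp]: "cpoly 1 z = 1"
  by (simp add: cpoly_def)

lemma cpoly_monom: "cpoly (monom a n) z = of_real a * z ^ n"
  by (simp add: cpoly_def map_poly_monom poly_monom)

lemma cpoly_prod: "cpoly (\<Prod>i\<in>A. p i) z = (\<Prod>i\<in>A. cpoly (p i) z)"
  by (induction A rule: infinite_finite_induct) (simp_all add: cpoly_mult)

lemma cpoly_sum: "cpoly (\<Sum>i\<in>A. p i) z = (\<Sum>i\<in>A. cpoly (p i) z)"
  by (induction A rule: infinite_finite_induct) (simp_all add: cpoly_add)

lemma cpoly_power: "cpoly (p ^ n) z = cpoly p z ^ n"
  by (induction n) (simp_all add: cpoly_mult)

lemma cpoly_pcompose_monom: "cpoly (p \<circ>\<^sub>p monom 1 n) z = cpoly p (z ^ n)"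
  by (induction p) (simp_all add: pcompose_pCons cpoly_add cpoly_mult cpoly_pCons cpoly_monom)

lemma smem_bounds:
  assumes adm: "admissible P" and j: "j \<in> {1..n_seas P}"
  shows "0 \<le> smem P j" "smem P j \<le> 1"
proof -
  have "0 \<le> smem P j \<and> smem P j < 1/2"
    using adm j unfolding admissible_def by blast
  then show "0 \<le> smem P j" "smem P j \<le> 1" by simp_all
qed

context
  fixes P :: sarfima_params and s :: "nat \<Rightarrow> nat"
  assumes adm: "admissible P" and s: "\<And>j. j \<in> {1..n_seas P} \<Longrightarrow> 0 < s j"
begin

lemma fps_abs_summable_sarfima_lhs_factors:
  "fps_abs_summable (fps_powr (1 - fps_const 1 * fps_X) (of_real (mem P + (\<Sum>j=1..n_seas P. smem P j))))"
  "j \<in> {1..n_seas P} \<Longrightarrow> \<zeta> \<in> {\<zeta>. \<zeta> ^ s j = 1} - {1} \<Longrightarrow>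
    fps_abs_summable (fps_powr (1 - fps_const \<zeta> * fps_X) (of_real (smem P j)))"
proof -
  show "fps_abs_summable (fps_powr (1 - fps_const 1 * fps_X) (of_real (mem P + (\<Sum>j=1..n_seas P. smem P j))))"
    using adm by (intro fps_abs_summable_powr_linear) (auto simp: admissible_def)
next
  assume j: "j \<in> {1..n_seas P}" and \<zeta>: "\<zeta> \<in> {\<zeta>. \<zeta> ^ s j = 1} - {1}"
  have "cmod \<zeta> ^ s j = 1" using \<zeta> by (simp flip: norm_power)
  then have "cmod \<zeta> = 1" using s[OF j] using power_eq_imp_eq_base[of "cmod \<zeta>" "s j" 1] by simp
  then show "fps_abs_summable (fps_powr (1 - fps_const \<zeta> * fps_X) (of_real (smem P j)))"
    using smem_bounds[OF adm j] by (intro fps_abs_summable_powr_linear)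
qed

lemma fps_abs_summable_sarfima_lhs: "fps_abs_summable (fps_complex (sarfima_lhs P s))"
  by (subst fps_complex_sarfima_lhs, erule s)
    (intro fps_abs_summable_mult fps_abs_summable_prod fps_abs_summable_of_poly fps_abs_summable_sarfima_lhs_factors)

text \<open>The regrouping is undone at the level of absolute values. The merged factor contributes
  |1 - z| to the power d + D_1 + ... + D_c, which splits again because the base is positive; each
  share with exponent D_j completes the product over the other roots of unity to a power of |1 -
  z^(s_j)|.\<close>

lemma norm_fps_value_sarfima_lhs:
  assumes z: "cmod z = 1" "z \<noteq> 1" "\<And>j. j \<in> {1..n_seas P} \<Longrightarrow> z ^ s j \<noteq> 1"
  shows "cmod (fps_value (fps_complex (sarfima_lhs P s)) z) =
    cmod (cpoly (ar P) z) * cmod (1 - z) powr mem P *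
    (\<Prod>j=1..n_seas P. cmod (cpoly (sar P j) (z ^ s j)) * cmod (1 - z ^ s j) powr smem P j)"
proof -
  have fin: "finite {\<zeta>::complex. \<zeta> ^ s j = 1}" if "j \<in> {1..n_seas P}" for j
    using card_roots_unity_eq[OF s[OF that]] s[OF that] by (metis card.infinite less_numeral_extra(3))
  have 1: "cmod (fps_value (fps_powr (1 - fps_const 1 * fps_X) (of_real (mem P + (\<Sum>j=1..n_seas P. smem P j)))) z) =
      cmod (1 - z) powr mem P * (\<Prod>j=1..n_seas P. cmod (1 - z) powr smem P j)"
    using adm z by (subst norm_fps_value_powr_linear) (auto simp: admissible_def powr_add powr_sum)
  have 2: "cmod (1 - z) powr smem P j * (\<Prod>\<zeta>\<in>{\<zeta>. \<zeta> ^ s j = 1} - {1}. cmod (fps_value (fps_powr (1 - fps_const \<zeta> * fps_X) (of_real (smem P j))) z))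
      = cmod (1 - z ^ s j) powr smem P j" if j: "j \<in> {1..n_seas P}" for j
  proof -
    have "cmod (fps_value (fps_powr (1 - fps_const \<zeta> * fps_X) (of_real (smem P j))) z) = cmod (1 - \<zeta> * z) powr smem P j"
      if \<zeta>: "\<zeta> ^ s j = 1" for \<zeta>
    proof (rule norm_fps_value_powr_linear)
      have "cmod \<zeta> ^ s j = 1" using \<zeta> by (simp flip: norm_power)
      then show "cmod \<zeta> = 1" using s[OF j] using power_eq_imp_eq_base[of "cmod \<zeta>" "s j" 1] by simp
      show "\<zeta> * z \<noteq> 1"
      proof
        assume "\<zeta> * z = 1"
        then have "(\<zeta> * z) ^ s j = 1" by simp
        then show False using \<zeta> z(3)[OF j] by (simp add: power_mult_distrib)
      qed
    qed (use smem_bounds[OF adm j] z in simp_all)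
    then have "cmod (1 - z) powr smem P j * (\<Prod>\<zeta>\<in>{\<zeta>. \<zeta> ^ s j = 1} - {1}. cmod (fps_value (fps_powr (1 - fps_const \<zeta> * fps_X) (of_real (smem P j))) z))
      = cmod (1 - 1 * z) powr smem P j * (\<Prod>\<zeta>\<in>{\<zeta>. \<zeta> ^ s j = 1} - {1}. cmod (1 - \<zeta> * z) powr smem P j)"
      by simp
    also have "\<dots> = (\<Prod>\<zeta>\<in>{\<zeta>. \<zeta> ^ s j = 1}. cmod (1 - \<zeta> * z) powr smem P j)"
      using fin[OF j] by (subst prod.remove[of "{\<zeta>. \<zeta> ^ s j = 1}" 1]) auto
    also have "\<dots> = cmod (\<Prod>\<zeta>\<in>{\<zeta>. \<zeta> ^ s j = 1}. 1 - \<zeta> * z) powr smem P j"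
      by (simp add: prod_norm[symmetric] prod_powr_distrib)
    also have "(\<Prod>\<zeta>\<in>{\<zeta>. \<zeta> ^ s j = 1}. 1 - \<zeta> * z) = 1 - z ^ s j"
      using arg_cong[OF prod_roots_of_unity[OF s[OF j]], of "\<lambda>p. poly p z"] by (simp add: poly_prod poly_monom mult.commute)
    finally show ?thesis .
  qed
  note S = fps_abs_summable_mult fps_abs_summable_prod fps_abs_summable_of_poly fps_abs_summable_sarfima_lhs_factors
  have "cmod (fps_value (fps_complex (sarfima_lhs P s)) z) =
    cmod (cpoly (ar P) z) * cmod (fps_value (fps_powr (1 - fps_const 1 * fps_X) (of_real (mem P + (\<Sum>j=1..n_seas P. smem P j)))) z) *
    (\<Prod>j=1..n_seas P. cmod (cpoly (sar P j) (z ^ s j)) *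
      (\<Prod>\<zeta>\<in>{\<zeta>. \<zeta> ^ s j = 1} - {1}. cmod (fps_value (fps_powr (1 - fps_const \<zeta> * fps_X) (of_real (smem P j))) z)))"
  proof -
    have z1: "cmod z \<le> 1" using z by simp
    have v: "fps_value (\<Prod>\<zeta>\<in>{\<zeta>. \<zeta> ^ s j = 1} - {1}. fps_powr (1 - fps_const \<zeta> * fps_X) (of_real (smem P j))) z =
       (\<Prod>\<zeta>\<in>{\<zeta>. \<zeta> ^ s j = 1} - {1}. fps_value (fps_powr (1 - fps_const \<zeta> * fps_X) (of_real (smem P j))) z)"
      if "j \<in> {1..n_seas P}" for j
      using that by (intro fps_value_prod z1 S)
    have w: "fps_value (fps_of_poly (map_poly of_real (sar P j \<circ>\<^sub>p monom 1 (s j))) * (\<Prod>\<zeta>\<in>{\<zeta>. \<zeta> ^ s j = 1} - {1}. fps_powr (1 - fps_const \<zeta> * fps_X) (of_real (smem P j)))) z =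
       cpoly (sar P j) (z ^ s j) * (\<Prod>\<zeta>\<in>{\<zeta>. \<zeta> ^ s j = 1} - {1}. fps_value (fps_powr (1 - fps_const \<zeta> * fps_X) (of_real (smem P j))) z)"
      if j: "j \<in> {1..n_seas P}" for j
    proof -
      have c: "fps_value (fps_of_poly (map_poly of_real (sar P j \<circ>\<^sub>p monom 1 (s j)))) z = cpoly (sar P j) (z ^ s j)"
        using cpoly_pcompose_monom[of "sar P j" "s j" z] by (simp add: fps_value_of_poly cpoly_def)
      show ?thesis
        unfolding v[OF j, symmetric] c[symmetric] using j by (intro fps_value_mult z1 S)
    qed
    define A where "A = fps_of_poly (map_poly complex_of_real (ar P))"
    define B where "B = fps_powr (1 - fps_const 1 * fps_X) (complex_of_real (mem P + (\<Sum>j=1..n_seas P. smem P j)))"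
    define C where "C j = fps_of_poly (map_poly complex_of_real (sar P j \<circ>\<^sub>p monom 1 (s j))) *
      (\<Prod>\<zeta>\<in>{\<zeta>. \<zeta> ^ s j = 1} - {1}. fps_powr (1 - fps_const \<zeta> * fps_X) (of_real (smem P j)))" for j
    have A: "fps_abs_summable A" unfolding A_def by (rule fps_abs_summable_of_poly)
    have B: "fps_abs_summable B" unfolding B_def by (rule fps_abs_summable_sarfima_lhs_factors)
    have C: "fps_abs_summable (C j)" if "j \<in> {1..n_seas P}" for j
      unfolding C_def using that by (intro S)
    have "fps_value (fps_complex (sarfima_lhs P s)) z = fps_value (A * B * (\<Prod>j=1..n_seas P. C j)) z"
      unfolding A_def B_def C_def by (subst fps_complex_sarfima_lhs, erule s) simp
    also have "\<dots> = fps_value A z * fps_value B z * (\<Prod>j=1..n_seas P. fps_value (C j) z)"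
      by (simp only: fps_value_mult[OF fps_abs_summable_mult[OF A B] fps_abs_summable_prod[OF C] z1]
          fps_value_mult[OF A B z1] fps_value_prod[OF C z1])
    also have "(\<Prod>j=1..n_seas P. fps_value (C j) z) = (\<Prod>j=1..n_seas P. cpoly (sar P j) (z ^ s j) *
       (\<Prod>\<zeta>\<in>{\<zeta>. \<zeta> ^ s j = 1} - {1}. fps_value (fps_powr (1 - fps_const \<zeta> * fps_X) (of_real (smem P j))) z))"
      unfolding C_def by (intro prod.cong refl w)
    finally show ?thesis
      by (simp add: norm_mult prod_norm[symmetric] A_def B_def fps_value_of_poly cpoly_def)
  qed
  also have "\<dots> = cmod (cpoly (ar P) z) * cmod (1 - z) powr mem P *
    (\<Prod>j=1..n_seas P. cmod (cpoly (sar P j) (z ^ s j)) * (cmod (1 - z) powr smem P j *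
      (\<Prod>\<zeta>\<in>{\<zeta>. \<zeta> ^ s j = 1} - {1}. cmod (fps_value (fps_powr (1 - fps_const \<zeta> * fps_X) (of_real (smem P j))) z))))"
    unfolding 1 prod.distrib by (simp add: mult_ac)
  also have "\<dots> = cmod (cpoly (ar P) z) * cmod (1 - z) powr mem P *
    (\<Prod>j=1..n_seas P. cmod (cpoly (sar P j) (z ^ s j)) * cmod (1 - z ^ s j) powr smem P j)"
    by (simp add: 2)
  finally show ?thesis .
qed

end

subsection \<open>The spectral density of a stationary SARFIMA process\<close>

lemma measurable_cis [measurable (raw)]:
  "f \<in> borel_measurable M \<Longrightarrow> (\<lambda>x. cis (f x)) \<in> borel_measurable M"
  by (rule measurable_compose[OF _ borel_measurable_continuous_onI]) (auto intro: continuous_intros)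

lemma measurable_cpoly [measurable (raw)]:
  "f \<in> borel_measurable M \<Longrightarrow> (\<lambda>x. cpoly p (f x)) \<in> borel_measurable M"
  unfolding cpoly_altdef by measurable

lemma has_spectral_density_cong_AE:
  assumes f: "has_spectral_density M X f"
    and g: "g \<in> borel_measurable borel" "\<And>\<omega>. 0 \<le> g \<omega>"
    and eq: "AE \<omega> in lborel. \<omega> \<in> {-pi<..pi} \<longrightarrow> f \<omega> = g \<omega>"
  shows "has_spectral_density M X g"
proof -
  have fi: "set_integrable lborel {-pi<..pi} f"
    using f by (simp add: has_spectral_density_def)
  then have fm: "(\<lambda>\<omega>. indicator {-pi<..pi} \<omega> * f \<omega>) \<in> borel_measurable borel"
    by (simp add: set_integrable_def)
  have gi: "set_integrable lborel {-pi<..pi} g"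
    unfolding set_integrable_def
  proof (rule integrable_cong_AE_imp)
    show "integrable lborel (\<lambda>\<omega>. indicator {-pi<..pi} \<omega> *\<^sub>R f \<omega>)"
      using fi by (simp add: set_integrable_def)
    show "(\<lambda>\<omega>. indicator {-pi<..pi} \<omega> *\<^sub>R g \<omega>) \<in> borel_measurable lborel"
      using g(1) by simp
    show "AE \<omega> in lborel. indicator {-pi<..pi} \<omega> *\<^sub>R f \<omega> = indicator {-pi<..pi} \<omega> *\<^sub>R g \<omega>"
      using eq by eventually_elim (auto simp: indicator_def)
  qed
  have "(CLBINT \<omega>:{-pi<..pi}. cis (of_int h * \<omega>) * complex_of_real (f \<omega>)) =
      (CLBINT \<omega>:{-pi<..pi}. cis (of_int h * \<omega>) * complex_of_real (g \<omega>))" for h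
    unfolding set_lebesgue_integral_def
  proof (rule integral_cong_AE)
    have "(\<lambda>\<omega>. cis (of_int h * \<omega>) * complex_of_real (indicator {-pi<..pi} \<omega> * f \<omega>)) \<in> borel_measurable borel"
      using fm by measurable
    then show "(\<lambda>\<omega>. indicator {-pi<..pi} \<omega> *\<^sub>R (cis (of_int h * \<omega>) * complex_of_real (f \<omega>))) \<in> borel_measurable lborel"
      by (simp add: scaleR_conv_of_real mult_ac)
    show "(\<lambda>\<omega>. indicator {-pi<..pi} \<omega> *\<^sub>R (cis (of_int h * \<omega>) * complex_of_real (g \<omega>))) \<in> borel_measurable lborel"
      using g(1) by measurable
    show "AE \<omega> in lborel. indicator {-pi<..pi} \<omega> *\<^sub>R (cis (of_int h * \<omega>) * complex_of_real (f \<omega>)) =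
       indicator {-pi<..pi} \<omega> *\<^sub>R (cis (of_int h * \<omega>) * complex_of_real (g \<omega>))"
      using eq by eventually_elim (auto simp: indicator_def)
  qed
  then show ?thesis
    using f gi g(2) by (simp add: has_spectral_density_def)
qed

lemma AE_cis_neq_1:
  assumes "0 < n"
  shows "AE \<omega> in lborel. cis (real n * \<omega>) \<noteq> 1"
proof (rule AE_I')
  let ?N = "range (\<lambda>k::int. of_int k * 2 * pi / real n)"
  show "?N \<in> null_sets lborel"
    by (intro countable_imp_null_set_lborel) auto
  have "\<omega> \<in> ?N" if "cis (real n * \<omega>) = 1" for \<omega>
  proof -
    have "cos (real n * \<omega>) = 1" using that by (simp add: complex_eq_iff)
    then obtain k :: int where "real n * \<omega> = of_int k * 2 * pi" by (auto simp: cos_one_2pi_int)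
    then have "\<omega> = of_int k * 2 * pi / real n" using assms by (simp add: field_simps)
    then show ?thesis by blast
  qed
  then show "{\<omega> \<in> space lborel. \<not> cis (real n * \<omega>) \<noteq> 1} \<subseteq> ?N" by auto
qed

text \<open>The classical density of the stationary process, with period vector \<open>s\<close>. At
  the finitely many zeros of the bases its value is governed by \<open>0 powr a = 0\<close>.\<close>

definition sarfima_density :: "sarfima_params \<Rightarrow> (nat \<Rightarrow> nat) \<Rightarrow> real \<Rightarrow> real" where
  "sarfima_density P s \<omega> = short_mem_density P \<omega> * seasonal_ratio P s \<omega> * cmod (1 - cis \<omega>) powr (- 2 * mem P) *
     (\<Prod>j=1..n_seas P. cmod (1 - cis (real (s j) * \<omega>)) powr (- 2 * smem P j))"

lemma admissible_cpoly_neq_0: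
  assumes "admissible P" "p \<in> ar_polys P \<union> ma_polys P" "cmod z = 1"
  shows "cpoly p z \<noteq> 0"
  using assms unfolding admissible_def by (metis less_irrefl)

lemma innov_var_pos: "admissible P \<Longrightarrow> 0 < innov_var P"
  by (simp add: admissible_def)

lemma short_mem_density_nonneg: "admissible P \<Longrightarrow> 0 \<le> short_mem_density P \<omega>"
  using innov_var_pos[of P] by (simp add: short_mem_density_def)

lemma seasonal_ratio_nonneg: "0 \<le> seasonal_ratio P s \<omega>"
  by (simp add: seasonal_ratio_def prod_nonneg)

lemma sarfima_density_nonneg: "admissible P \<Longrightarrow> 0 \<le> sarfima_density P s \<omega>"
  by (simp add: sarfima_density_def short_mem_density_nonneg seasonal_ratio_nonneg prod_nonneg)

lemma measurable_short_mem_density [measurable]: "short_mem_density P \<in> borel_measurable borel"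
  unfolding short_mem_density_def[abs_def] by measurable

lemma measurable_seasonal_ratio [measurable]: "seasonal_ratio P s \<in> borel_measurable borel"
  unfolding seasonal_ratio_def[abs_def] by measurable

lemma measurable_sarfima_density [measurable]: "sarfima_density P s \<in> borel_measurable borel"
  unfolding sarfima_density_def[abs_def] by measurable

text \<open>Pointwise division of the spectral form of the difference equation, at frequencies where
  no factor of the autoregressive operator vanishes.\<close>

lemma sarfima_density_eq:
  assumes adm: "admissible P" and s: "\<And>j. j \<in> {1..n_seas P} \<Longrightarrow> 0 < s j"
    and ne: "cis \<omega> \<noteq> 1" "\<And>j. j \<in> {1..n_seas P} \<Longrightarrow> cis (real (s j) * \<omega>) \<noteq> 1"
    and y: "(cmod (fps_value (fps_complex (sarfima_lhs P s)) (cis \<omega>)))\<^sup>2 * y =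
      (cmod (cpoly (sarfima_rhs P s) (cis \<omega>)))\<^sup>2 * (innov_var P / (2 * pi))"
  shows "y = sarfima_density P s \<omega>"
proof -
  let ?c = "\<lambda>j. cis (real (s j) * \<omega>)"
  have pw: "cis \<omega> ^ s j = ?c j" for j by (simp add: Complex.DeMoivre)
  have a0: "cpoly (ar P) (cis \<omega>) \<noteq> 0"
    by (rule admissible_cpoly_neq_0[OF adm]) (auto simp: ar_polys_def)
  have s0: "cpoly (sar P j) (?c j) \<noteq> 0" if "j \<in> {1..n_seas P}" for j
    using that by (intro admissible_cpoly_neq_0[OF adm]) (auto simp: ar_polys_def)
  have p2: "(x powr a)\<^sup>2 = x powr (2 * a)" for x a :: real
    by (simp add: power2_eq_square flip: powr_add)
  have L: "(cmod (fps_value (fps_complex (sarfima_lhs P s)) (cis \<omega>)))\<^sup>2 =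
     (cmod (cpoly (ar P) (cis \<omega>)))\<^sup>2 * cmod (1 - cis \<omega>) powr (2 * mem P) *
     (\<Prod>j=1..n_seas P. (cmod (cpoly (sar P j) (?c j)))\<^sup>2 * cmod (1 - ?c j) powr (2 * smem P j))" (is "_ = ?L")
    using ne by (subst norm_fps_value_sarfima_lhs[OF adm s]) (auto simp: pw power_mult_distrib p2 prod_power_distrib)
  have R: "(cmod (cpoly (sarfima_rhs P s) (cis \<omega>)))\<^sup>2 =
     (cmod (cpoly (ma P) (cis \<omega>)))\<^sup>2 * (\<Prod>j=1..n_seas P. (cmod (cpoly (sma P j) (?c j)))\<^sup>2)"
    by (simp add: sarfima_rhs_def cpoly_mult cpoly_prod cpoly_pcompose_monom pw norm_mult power_mult_distrib
        prod_norm[symmetric] prod_power_distrib)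
  have L0: "?L \<noteq> 0" using a0 s0 ne by auto
  have "?L * sarfima_density P s \<omega> = (cmod (cpoly (ma P) (cis \<omega>)))\<^sup>2 * (\<Prod>j=1..n_seas P. (cmod (cpoly (sma P j) (?c j)))\<^sup>2) * (innov_var P / (2 * pi))"
  proof -
    have 1: "(cmod (cpoly (ar P) (cis \<omega>)))\<^sup>2 * short_mem_density P \<omega> = (cmod (cpoly (ma P) (cis \<omega>)))\<^sup>2 * (innov_var P / (2 * pi))"
      using a0 by (simp add: short_mem_density_def field_simps)
    have 2: "cmod (1 - cis \<omega>) powr (2 * mem P) * cmod (1 - cis \<omega>) powr (- 2 * mem P) = 1"
      using ne(1) by (simp flip: powr_add)
    have 3: "(\<Prod>j=1..n_seas P. (cmod (cpoly (sar P j) (?c j)))\<^sup>2 * cmod (1 - ?c j) powr (2 * smem P j)) *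
        (seasonal_ratio P s \<omega> * (\<Prod>j=1..n_seas P. cmod (1 - ?c j) powr (- 2 * smem P j))) =
        (\<Prod>j=1..n_seas P. (cmod (cpoly (sma P j) (?c j)))\<^sup>2)"
      unfolding seasonal_ratio_def prod.distrib[symmetric]
    proof (intro prod.cong refl)
      fix j assume j: "j \<in> {1..n_seas P}"
      have *: "a * p * (q * p') = (a * q) * (p * p')" for a p q p' :: real
        by (simp only: mult_ac)
      have "cmod (1 - ?c j) powr (2 * smem P j) * cmod (1 - ?c j) powr (- 2 * smem P j) = 1"
        using ne(2)[OF j] by (simp flip: powr_add)
      moreover have "(cmod (cpoly (sar P j) (?c j)))\<^sup>2 * (cmod (cpoly (sma P j) (?c j) / cpoly (sar P j) (?c j)))\<^sup>2 = (cmod (cpoly (sma P j) (?c j)))\<^sup>2"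
        using s0[OF j] by (simp add: norm_divide power_divide)
      ultimately show "(cmod (cpoly (sar P j) (?c j)))\<^sup>2 * cmod (1 - ?c j) powr (2 * smem P j) *
        ((cmod (cpoly (sma P j) (?c j) / cpoly (sar P j) (?c j)))\<^sup>2 * cmod (1 - ?c j) powr (- 2 * smem P j)) = (cmod (cpoly (sma P j) (?c j)))\<^sup>2"
        by (subst *) (simp only: mult_1_right)
    qed
    have *: "a * p * l * (sm * sr * p' * q) = (a * sm) * (p * p') * (l * (sr * q))" for a p l sm sr p' q :: real
      by (simp only: mult_ac)
    show ?thesis
      unfolding sarfima_density_def * 1 2 3 by (simp only: mult_1_right mult_ac)
  qed
  with y L R have "?L * y = ?L * sarfima_density P s \<omega>" by simp
  with L0 show ?thesis by (simp only: mult_cancel_left) simp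
qed

lemma stationary_sarfima_density:
  assumes st: "stationary_sarfima M P s \<epsilon> U" and f: "has_spectral_density M U f"
  shows "AE \<omega> in lborel. \<omega> \<in> {-pi<..pi} \<longrightarrow> f \<omega> = sarfima_density P s \<omega>"
proof -
  have adm: "admissible P" and wn: "white_noise M (innov_var P) \<epsilon>" and ws: "weakly_stationary M U"
    and ms: "ms_filter M (sarfima_lhs P s) U (backshift_poly (sarfima_rhs P s) \<epsilon>)"
    and s0: "\<And>j. j \<in> {1..n_seas P} \<Longrightarrow> 0 < s j"
    using st unfolding stationary_sarfima_def by fastforce+
  interpret prob_space M using ws by (simp add: weakly_stationary_def)
  define W where "W = backshift_poly (sarfima_rhs P s) \<epsilon>"
  define g where "g \<omega> = (cmod (cpoly (sarfima_rhs P s) (cis \<omega>)))\<^sup>2 * (innov_var P / (2 * pi))" for \<omega>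
  have W: "has_spectral_density M W g"
    unfolding W_def g_def by (intro has_spectral_density_backshift_poly has_spectral_density_white_noise wn)
  define F where "F = sarfima_lhs P s"
  define V where "V n t x = (\<Sum>k<n. fps_nth F k * U (t - int k) x)" for n t x
  define \<Phi> where "\<Phi> n \<omega> = (\<Sum>k<n. complex_of_real (fps_nth F k) * cis (real k * \<omega>))" for n \<omega>
  define \<Psi> where "\<Psi> \<omega> = fps_value (fps_complex F) (cis \<omega>)" for \<omega>
  have V: "has_spectral_density M (V n) (\<lambda>\<omega>. (cmod (\<Phi> n \<omega>))\<^sup>2 * f \<omega>)" for n
    unfolding V_def[abs_def] \<Phi>_def by (rule has_spectral_density_filter[OF f])
  have abs: "fps_abs_summable (fps_complex F)"
    unfolding F_def by (rule fps_abs_summable_sarfima_lhs[OF adm s0])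
  \<comment> \<open>Absolute summability is used here: the truncated transfer functions are bounded
    uniformly in \<open>n\<close> and \<omega>, so a multiple of |f| dominates all the integrands
    below.\<close>
  define B where "B = (\<Sum>k. \<bar>fps_nth F k\<bar>)"
  have B: "cmod (\<Phi> n \<omega>) \<le> B" for n \<omega>
  proof -
    have "cmod (\<Phi> n \<omega>) \<le> (\<Sum>k<n. \<bar>fps_nth F k\<bar>)"
      unfolding \<Phi>_def by (rule order_trans[OF norm_sum]) (simp add: norm_mult)
    also have "\<dots> \<le> B"
      unfolding B_def using abs by (intro sum_le_suminf) (auto simp: fps_abs_summable_def)
    finally show ?thesis .
  qed
  have lim: "(\<lambda>n. \<Phi> n \<omega>) \<longlonglongrightarrow> \<Psi> \<omega>" for \<omega>
  proof -
    have "summable (\<lambda>k. fps_nth (fps_complex F) k * cis \<omega> ^ k)"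
      by (rule summable_norm_cancel[OF fps_abs_summable_norm[OF abs]]) simp
    from summable_LIMSEQ[OF this] show ?thesis
      by (simp add: \<Phi>_def[abs_def] \<Psi>_def fps_value_def Complex.DeMoivre)
  qed
  have \<Phi>m [measurable]: "\<Phi> n \<in> borel_measurable borel" for n
    unfolding \<Phi>_def[abs_def] by measurable
  have \<Psi>m [measurable]: "\<Psi> \<in> borel_measurable borel"
    by (rule borel_measurable_LIMSEQ_metric[OF \<Phi>m lim])
  have fi: "set_integrable lborel {-pi<..pi} f" and f0: "\<And>\<omega>. \<omega> \<in> {-pi<..pi} \<Longrightarrow> 0 \<le> f \<omega>"
    using f by (auto simp: has_spectral_density_def)
  have fm: "(\<lambda>\<omega>. indicator {-pi<..pi} \<omega> * f \<omega>) \<in> borel_measurable borel"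
    using fi by (simp add: set_integrable_def)
  have \<Psi>B: "cmod (\<Psi> \<omega>) \<le> B" for \<omega>
    using LIMSEQ_le_const2[OF tendsto_norm[OF lim], of \<omega> B] B by blast
  have hi: "set_integrable lborel {-pi<..pi} (\<lambda>\<omega>. (cmod (\<Psi> \<omega>))\<^sup>2 * f \<omega>)"
    using set_integrable_bounded_mult[OF fi, of "\<lambda>\<omega>. (cmod (\<Psi> \<omega>))\<^sup>2" "B\<^sup>2"] \<Psi>B by (simp add: power_mono)
  \<comment> \<open>The covariances of the truncated filters \<open>V n\<close> are followed to the
    limit in two ways: mean square convergence gives the covariance of \<open>W\<close>, dominated
    convergence gives the integral with the full transfer function.\<close>
  have cov_eq: "(CLBINT \<omega>:{-pi<..pi}. cis (of_int h * \<omega>) * complex_of_real ((cmod (\<Psi> \<omega>))\<^sup>2 * f \<omega>)) =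
      complex_of_real (cov M (W h) (W 0))" for h
  proof (rule LIMSEQ_unique)
    have "(\<lambda>n. cov M (V n h) (V n 0)) \<longlonglongrightarrow> cov M (W h) (W 0)"
    proof -
      have "square_integrable M (V n t)" for n t
        using V by (intro square_integrable_weakly_stationary) (auto simp: has_spectral_density_def)
      moreover have "square_integrable M (W t)" for t
        using W by (intro square_integrable_weakly_stationary) (auto simp: has_spectral_density_def)
      moreover have "(\<lambda>n. \<integral>x. (V n t x - W t x)\<^sup>2 \<partial>M) \<longlonglongrightarrow> 0" for t
        using ms by (simp add: ms_filter_def V_def W_def F_def)
      ultimately show ?thesis
        by (intro cov_tendsto)
    qed
    then show "(\<lambda>n. complex_of_real (cov M (V n h) (V n 0))) \<longlonglongrightarrow> complex_of_real (cov M (W h) (W 0))"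
      by (rule tendsto_of_real)
    have e: "complex_of_real (cov M (V n h) (V n 0)) =
       (CLBINT \<omega>:{-pi<..pi}. cis (of_int h * \<omega>) * complex_of_real ((cmod (\<Phi> n \<omega>))\<^sup>2 * f \<omega>))" for n
    proof -
      have "\<forall>t h. complex_of_real (cov M (V n (t + h)) (V n t)) =
        (CLBINT \<omega>:{-pi<..pi}. cis (of_int h * \<omega>) * complex_of_real ((cmod (\<Phi> n \<omega>))\<^sup>2 * f \<omega>))"
        using V[of n] unfolding has_spectral_density_def by blast
      from this[rule_format, of 0 h] show ?thesis by simp
    qed
    show "(\<lambda>n. complex_of_real (cov M (V n h) (V n 0))) \<longlonglongrightarrow>
      (CLBINT \<omega>:{-pi<..pi}. cis (of_int h * \<omega>) * complex_of_real ((cmod (\<Psi> \<omega>))\<^sup>2 * f \<omega>))"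
      unfolding e set_lebesgue_integral_def
    proof (rule integral_dominated_convergence[where w = "\<lambda>\<omega>. B\<^sup>2 * norm (indicator {-pi<..pi} \<omega> *\<^sub>R f \<omega>)"])
      have m: "(\<lambda>\<omega>. indicator {-pi<..pi} \<omega> *\<^sub>R (cis (of_int h * \<omega>) * complex_of_real ((cmod (\<Theta> \<omega>))\<^sup>2 * f \<omega>))) \<in> borel_measurable lborel"
        if [measurable]: "\<Theta> \<in> borel_measurable borel" for \<Theta> :: "real \<Rightarrow> complex"
      proof -
        have "(\<lambda>\<omega>. cis (of_int h * \<omega>) * complex_of_real ((cmod (\<Theta> \<omega>))\<^sup>2 * (indicator {-pi<..pi} \<omega> * f \<omega>))) \<in> borel_measurable lborel"
          using fm by measurable
        then show ?thesis by (simp add: scaleR_conv_of_real mult_ac)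
      qed
      show "(\<lambda>\<omega>. indicator {-pi<..pi} \<omega> *\<^sub>R (cis (of_int h * \<omega>) * complex_of_real ((cmod (\<Psi> \<omega>))\<^sup>2 * f \<omega>))) \<in> borel_measurable lborel"
        by (rule m) fact
      show "(\<lambda>\<omega>. indicator {-pi<..pi} \<omega> *\<^sub>R (cis (of_int h * \<omega>) * complex_of_real ((cmod (\<Phi> n \<omega>))\<^sup>2 * f \<omega>))) \<in> borel_measurable lborel" for n
        by (rule m) fact
      show "integrable lborel (\<lambda>\<omega>. B\<^sup>2 * norm (indicator {-pi<..pi} \<omega> *\<^sub>R f \<omega>))"
        using fi by (simp add: set_integrable_def)
      show "AE \<omega> in lborel. (\<lambda>n. indicator {-pi<..pi} \<omega> *\<^sub>R (cis (of_int h * \<omega>) * complex_of_real ((cmod (\<Phi> n \<omega>))\<^sup>2 * f \<omega>)))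
        \<longlonglongrightarrow> indicator {-pi<..pi} \<omega> *\<^sub>R (cis (of_int h * \<omega>) * complex_of_real ((cmod (\<Psi> \<omega>))\<^sup>2 * f \<omega>))"
        by (intro AE_I2 tendsto_intros lim)
      show "AE \<omega> in lborel. norm (indicator {-pi<..pi} \<omega> *\<^sub>R (cis (of_int h * \<omega>) * complex_of_real ((cmod (\<Phi> n \<omega>))\<^sup>2 * f \<omega>)))
         \<le> B\<^sup>2 * norm (indicator {-pi<..pi} \<omega> *\<^sub>R f \<omega>)" for n
      proof (intro AE_I2)
        fix \<omega>
        have "(cmod (\<Phi> n \<omega>))\<^sup>2 * \<bar>f \<omega>\<bar> \<le> B\<^sup>2 * \<bar>f \<omega>\<bar>"
          using B[of n \<omega>] by (intro mult_right_mono power_mono) auto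
        then show "norm (indicator {-pi<..pi} \<omega> *\<^sub>R (cis (of_int h * \<omega>) * complex_of_real ((cmod (\<Phi> n \<omega>))\<^sup>2 * f \<omega>)))
         \<le> B\<^sup>2 * norm (indicator {-pi<..pi} \<omega> *\<^sub>R f \<omega>)"
          by (simp add: norm_mult norm_power indicator_def)
      qed
    qed
  qed
  have "AE \<omega> in lborel. \<omega> \<in> {-pi<..pi} \<longrightarrow> (cmod (\<Psi> \<omega>))\<^sup>2 * f \<omega> = g \<omega>"
  proof (rule fourier_coefficients_unique[OF hi])
    show "set_integrable lborel {-pi<..pi} g" and "\<And>\<omega>. \<omega> \<in> {-pi<..pi} \<Longrightarrow> 0 \<le> g \<omega>"
      using W by (auto simp: has_spectral_density_def)
    have "\<forall>t h. complex_of_real (cov M (W (t + h)) (W t)) = (CLBINT \<omega>:{-pi<..pi}. cis (of_int h * \<omega>) * complex_of_real (g \<omega>))"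
      using W unfolding has_spectral_density_def by blast
    from this[rule_format, of 0]
    show "(CLBINT \<omega>:{-pi<..pi}. cis (of_int h * \<omega>) * complex_of_real ((cmod (\<Psi> \<omega>))\<^sup>2 * f \<omega>)) =
      (CLBINT \<omega>:{-pi<..pi}. cis (of_int h * \<omega>) * complex_of_real (g \<omega>))" for h
      unfolding cov_eq by simp
  qed (simp add: f0)
  moreover have "AE \<omega> in lborel. cis \<omega> \<noteq> 1"
    using AE_cis_neq_1[of 1] by simp
  moreover have "AE \<omega> in lborel. \<forall>j\<in>{1..n_seas P}. cis (real (s j) * \<omega>) \<noteq> 1"
    using s0 by (intro AE_finite_allI AE_cis_neq_1) auto
  ultimately show ?thesis
  proof eventually_elim
    case (elim \<omega>)
    show ?case
    proof
      assume "\<omega> \<in> {-pi<..pi}"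
      with elim(1) have e: "(cmod (\<Psi> \<omega>))\<^sup>2 * f \<omega> = g \<omega>" by simp
      show "f \<omega> = sarfima_density P s \<omega>"
        by (rule sarfima_density_eq[OF adm s0]) (use elim e in \<open>auto simp: \<Psi>_def F_def g_def\<close>)
    qed
  qed
qed

subsection \<open>Backshift polynomials and aggregation\<close>

lemma backshift_poly_bound:
  assumes "degree p \<le> n"
  shows "backshift_poly p X t x = (\<Sum>k\<le>n. coeff p k * X (t - int k) x)"
  unfolding backshift_poly_def using assms
  by (intro sum.mono_neutral_left) (auto simp: coeff_eq_0)

lemma backshift_poly_0 [simp]: "backshift_poly 0 X t x = 0"
  by (simp add: backshift_poly_def)

lemma backshift_poly_add:
  "backshift_poly (p + q) X t x = backshift_poly p X t x + backshift_poly q X t x"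
proof -
  let ?n = "max (degree p) (degree q)"
  have "degree (p + q) \<le> ?n" by (rule degree_add_le_max)
  then show ?thesis
    by (simp add: backshift_poly_bound[of _ ?n] distrib_right sum.distrib)
qed

lemma backshift_poly_smult: "backshift_poly (smult a p) X t x = a * backshift_poly p X t x"
  by (simp add: backshift_poly_bound[OF degree_smult_le] backshift_poly_def sum_distrib_left mult.assoc)

lemma backshift_poly_pCons:
  "backshift_poly (pCons a p) X t x = a * X t x + backshift_poly p X (t - 1) x"
proof -
  have "backshift_poly (pCons a p) X t x = (\<Sum>k\<le>Suc (degree p). coeff (pCons a p) k * X (t - int k) x)"
    by (rule backshift_poly_bound) (rule degree_pCons_le)
  also have "\<dots> = a * X t x + backshift_poly p X (t - 1) x"
    by (subst sum.atMost_Suc_shift) (simp add: backshift_poly_def algebra_simps)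
  finally show ?thesis .
qed

lemma backshift_poly_mult:
  "backshift_poly (p * q) X t x = backshift_poly p (backshift_poly q X) t x"
proof (induction p arbitrary: t)
  case (pCons a p)
  then show ?case
    by (simp add: backshift_poly_add backshift_poly_smult backshift_poly_pCons)
qed simp

lemma backshift_poly_monom: "backshift_poly (monom a n) X t x = a * X (t - int n) x"
proof (induction n arbitrary: t)
  case 0
  then show ?case by (simp add: monom_0 backshift_poly_pCons)
next
  case (Suc n)
  then show ?case by (simp add: monom_Suc backshift_poly_pCons algebra_simps)
qed

lemma backshift_poly_sum:
  "backshift_poly (\<Sum>i\<in>A. p i) X t x = (\<Sum>i\<in>A. backshift_poly (p i) X t x)"
  by (induction A rule: infinite_finite_induct) (simp_all add: backshift_poly_add)

text \<open>One step back in the sampled series is \<open>m\<close> steps back in the original one,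
  so B is replaced by B^m.\<close>

lemma backshift_poly_subsample:
  "backshift_poly p (\<lambda>T. X (int m * T)) T x = backshift_poly (p \<circ>\<^sub>p monom 1 m) X (int m * T) x"
proof (induction p arbitrary: T)
  case (pCons a p)
  have "backshift_poly (pCons a p \<circ>\<^sub>p monom 1 m) X (int m * T) x =
      a * X (int m * T) x + backshift_poly (p \<circ>\<^sub>p monom 1 m) X (int m * T - int m) x"
    by (simp add: pcompose_pCons backshift_poly_add backshift_poly_mult backshift_poly_monom backshift_poly_pCons)
  moreover have "int m * T - int m = int m * (T - 1)" by (simp add: algebra_simps)
  ultimately show ?case by (simp add: backshift_poly_pCons pCons.IH)
qed simp

section \<open>Aggregation as a polynomial in the backshift\<close>

definition geometric_poly :: "nat \<Rightarrow> real poly" where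
  "geometric_poly m = (\<Sum>i<m. monom 1 i)"

lemma aggregate_eq_backshift_poly:
  "aggregate m Y T x = backshift_poly (geometric_poly m) Y (int m * T) x"
proof -
  have "aggregate m Y T x = (\<Sum>i<m. Y (int m * T - int i) x)"
    unfolding aggregate_def
    by (rule sum.reindex_bij_witness[of _ "\<lambda>i. int m * T - int i" "\<lambda>k. nat (int m * T - k)"])
      (auto simp: algebra_simps)
  then show ?thesis
    by (simp add: geometric_poly_def backshift_poly_sum backshift_poly_monom)
qed

lemma geometric_poly_mult: "geometric_poly m * [:1, -1:] = 1 - monom 1 m"
proof -
  have "[:1, -1:] = 1 - monom (1::real) 1"
    by (simp add: monom_Suc monom_0 one_pCons)
  moreover have "geometric_poly m * (1 - monom 1 1) = 1 - monom 1 m"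
    unfolding geometric_poly_def
    by (induction m) (simp_all add: distrib_right right_diff_distrib mult_monom)
  ultimately show ?thesis by simp
qed

text \<open>With G = 1 + X + ... + X^(m-1), the factor (1 - X)^r becomes (1 - X^m)^r = G^r (1 -
  X)^r, and aggregation supplies one more G. The seasonal factors just change period from z_j to m
  z_j.\<close>

lemma diff_poly_pcompose:
  "diff_poly c r R z \<circ>\<^sub>p monom 1 m * geometric_poly m = geometric_poly m ^ Suc r * diff_poly c r R (\<lambda>j. m * z j)"
proof -
  have lin: "[:1, -1:] \<circ>\<^sub>p monom 1 m = geometric_poly m * [:1, -1:]"
    unfolding geometric_poly_mult by (simp add: pcompose_pCons one_pCons)
  have mono: "(1 - monom 1 k) \<circ>\<^sub>p monom 1 m = 1 - monom (1::real) (m * k)" for k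
  proof -
    have "monom (1::real) k \<circ>\<^sub>p monom 1 m = monom 1 (m * k)"
    proof (induction k)
      case (Suc k)
      then show ?case by (simp add: monom_Suc[of 1 k] pcompose_pCons mult_monom)
    qed (simp only: mult_0_right monom_0 pcompose_const)
    then show ?thesis by (simp add: pcompose_diff pcompose_1)
  qed
  have pw: "(p ^ n) \<circ>\<^sub>p q = (p \<circ>\<^sub>p q) ^ n" for p q :: "real poly" and n
    by (induction n) (simp_all add: pcompose_mult pcompose_1)
  show ?thesis
    unfolding diff_poly_def pcompose_mult pcompose_prod pw lin mono power_mult_distrib power_Suc
    by (simp only: mult_ac)
qed

text \<open>A pointwise algebraic identity valid for any family \<open>Y\<close>; the differenced
  aggregates are thereby expressed through the stationary differences alone.\<close>

lemma aggregate_diff_eq_subsample: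
  "backshift_poly (diff_poly c r R z) (aggregate m Y) =
    (\<lambda>T. backshift_poly (geometric_poly m ^ Suc r) (backshift_poly (diff_poly c r R (\<lambda>j. m * z j)) Y) (int m * T))"
proof (intro ext)
  fix T x
  have "aggregate m Y = (\<lambda>T. backshift_poly (geometric_poly m) Y (int m * T))"
    by (intro ext aggregate_eq_backshift_poly)
  then have "backshift_poly (diff_poly c r R z) (aggregate m Y) T x =
      backshift_poly (diff_poly c r R z \<circ>\<^sub>p monom 1 m) (backshift_poly (geometric_poly m) Y) (int m * T) x"
    by (simp only: backshift_poly_subsample)
  also have "\<dots> = backshift_poly (geometric_poly m ^ Suc r) (backshift_poly (diff_poly c r R (\<lambda>j. m * z j)) Y) (int m * T) x"
    by (simp only: backshift_poly_mult[symmetric] diff_poly_pcompose)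
  finally show "backshift_poly (diff_poly c r R z) (aggregate m Y) T x = \<dots>" .
qed

subsection \<open>Folding of the spectrum under subsampling\<close>

text \<open>For even \<open>m\<close> the bounds are integer multiples of 2 pi, so the sign of
  \<open>y\<close> decides which of k = h and k = -h falls into the half-open interval; for
  \<open>y = 0\<close> it is k = h. For odd \<open>m\<close> they sit midway and both ends are
  symmetric.\<close>

lemma alias_range_iff:
  assumes m: "0 < m" and y: "-pi < y" "y \<le> pi"
  shows "k \<in> alias_range m y \<longleftrightarrow> (y + 2 * of_int k * pi) / real m \<in> {-pi<..pi}"
proof -
  \<comment> \<open>Multiples of pi become values of an additive, monotone function, which reduces
    the comparisons to linear arithmetic.\<close>
  define q where "q a = real_of_int a * pi" for a
  have p: "q a \<le> q b" if "a \<le> b" for a b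
    using that unfolding q_def by (intro mult_right_mono) auto
  have q: "q (a + b) = q a + q b" "q (a - b) = q a - q b" "q (- a) = - q a" "q 1 = pi" for a b
    by (simp_all add: q_def algebra_simps)
  have eq: "(y + 2 * of_int k * pi) / real m \<in> {-pi<..pi} \<longleftrightarrow> - (real m * pi) < y + 2 * q k \<and> y + 2 * q k \<le> real m * pi"
    using m by (simp add: field_simps q_def)
  define h where "h = int (m div 2)"
  show ?thesis
  proof (cases "odd m")
    case True
    then have mh: "real m * pi = 2 * q h + pi"
      unfolding h_def q_def by (auto elim!: oddE simp: algebra_simps)
    have "k \<in> alias_range m y \<longleftrightarrow> - h \<le> k \<and> k \<le> h"
      using True by (simp add: alias_range_def h_def Let_def)
    also have "\<dots> \<longleftrightarrow> - (real m * pi) < y + 2 * q k \<and> y + 2 * q k \<le> real m * pi"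
    proof (intro conj_cong)
      show "- h \<le> k \<longleftrightarrow> - (real m * pi) < y + 2 * q k"
        using p[of "-h" k] p[of k "-h-1"] y unfolding mh by (cases "-h \<le> k") (simp_all add: q)
      show "k \<le> h \<longleftrightarrow> y + 2 * q k \<le> real m * pi"
        using p[of k h] p[of "h+1" k] y unfolding mh by (cases "k \<le> h") (simp_all add: q)
    qed
    finally show ?thesis unfolding eq .
  next
    case False
    then have mh: "real m * pi = 2 * q h"
      unfolding h_def q_def by (auto elim!: evenE)
    show ?thesis
    proof (cases "y \<le> 0")
      case y0: True
      have "k \<in> alias_range m y \<longleftrightarrow> - h + 1 \<le> k \<and> k \<le> h"
        using False y0 by (simp add: alias_range_def h_def Let_def)
      also have "\<dots> \<longleftrightarrow> - (real m * pi) < y + 2 * q k \<and> y + 2 * q k \<le> real m * pi"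
      proof (intro conj_cong)
        show "- h + 1 \<le> k \<longleftrightarrow> - (real m * pi) < y + 2 * q k"
          using p[of "-h + 1" k] p[of k "-h"] y y0 unfolding mh by (cases "-h + 1 \<le> k") (simp_all add: q)
        show "k \<le> h \<longleftrightarrow> y + 2 * q k \<le> real m * pi"
          using p[of k h] p[of "h+1" k] y y0 unfolding mh by (cases "k \<le> h") (simp_all add: q)
      qed
      finally show ?thesis unfolding eq .
    next
      case y0: False
      have "k \<in> alias_range m y \<longleftrightarrow> - h \<le> k \<and> k \<le> h - 1"
        using False y0 by (simp add: alias_range_def h_def Let_def)
      also have "\<dots> \<longleftrightarrow> - (real m * pi) < y + 2 * q k \<and> y + 2 * q k \<le> real m * pi"
      proof (intro conj_cong)
        show "- h \<le> k \<longleftrightarrow> - (real m * pi) < y + 2 * q k"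
          using p[of "-h" k] p[of k "-h - 1"] y y0 unfolding mh by (cases "-h \<le> k") (simp_all add: q)
        show "k \<le> h - 1 \<longleftrightarrow> y + 2 * q k \<le> real m * pi"
          using p[of k "h - 1"] p[of h k] y y0 unfolding mh by (cases "k \<le> h - 1") (simp_all add: q)
      qed
      finally show ?thesis unfolding eq .
    qed
  qed
qed

lemma alias_range_subset: "alias_range m y \<subseteq> {- int m..int m}"
  unfolding alias_range_def by (auto simp: Let_def split: if_splits)

lemma finite_alias_range [simp]: "finite (alias_range m y)"
  by (rule finite_subset[OF alias_range_subset]) simp

text \<open>Stretching by \<open>m\<close> turns the integral into one over (-m pi, m pi]; this is
  cut by the translates of (-pi, pi] by multiples of 2 pi and every piece is moved back.
  \<open>K\<close> vanishes outside the stretched interval, so the fixed range from -m to m may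
  stand in for the range depending on \<omega>.\<close>

lemma has_bochner_integral_fold:
  fixes G :: "real \<Rightarrow> 'a :: {banach, second_countable_topology}"
  assumes m: "0 < m" and G: "set_integrable lborel {-pi<..pi} G"
  shows "has_bochner_integral lborel
    (\<lambda>\<omega>. indicator {-pi<..pi} \<omega> *\<^sub>R ((1 / real m) *\<^sub>R (\<Sum>k\<in>alias_range m \<omega>. G ((\<omega> + 2 * of_int k * pi) / real m))))
    (LBINT \<omega>:{-pi<..pi}. G \<omega>)"
proof -
  let ?I = "{-pi<..pi}"
  define K where "K x = indicat_real ?I (x / real m) *\<^sub>R G (x / real m)" for x
  have "has_bochner_integral lborel (\<lambda>x. indicat_real ?I x *\<^sub>R G x) (LBINT \<omega>:?I. G \<omega>)"
    using G unfolding set_integrable_def set_lebesgue_integral_def by (rule has_bochner_integral_integrable)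
  then have "has_bochner_integral lborel (\<lambda>x. indicat_real ?I (0 + (1 / real m) * x) *\<^sub>R G (0 + (1 / real m) * x)) ((LBINT \<omega>:?I. G \<omega>) /\<^sub>R \<bar>1 / real m\<bar>)"
    using m by (subst (asm) lborel_has_bochner_integral_real_affine_iff[of "1 / real m" _ _ 0]) auto
  then have K: "has_bochner_integral lborel K (real m *\<^sub>R (LBINT \<omega>:?I. G \<omega>))"
    using m by (simp add: K_def[abs_def])
  have piece: "integrable lborel (\<lambda>x. indicat_real ?I (x - 2 * of_int k * pi) *\<^sub>R K x)" for k :: int
  proof -
    have "integrable lborel (\<lambda>x. indicat_real {-pi + 2 * of_int k * pi<..pi + 2 * of_int k * pi} x *\<^sub>R K x)"
      using K by (intro integrable_mult_indicator) (auto simp: has_bochner_integral_iff)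
    also have "(\<lambda>x. indicat_real {-pi + 2 * of_int k * pi<..pi + 2 * of_int k * pi} x *\<^sub>R K x) = (\<lambda>x. indicat_real ?I (x - 2 * of_int k * pi) *\<^sub>R K x)"
      by (auto simp: indicator_def fun_eq_iff)
    finally show ?thesis .
  qed
  have split: "(\<Sum>k\<in>{- int m..int m}. indicat_real ?I (x - 2 * of_int k * pi) *\<^sub>R K x) = K x" for x
  proof (cases "x / real m \<in> ?I")
    case False
    then show ?thesis by (simp add: K_def)
  next
    case True
    then have x: "- real m * pi < x" "x \<le> real m * pi"
      using m by (simp_all add: field_simps)
    \<comment> \<open>The ceiling selects the one half-open translate that contains
      \<open>x\<close>.\<close>
    define k0 where "k0 = \<lceil>(x - pi) / (2 * pi)\<rceil>"
    have k0: "of_int k0 * (2 * pi) \<ge> x - pi" "of_int k0 * (2 * pi) < x + pi"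
    proof -
      have "(x - pi) / (2 * pi) \<le> of_int k0" "of_int k0 < (x - pi) / (2 * pi) + 1"
        unfolding k0_def by linarith+
      then show "of_int k0 * (2 * pi) \<ge> x - pi" "of_int k0 * (2 * pi) < x + pi"
        by (simp_all add: field_simps)
    qed
    have iff: "x - 2 * of_int k * pi \<in> ?I \<longleftrightarrow> k = k0" for k
    proof
      assume "x - 2 * of_int k * pi \<in> ?I"
      then have a: "- pi < x - of_int k * (2 * pi)" "x - of_int k * (2 * pi) \<le> pi" by (simp_all add: mult_ac)
      have "(of_int k - of_int k0) * (2 * pi) < 1 * (2 * pi)" "(of_int k0 - of_int k) * (2 * pi) < 1 * (2 * pi)"
        using a k0 by (simp_all add: algebra_simps)
      then have "real_of_int (k - k0) < 1" "real_of_int (k0 - k) < 1"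
        by (simp_all add: mult_less_cancel_right)
      then show "k = k0" by linarith
    next
      assume "k = k0"
      then show "x - 2 * of_int k * pi \<in> ?I" using k0 by (simp add: algebra_simps)
    qed
    \<comment> \<open>From |x| <= m pi one gets 2 |k0| < m + 1, which is at most 2 m since
      \<open>m\<close> is positive.\<close>
    have "k0 \<in> {- int m..int m}"
    proof -
      have "of_int k0 * (2 * pi) < (real m + 1) * pi" "- (real m + 1) * pi < of_int k0 * (2 * pi)"
        using k0 x by (simp_all add: algebra_simps)
      then have "(of_int k0 * 2) * pi < (real m + 1) * pi" "- (real m + 1) * pi < (of_int k0 * 2) * pi"
        by (simp_all add: mult_ac)
      then have "of_int k0 * 2 < real m + 1" "- (real m + 1) < of_int k0 * 2"
        by (simp_all only: mult_less_cancel_right_pos[OF pi_gt_zero])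
      then show ?thesis using m by simp
    qed
    then have "(\<Sum>k\<in>{- int m..int m}. indicat_real ?I (x - 2 * of_int k * pi) *\<^sub>R K x) =
        (\<Sum>k\<in>{k0}. indicat_real ?I (x - 2 * of_int k * pi) *\<^sub>R K x)"
      using iff by (intro sum.mono_neutral_right) (auto simp: indicator_def)
    also have "\<dots> = indicat_real ?I (x - 2 * of_int k0 * pi) *\<^sub>R K x"
      by (subst sum.insert) simp_all
    finally show ?thesis using iff[of k0] by simp
  qed
  have tr: "has_bochner_integral lborel (\<lambda>x. indicat_real ?I x *\<^sub>R K (x + 2 * of_int k * pi))
      (LINT x|lborel. indicat_real ?I (x - 2 * of_int k * pi) *\<^sub>R K x)" for k :: int
  proof -
    have "has_bochner_integral lborel (\<lambda>x. indicat_real ?I (2 * of_int k * pi + 1 * x - 2 * of_int k * pi) *\<^sub>R K (2 * of_int k * pi + 1 * x))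
      ((LINT x|lborel. indicat_real ?I (x - 2 * of_int k * pi) *\<^sub>R K x) /\<^sub>R \<bar>1\<bar>)"
      using has_bochner_integral_integrable[OF piece[of k]]
      by (subst (asm) lborel_has_bochner_integral_real_affine_iff[of 1 _ _ "2 * of_int k * pi"]) auto
    then show ?thesis by (simp add: add.commute)
  qed
  have "has_bochner_integral lborel (\<lambda>x. \<Sum>k\<in>{- int m..int m}. indicat_real ?I x *\<^sub>R K (x + 2 * of_int k * pi))
     (\<Sum>k\<in>{- int m..int m}. LINT x|lborel. indicat_real ?I (x - 2 * of_int k * pi) *\<^sub>R K x)"
    by (intro has_bochner_integral_sum tr)
  also have "(\<Sum>k\<in>{- int m..int m}. LINT x|lborel. indicat_real ?I (x - 2 * of_int k * pi) *\<^sub>R K x) = (LINT x|lborel. K x)"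
    using piece by (subst Bochner_Integration.integral_sum[symmetric]) (simp_all add: split)
  also have "(LINT x|lborel. K x) = real m *\<^sub>R (LBINT \<omega>:?I. G \<omega>)"
    using K by (rule has_bochner_integral_integral_eq)
  also have "(\<lambda>x. \<Sum>k\<in>{- int m..int m}. indicat_real ?I x *\<^sub>R K (x + 2 * of_int k * pi)) =
    (\<lambda>x. indicat_real ?I x *\<^sub>R (\<Sum>k\<in>alias_range m x. G ((x + 2 * of_int k * pi) / real m)))"
  proof
    fix x :: real
    show "(\<Sum>k\<in>{- int m..int m}. indicat_real ?I x *\<^sub>R K (x + 2 * of_int k * pi)) =
      indicat_real ?I x *\<^sub>R (\<Sum>k\<in>alias_range m x. G ((x + 2 * of_int k * pi) / real m))"
    proof (cases "x \<in> ?I")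
      case True
      then have iff: "k \<in> alias_range m x \<longleftrightarrow> (x + 2 * of_int k * pi) / real m \<in> ?I" for k
        using alias_range_iff[OF m] by simp
      have "(\<Sum>k\<in>alias_range m x. G ((x + 2 * of_int k * pi) / real m)) = (\<Sum>k\<in>{- int m..int m}. K (x + 2 * of_int k * pi))"
        using alias_range_subset[of m x] by (intro sum.mono_neutral_cong_left) (auto simp: K_def iff)
      then show ?thesis using True by simp
    qed simp
  qed
  finally have "has_bochner_integral lborel (\<lambda>x. (1 / real m) *\<^sub>R (indicat_real ?I x *\<^sub>R (\<Sum>k\<in>alias_range m x. G ((x + 2 * of_int k * pi) / real m))))
    ((1 / real m) *\<^sub>R (real m *\<^sub>R (LBINT \<omega>:?I. G \<omega>)))"
    by (rule has_bochner_integral_scaleR_right)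
  then show ?thesis using m by (simp add: mult.commute)
qed

text \<open>Lag \<open>h\<close> of the sampled series is lag \<open>m h\<close> of the original.
  After folding, the phase at this lag is the same for all aliases of \<omega>, so it leaves the
  sum.\<close>

lemma has_spectral_density_subsample:
  assumes m: "0 < m" and V: "has_spectral_density M V g"
  shows "has_spectral_density M (\<lambda>T. V (int m * T))
    (\<lambda>\<omega>. (1 / real m) * (\<Sum>k\<in>alias_range m \<omega>. g ((\<omega> + 2 * of_int k * pi) / real m)))" (is "has_spectral_density M _ ?f")
proof -
  have ws: "weakly_stationary M V" and g0: "\<And>\<omega>. \<omega> \<in> {-pi<..pi} \<Longrightarrow> 0 \<le> g \<omega>"
    and gi: "set_integrable lborel {-pi<..pi} g"
    and c: "\<And>t h. complex_of_real (cov M (V (t + h)) (V t)) =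
        (CLBINT \<omega>:{-pi<..pi}. cis (of_int h * \<omega>) * complex_of_real (g \<omega>))"
    using V by (auto simp: has_spectral_density_def)
  have "weakly_stationary M (\<lambda>T. V (int m * T))"
    using ws unfolding weakly_stationary_def by (auto simp: distrib_left)
  moreover have "0 \<le> ?f \<omega>" if "\<omega> \<in> {-pi<..pi}" for \<omega>
    using that alias_range_iff[OF m] by (intro mult_nonneg_nonneg sum_nonneg g0) auto
  moreover have "set_integrable lborel {-pi<..pi} ?f"
    using has_bochner_integral_fold[OF m gi] by (auto simp: set_integrable_def has_bochner_integral_iff)
  moreover have "complex_of_real (cov M (V (int m * (T + h))) (V (int m * T))) =
     (CLBINT \<omega>:{-pi<..pi}. cis (of_int h * \<omega>) * complex_of_real (?f \<omega>))" for T h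
  proof -
    let ?G = "\<lambda>\<omega>. cis (of_int (int m * h) * \<omega>) * complex_of_real (g \<omega>)"
    have G: "set_integrable lborel {-pi<..pi} ?G"
      by (rule set_integrable_bounded_mult[OF gi, where C = 1]) (auto intro!: borel_measurable_continuous_onI continuous_intros)
    have "complex_of_real (cov M (V (int m * (T + h))) (V (int m * T))) = (CLBINT \<omega>:{-pi<..pi}. ?G \<omega>)"
      using c[of "int m * T" "int m * h"] by (simp add: distrib_left)
    also have "\<dots> = (CLBINT \<omega>:{-pi<..pi}. (1 / real m) *\<^sub>R (\<Sum>k\<in>alias_range m \<omega>. ?G ((\<omega> + 2 * of_int k * pi) / real m)))"
      using has_bochner_integral_fold[OF m G] unfolding set_lebesgue_integral_def by (simp add: has_bochner_integral_iff)
    also have "\<dots> = (CLBINT \<omega>:{-pi<..pi}. cis (of_int h * \<omega>) * complex_of_real (?f \<omega>))"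
    proof (intro set_lebesgue_integral_cong allI impI)
      fix \<omega> :: real
      have "cis (of_int (int m * h) * ((\<omega> + 2 * of_int k * pi) / real m)) = cis (of_int h * \<omega>)" for k :: int
      proof -
        have "of_int (int m * h) * ((\<omega> + 2 * of_int k * pi) / real m) = of_int h * \<omega> + 2 * pi * of_int (h * k)"
          using m by (simp add: field_simps)
        moreover have "cis (2 * pi * of_int (h * k)) = 1"
          by (rule cis_multiple_2pi) simp
        ultimately show ?thesis by (simp only: cis_mult[symmetric]) simp
      qed
      then show "(1 / real m) *\<^sub>R (\<Sum>k\<in>alias_range m \<omega>. ?G ((\<omega> + 2 * of_int k * pi) / real m)) = cis (of_int h * \<omega>) * complex_of_real (?f \<omega>)"
        by (simp add: scaleR_conv_of_real sum_distrib_left mult_ac)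
    qed auto
    finally show ?thesis .
  qed
  ultimately show ?thesis by (simp add: has_spectral_density_def)
qed

subsection \<open>The spectral density of the differenced aggregates\<close>

lemma norm_one_minus_cis: "cmod (1 - cis t) = \<bar>2 * sin (t / 2)\<bar>"
proof -
  have "(cmod (1 - cis t))\<^sup>2 = 2 - 2 * cos t"
    unfolding cmod_power2 by (simp add: power2_eq_square algebra_simps)
  also have "\<dots> = (2 * sin (t / 2))\<^sup>2"
    using cos_double_sin[of "t / 2"] by (simp add: power2_eq_square)
  finally show ?thesis
    by (metis abs_ge_zero norm_ge_zero power2_abs power2_eq_imp_eq)
qed

lemma agg_density_nonneg: "admissible P \<Longrightarrow> 0 \<le> agg_density P r z m \<omega>"
  unfolding agg_density_def
  by (intro mult_nonneg_nonneg prod_nonneg sum_nonneg short_mem_density_nonneg seasonal_ratio_nonneg) auto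

text \<open>The index set of the sum varies with \<omega>. It is replaced by the fixed range from -m
  to m, with membership depending only on whether \<omega> <= 0.\<close>

lemma measurable_agg_density [measurable]: "agg_density P r z m \<in> borel_measurable borel"
proof -
  have "agg_density P r z m = (\<lambda>\<omega>. 1 / real m * \<bar>2 * sin (\<omega> / 2)\<bar> ^ (2 * r + 2) *
     (\<Prod>j=1..n_seas P. \<bar>2 * sin (real (z j) * \<omega> / 2)\<bar> powr (- 2 * smem P j)) *
     seasonal_ratio P z \<omega> *
     (\<Sum>k\<in>{- int m..int m}. (if k \<in> alias_range m \<omega> then 
        \<bar>2 * sin ((\<omega> + 2 * of_int k * pi) / (2 * real m))\<bar> powr (- 2 * real r - 2 * mem P - 2) *
        short_mem_density P ((\<omega> + 2 * of_int k * pi) / real m) else 0)))"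
    unfolding agg_density_def using alias_range_subset
    by (intro ext arg_cong2[where f = "(*)"] refl sum.mono_neutral_cong_left) auto
  moreover have "Measurable.pred borel (\<lambda>\<omega>. k \<in> alias_range m \<omega>)" for k
  proof -
    have "(\<lambda>\<omega>. k \<in> alias_range m \<omega>) = (\<lambda>\<omega>. if \<omega> \<le> 0 then k \<in> alias_range m 0 else k \<in> alias_range m 1)"
      by (auto simp: alias_range_def fun_eq_iff Let_def)
    then show ?thesis by simp
  qed
  note this[measurable]
  ultimately show ?thesis by simp
qed

text \<open>At an alias x of \<omega> one has e^(i m n x) = e^(i n \<omega>), so all seasonal
  factors with periods m z_j are the same for every alias and leave the sum. The geometric
  polynomial has modulus |1 - e^(i \<omega>)| / |1 - e^(i x)|, whose power 2r + 2 produces the front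
  factor and shifts the exponent inside the sum.\<close>

lemma folded_sarfima_density_eq:
  assumes m: "0 < m" and \<omega>: "\<omega> \<in> {-pi<..pi}"
    and ne: "cis \<omega> \<noteq> 1"
  shows "(1 / real m) * (\<Sum>k\<in>alias_range m \<omega>.
      (cmod (cpoly (geometric_poly m ^ Suc r) (cis ((\<omega> + 2 * of_int k * pi) / real m))))\<^sup>2 *
      sarfima_density P (\<lambda>j. m * z j) ((\<omega> + 2 * of_int k * pi) / real m)) = agg_density P r z m \<omega>"
proof -
  have e: "(cmod (cpoly (geometric_poly m ^ Suc r) (cis ((\<omega> + 2 * of_int k * pi) / real m))))\<^sup>2 *
      sarfima_density P (\<lambda>j. m * z j) ((\<omega> + 2 * of_int k * pi) / real m) =
    \<bar>2 * sin (\<omega> / 2)\<bar> ^ (2 * r + 2) *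
     (\<Prod>j=1..n_seas P. \<bar>2 * sin (real (z j) * \<omega> / 2)\<bar> powr (- 2 * smem P j)) *
     seasonal_ratio P z \<omega> *
      (\<bar>2 * sin ((\<omega> + 2 * of_int k * pi) / (2 * real m))\<bar> powr (- 2 * real r - 2 * mem P - 2) *
        short_mem_density P ((\<omega> + 2 * of_int k * pi) / real m))" for k :: int
  proof -
    define x where "x = (\<omega> + 2 * of_int k * pi) / real m"
    have per: "cis (real (m * n) * x) = cis (real n * \<omega>)" for n
    proof -
      have "real (m * n) * x = real n * \<omega> + 2 * pi * of_int (int n * k)"
        using m by (simp add: x_def field_simps)
      moreover have "cis (2 * pi * of_int (int n * k)) = 1"
        by (rule cis_multiple_2pi) simp
      ultimately show ?thesis by (simp only: cis_mult[symmetric]) simp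
    qed
    \<comment> \<open>Otherwise the m-th power, which is e^(i \<omega>), would be 1 as well.\<close>
    have x1: "cis x \<noteq> 1"
    proof
      assume "cis x = 1"
      then have "cis x ^ m = 1" by simp
      then show False using per[of 1] ne by (simp add: Complex.DeMoivre)
    qed
    have s: "\<bar>2 * sin (x / 2)\<bar> = cmod (1 - cis x)" "\<bar>2 * sin (\<omega> / 2)\<bar> = cmod (1 - cis \<omega>)"
      "\<bar>2 * sin (real (z j) * \<omega> / 2)\<bar> = cmod (1 - cis (real (z j) * \<omega>))" for j
      by (simp_all only: norm_one_minus_cis)
    have pos: "0 < cmod (1 - cis x)" using x1 by simp
    have G: "cmod (cpoly (geometric_poly m) (cis x)) = cmod (1 - cis \<omega>) / cmod (1 - cis x)"
    proof -
      have "cpoly (geometric_poly m) (cis x) = (\<Sum>i<m. cis x ^ i)"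
        by (simp add: geometric_poly_def cpoly_sum cpoly_monom)
      also have "\<dots> = (1 - cis x ^ m) / (1 - cis x)"
        using x1 by (simp add: sum_gp_strict)
      finally show ?thesis using per[of 1] by (simp add: norm_divide Complex.DeMoivre)
    qed
    have "(cmod (cpoly (geometric_poly m ^ Suc r) (cis x)))\<^sup>2 = cmod (1 - cis \<omega>) ^ (2 * r + 2) * cmod (1 - cis x) powr (- 2 * real r - 2)"
    proof -
      have "(cmod (cpoly (geometric_poly m ^ Suc r) (cis x)))\<^sup>2 = (cmod (1 - cis \<omega>) / cmod (1 - cis x)) ^ (2 * r + 2)"
        by (simp only: cpoly_power norm_power G power_mult[symmetric]) (simp add: mult.commute)
      also have "\<dots> = cmod (1 - cis \<omega>) ^ (2 * r + 2) / cmod (1 - cis x) powr real (2 * r + 2)"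
        using pos by (simp only: power_divide powr_realpow)
      also have "\<dots> = cmod (1 - cis \<omega>) ^ (2 * r + 2) * cmod (1 - cis x) powr (- real (2 * r + 2))"
        by (simp only: powr_minus_divide) simp
      also have "- real (2 * r + 2) = - 2 * real r - 2" by simp
      finally show ?thesis .
    qed
    moreover have "cmod (1 - cis x) powr (- 2 * real r - 2) * cmod (1 - cis x) powr (- 2 * mem P) =
      cmod (1 - cis x) powr (- 2 * real r - 2 * mem P - 2)"
      by (subst powr_add[symmetric]) (rule arg_cong2[where f = "(powr)"], simp_all)
    moreover have "seasonal_ratio P (\<lambda>j. m * z j) x = seasonal_ratio P z \<omega>"
      by (simp only: seasonal_ratio_def per)
    moreover have "(\<Prod>j=1..n_seas P. cmod (1 - cis (real (m * z j) * x)) powr (- 2 * smem P j)) =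
      (\<Prod>j=1..n_seas P. \<bar>2 * sin (real (z j) * \<omega> / 2)\<bar> powr (- 2 * smem P j))"
      by (simp only: per s)
    moreover have "(\<omega> + 2 * of_int k * pi) / (2 * real m) = x / 2" by (simp add: x_def)
    moreover have "(a * b) * (c * d * e * f) = a * f * d * (b * e * c)" for a b c d e f :: real
      by (simp only: mult_ac)
    ultimately show ?thesis
      by (simp only: x_def[symmetric] s sarfima_density_def)
  qed
  show ?thesis
    unfolding agg_density_def e sum_distrib_left[symmetric] by (simp only: mult.assoc)
qed

lemma has_spectral_density_stationary_sarfima:
  assumes st: "stationary_sarfima M P s \<epsilon> U"
  shows "has_spectral_density M U (sarfima_density P s)"
proof -
  obtain f where f: "has_spectral_density M U f" and adm: "admissible P"
    using st by (auto simp: stationary_sarfima_def)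
  show ?thesis
    by (rule has_spectral_density_cong_AE[OF f _ _ stationary_sarfima_density[OF st f]])
      (auto simp: sarfima_density_nonneg[OF adm])
qed

lemma has_spectral_density_agg:
  assumes m: "2 \<le> m" and z: "\<And>j. j \<in> {1..n_seas P} \<Longrightarrow> 0 < z j"
    and Y: "integrated_sarfima M P r R (\<lambda>j. m * z j) \<epsilon> Y"
  shows "has_spectral_density M (backshift_poly (diff_poly (n_seas P) r R z) (aggregate m Y)) (agg_density P r z m)"
proof -
  define U where "U = backshift_poly (diff_poly (n_seas P) r R (\<lambda>j. m * z j)) Y"
  have st: "stationary_sarfima M P (\<lambda>j. m * z j) \<epsilon> U"
    using Y by (simp add: integrated_sarfima_def U_def)
  then have adm: "admissible P" by (simp add: stationary_sarfima_def)
  note * = has_spectral_density_stationary_sarfima[OF st]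
  from has_spectral_density_subsample[OF _ has_spectral_density_backshift_poly[OF *], of m "geometric_poly m ^ Suc r"]
  have sd: "has_spectral_density M (backshift_poly (diff_poly (n_seas P) r R z) (aggregate m Y))
    (\<lambda>\<omega>. (1 / real m) * (\<Sum>k\<in>alias_range m \<omega>.
      (cmod (cpoly (geometric_poly m ^ Suc r) (cis ((\<omega> + 2 * of_int k * pi) / real m))))\<^sup>2 *
      sarfima_density P (\<lambda>j. m * z j) ((\<omega> + 2 * of_int k * pi) / real m)))"
    using m unfolding aggregate_diff_eq_subsample U_def by simp
  show ?thesis
  proof (rule has_spectral_density_cong_AE[OF sd])
    have "AE \<omega> in lborel. cis \<omega> \<noteq> 1" using AE_cis_neq_1[of 1] by simp
    then show "AE \<omega> in lborel. \<omega> \<in> {-pi<..pi} \<longrightarrow> (1 / real m) * (\<Sum>k\<in>alias_range m \<omega>.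
      (cmod (cpoly (geometric_poly m ^ Suc r) (cis ((\<omega> + 2 * of_int k * pi) / real m))))\<^sup>2 *
      sarfima_density P (\<lambda>j. m * z j) ((\<omega> + 2 * of_int k * pi) / real m)) = agg_density P r z m \<omega>"
    proof eventually_elim
      case (elim \<omega>)
      then show ?case using folded_sarfima_density_eq[of m \<omega>] m by simp
    qed
  qed (auto simp: agg_density_nonneg[OF adm])
qed

subsection \<open>Integrability of products of powers of sines\<close>

text \<open>A weak form of Jordan's inequality. Up to pi/3 the difference sin y - y/2 increases
  because cos y >= 1/2; beyond it the bound is numerical.\<close>

lemma abs_sin_ge_half:
  fixes x :: real
  assumes "\<bar>x\<bar> \<le> pi / 2"
  shows "\<bar>x\<bar> / 2 \<le> \<bar>sin x\<bar>"
proof -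
  have pos: "y / 2 \<le> sin y" if y: "0 \<le> y" "y \<le> pi / 2" for y :: real
  proof (cases "y \<le> pi / 3")
    case True
    have "0 / 2 - sin 0 \<ge> y / 2 - sin y"
    proof (rule DERIV_nonpos_imp_nonincreasing[OF y(1)])
      fix t :: real assume t: "0 \<le> t" "t \<le> y"
      have "cos (pi / 3) \<le> cos t"
        using t True by (intro cos_monotone_0_pi_le) auto
      then have "1 / 2 - cos t \<le> 0" by (simp add: cos_60)
      moreover have "DERIV (\<lambda>y. y / 2 - sin y) t :> 1 / 2 - cos t"
        by (auto intro!: derivative_eq_intros)
      ultimately show "\<exists>d. DERIV (\<lambda>y. y / 2 - sin y) t :> d \<and> d \<le> 0" by blast
    qed
    then show ?thesis by simp
  next
    case False
    have "sin (pi / 3) \<le> sin y"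
      using False y by (intro sin_monotone_2pi_le) auto
    \<comment> \<open>Thus sin y >= sqrt 3 / 2 > 0.85, while y/2 <= pi/4 < 0.8.\<close>
    moreover have "1.7 < sqrt (3::real)" by (rule real_less_rsqrt) (simp add: power2_eq_square)
    moreover have "y / 2 \<le> 0.8" using y pi_less_4 pi_approx by simp
    ultimately show ?thesis by (simp add: sin_60)
  qed
  show ?thesis
  proof (cases "0 \<le> x")
    case True
    then show ?thesis using pos[of x] assms by simp
  next
    case False
    then show ?thesis using pos[of "- x"] assms by simp
  qed
qed

lemma integrable_abs_powr_around:
  fixes p c x :: real
  assumes p: "p < 1" and c: "0 \<le> c"
  shows "integrable lborel (\<lambda>\<omega>. indicator {-c..c} (\<omega> - x) * \<bar>\<omega> - x\<bar> powr (- p))"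
proof -
  have "(\<lambda>y. y powr (- p)) absolutely_integrable_on {0..c}"
    using p c by (intro nonnegative_absolutely_integrable_1) (auto intro: integrable_on_powr_from_0)
  then have "integrable (completion lborel) (\<lambda>y. indicat_real {0..c} y *\<^sub>R y powr (- p))"
    by (simp add: set_integrable_def)
  then have I: "integrable lborel (\<lambda>y. indicat_real {0..c} y *\<^sub>R y powr (- p))"
    by (subst (asm) integrable_completion) auto
  have "integrable lborel (\<lambda>\<omega>. indicat_real {0..c} (- x + 1 * \<omega>) *\<^sub>R (- x + 1 * \<omega>) powr (- p))"
    "integrable lborel (\<lambda>\<omega>. indicat_real {0..c} (x + (- 1) * \<omega>) *\<^sub>R (x + (- 1) * \<omega>) powr (- p))"
    by (rule lborel_integrable_real_affine[OF I], simp)+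
  then have "integrable lborel (\<lambda>\<omega>. indicat_real {0..c} (- x + 1 * \<omega>) *\<^sub>R (- x + 1 * \<omega>) powr (- p) +
      indicat_real {0..c} (x + (- 1) * \<omega>) *\<^sub>R (x + (- 1) * \<omega>) powr (- p))"
    by (rule Bochner_Integration.integrable_add)
  \<comment> \<open>The two one-sided pieces overlap only at \<omega> = x, where both are 0 because
    \<open>0 powr a = 0\<close>.\<close>
  also have "(\<lambda>\<omega>. indicat_real {0..c} (- x + 1 * \<omega>) *\<^sub>R (- x + 1 * \<omega>) powr (- p) +
      indicat_real {0..c} (x + (- 1) * \<omega>) *\<^sub>R (x + (- 1) * \<omega>) powr (- p)) =
      (\<lambda>\<omega>. indicator {-c..c} (\<omega> - x) * \<bar>\<omega> - x\<bar> powr (- p))"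
    by (rule ext) (auto simp: indicator_def abs_if)
  finally show ?thesis .
qed

text \<open>The zeros are the points 2 k pi / z. At every \<omega> the sine is at least z/4 times
  the distance to the nearest zero, so the sum of the poles at all zeros that can occur is an
  integrable majorant.\<close>

lemma set_integrable_abs_sin_powr:
  assumes z: "0 < (z::nat)" and p: "0 \<le> p" "p < 1"
  shows "set_integrable lborel {-pi<..pi} (\<lambda>\<omega>. \<bar>sin (real z * \<omega> / 2)\<bar> powr (- p))"
  unfolding set_integrable_def
proof (rule Bochner_Integration.integrable_bound)
  let ?x = "\<lambda>k::int. 2 * of_int k * pi / real z"
  let ?F = "\<lambda>\<omega>. \<Sum>k\<in>{- int z..int z}. (real z / 4) powr (- p) * (indicator {-pi..pi} (\<omega> - ?x k) * \<bar>\<omega> - ?x k\<bar> powr (- p))"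
  show "integrable lborel ?F"
    using p by (intro Bochner_Integration.integrable_sum integrable_mult_right integrable_abs_powr_around) auto
  show "(\<lambda>\<omega>. indicat_real {-pi<..pi} \<omega> *\<^sub>R \<bar>sin (real z * \<omega> / 2)\<bar> powr (- p)) \<in> borel_measurable lborel"
    by simp
  have F0: "0 \<le> (real z / 4) powr (- p) * (indicator {-pi..pi} (\<omega> - ?x k) * \<bar>\<omega> - ?x k\<bar> powr (- p))" for \<omega> k
    by simp
  have "norm (indicat_real {-pi<..pi} \<omega> *\<^sub>R \<bar>sin (real z * \<omega> / 2)\<bar> powr (- p)) \<le> norm (?F \<omega>)" for \<omega>
  proof (cases "\<omega> \<in> {-pi<..pi} \<and> sin (real z * \<omega> / 2) \<noteq> 0")
    case True
    \<comment> \<open>Rounding finds the nearest zero and makes |y| <= pi/2, the range of the lower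
      bound for the sine.\<close>
    define k where "k = round (real z * \<omega> / (2 * pi))"
    have r: "\<bar>of_int k - real z * \<omega> / (2 * pi)\<bar> \<le> 1 / 2"
      unfolding k_def by (rule of_int_round_abs_le)
    define y where "y = real z * \<omega> / 2 - of_int k * pi"
    have yk: "y = - ((of_int k - real z * \<omega> / (2 * pi)) * pi)"
      by (simp add: y_def field_simps)
    have "\<bar>y\<bar> = \<bar>of_int k - real z * \<omega> / (2 * pi)\<bar> * pi" unfolding yk by (simp add: abs_mult)
    also have "\<dots> \<le> 1 / 2 * pi" using r by (intro mult_right_mono) auto
    finally have y: "\<bar>y\<bar> \<le> pi / 2" by simp
    have "\<bar>sin (real z * \<omega> / 2)\<bar> = \<bar>sin y\<bar>"
    proof -
      have s0: "sin (of_int k * pi) = 0" using sin_npi_int[of k] by (simp add: mult.commute)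
      then have "\<bar>cos (of_int k * pi)\<bar> = 1"
        using sin_cos_squared_add[of "of_int k * pi"] by (auto simp: power2_eq_1_iff)
      moreover have "sin y = sin (real z * \<omega> / 2) * cos (of_int k * pi)"
        unfolding y_def sin_diff s0 by simp
      ultimately show ?thesis by (simp add: abs_mult)
    qed
    moreover have "\<bar>y\<bar> / 2 \<le> \<bar>sin y\<bar>" by (rule abs_sin_ge_half[OF y])
    moreover have "y = real z / 2 * (\<omega> - ?x k)" using z by (simp add: y_def field_simps)
    then have "\<bar>y\<bar> = \<bar>real z / 2\<bar> * \<bar>\<omega> - ?x k\<bar>" by (simp only: abs_mult)
    then have ay: "\<bar>y\<bar> = real z / 2 * \<bar>\<omega> - ?x k\<bar>" by simp
    ultimately have ge: "real z / 4 * \<bar>\<omega> - ?x k\<bar> \<le> \<bar>sin (real z * \<omega> / 2)\<bar>" by simp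
    have "\<omega> \<noteq> ?x k"
    proof
      assume "\<omega> = ?x k"
      then have "y = 0" using z by (simp add: y_def)
      then show False using True \<open>\<bar>sin (real z * \<omega> / 2)\<bar> = \<bar>sin y\<bar>\<close> by simp
    qed
    then have pos: "0 < real z / 4 * \<bar>\<omega> - ?x k\<bar>" using z by simp
    have b1: "\<bar>sin (real z * \<omega> / 2)\<bar> powr (- p) \<le> (real z / 4 * \<bar>\<omega> - ?x k\<bar>) powr (- p)"
      using p by (intro powr_mono2' pos ge) auto
    have kz: "k \<in> {- int z..int z}"
    proof -
      have "real z * \<omega> \<le> real z * pi" "real z * (- pi) \<le> real z * \<omega>"
        using True by (intro mult_left_mono; simp)+
      then have "real z * \<omega> / (2 * pi) \<le> real z / 2" "- (real z / 2) \<le> real z * \<omega> / (2 * pi)"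
        by (simp_all add: field_simps)
      moreover define q where "q = real z * \<omega> / (2 * pi)"
      ultimately have "q \<le> real z / 2" "- (real z / 2) \<le> q" "\<bar>of_int k - q\<bar> \<le> 1 / 2"
        using r by simp_all
      then have "2 * \<bar>of_int k\<bar> \<le> real z + 1" by linarith
      moreover have "1 \<le> real z" using z by simp
      ultimately have "2 * \<bar>real_of_int k\<bar> < 2 * real z + 1" by linarith
      then show ?thesis by (auto simp: abs_if split: if_splits)
    qed
    have in': "\<omega> - ?x k \<in> {-pi..pi}"
    proof -
      have gen: "t \<in> {-pi..pi}" if "real z / 2 * \<bar>t\<bar> \<le> pi / 2" for t :: real
      proof -
        have "1 * \<bar>t\<bar> \<le> real z * \<bar>t\<bar>" using z by (intro mult_right_mono) auto
        then have "\<bar>t\<bar> \<le> pi" using that by simp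
        then show ?thesis by auto
      qed
      show ?thesis
        using y unfolding ay by (rule gen)
    qed
    have "(real z / 4 * \<bar>\<omega> - ?x k\<bar>) powr (- p) = (real z / 4) powr (- p) * (indicator {-pi..pi} (\<omega> - ?x k) * \<bar>\<omega> - ?x k\<bar> powr (- p))"
      using in' powr_mult[of "real z / 4" "\<bar>\<omega> - ?x k\<bar>" "- p"] by simp
    also have "\<dots> \<le> ?F \<omega>"
      using F0 by (intro member_le_sum[OF kz]) auto
    finally show ?thesis
      using True b1 by simp
  qed (auto simp: indicator_def)
  then show "AE \<omega> in lborel. norm (indicat_real {-pi<..pi} \<omega> *\<^sub>R \<bar>sin (real z * \<omega> / 2)\<bar> powr (- p)) \<le> norm (?F \<omega>)"
    by (intro AE_I2)
qed

text \<open>Replacing every base by the smallest one leaves a single power with the total exponent.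
  Hence only this total matters where several factors vanish together, as at frequency 0. A zero
  base makes the product 0 by the convention for \<open>powr\<close>.\<close>

lemma prod_powr_neg_le_sum:
  fixes s e :: "'i \<Rightarrow> real"
  assumes A: "finite A" "A \<noteq> {}" and s: "\<And>j. j \<in> A \<Longrightarrow> 0 \<le> s j" and e: "\<And>j. j \<in> A \<Longrightarrow> 0 \<le> e j"
  shows "(\<Prod>j\<in>A. s j powr (- e j)) \<le> (\<Sum>j\<in>A. s j powr (- (\<Sum>j\<in>A. e j)))"
proof (cases "\<exists>j\<in>A. s j = 0")
  case True
  then have "(\<Prod>j\<in>A. s j powr (- e j)) = 0" using A(1) by auto
  then show ?thesis by (simp add: sum_nonneg)
next
  case False
  then have pos: "0 < s j" if "j \<in> A" for j using s[OF that] that by force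
  have "Min (s ` A) \<in> s ` A" using A by (intro Min_in) auto
  then obtain i where "i \<in> A" "s i = Min (s ` A)" by auto
  then have i: "i \<in> A" "\<And>j. j \<in> A \<Longrightarrow> s i \<le> s j" using A by auto
  have "(\<Prod>j\<in>A. s j powr (- e j)) \<le> (\<Prod>j\<in>A. s i powr (- e j))"
    using i pos e by (intro prod_mono conjI powr_mono2') auto
  also have "\<dots> = s i powr (- (\<Sum>j\<in>A. e j))"
    using pos[OF i(1)] A(1) by (simp add: powr_sum flip: sum_negf)
  also have "\<dots> \<le> (\<Sum>j\<in>A. s j powr (- (\<Sum>j\<in>A. e j)))"
    using A(1) i(1) by (intro member_le_sum) auto
  finally show ?thesis .
qed

lemma set_integrable_prod_abs_sin_powr:
  fixes z :: "'i \<Rightarrow> nat" and e :: "'i \<Rightarrow> real"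
  assumes A: "finite A" "A \<noteq> {}" and z: "\<And>j. j \<in> A \<Longrightarrow> 0 < z j" and e: "\<And>j. j \<in> A \<Longrightarrow> 0 \<le> e j"
    and sum: "(\<Sum>j\<in>A. e j) < 1"
  shows "set_integrable lborel {-pi<..pi} (\<lambda>\<omega>. \<Prod>j\<in>A. \<bar>sin (real (z j) * \<omega> / 2)\<bar> powr (- e j))"
proof (rule set_integrable_bound)
  show "set_integrable lborel {-pi<..pi} (\<lambda>\<omega>. \<Sum>j\<in>A. \<bar>sin (real (z j) * \<omega> / 2)\<bar> powr (- (\<Sum>j\<in>A. e j)))"
    using sum e z by (intro set_integrable_finite_sum set_integrable_abs_sin_powr sum_nonneg) auto
  show "set_borel_measurable lborel {-pi<..pi} (\<lambda>\<omega>. \<Prod>j\<in>A. \<bar>sin (real (z j) * \<omega> / 2)\<bar> powr (- e j))"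
    unfolding set_borel_measurable_def by simp
  show "AE \<omega> in lborel. \<omega> \<in> {-pi<..pi} \<longrightarrow> norm (\<Prod>j\<in>A. \<bar>sin (real (z j) * \<omega> / 2)\<bar> powr (- e j)) \<le> norm (\<Sum>j\<in>A. \<bar>sin (real (z j) * \<omega> / 2)\<bar> powr (- (\<Sum>j\<in>A. e j)))"
    using prod_powr_neg_le_sum[OF A _ e] by (intro AE_I2 impI) (simp add: prod_nonneg sum_nonneg)
qed

subsection \<open>Existence of the processes bounds the memory parameters\<close>

lemma admissible_cpoly_cis_neq_0:
  assumes "admissible P"
  shows "cpoly (ar P) (cis t) \<noteq> 0" "cpoly (ma P) (cis t) \<noteq> 0"
    and "j \<in> {1..n_seas P} \<Longrightarrow> cpoly (sar P j) (cis t) \<noteq> 0" "j \<in> {1..n_seas P} \<Longrightarrow> cpoly (sma P j) (cis t) \<noteq> 0"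
  using admissible_cpoly_neq_0[OF assms, of _ "cis t"] by (simp_all add: ar_polys_def ma_polys_def)

lemma continuous_on_cpoly [continuous_intros]:
  "continuous_on A f \<Longrightarrow> continuous_on A (\<lambda>x. cpoly p (f x))"
  unfolding cpoly_altdef by (intro continuous_intros)

lemma continuous_on_short_mem_density:
  assumes "admissible P"
  shows "continuous_on A (short_mem_density P)"
  unfolding short_mem_density_def[abs_def] using assms
  by (intro continuous_intros) (auto simp: admissible_cpoly_cis_neq_0)

lemma continuous_on_seasonal_ratio:
  assumes "admissible P"
  shows "continuous_on A (seasonal_ratio P z)"
  unfolding seasonal_ratio_def[abs_def] using assms
  by (intro continuous_intros) (auto simp: admissible_cpoly_cis_neq_0)

lemma short_mem_density_pos:
  assumes "admissible P"
  shows "0 < short_mem_density P \<omega>"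
proof -
  show ?thesis using innov_var_pos[OF assms] admissible_cpoly_cis_neq_0[OF assms] by (simp add: short_mem_density_def)
qed

lemma seasonal_ratio_pos:
  assumes "admissible P"
  shows "0 < seasonal_ratio P z \<omega>"
  unfolding seasonal_ratio_def
proof (rule prod_pos)
  fix j assume "j \<in> {1..n_seas P}"
  then have "cpoly (sma P j) (cis (real (z j) * \<omega>)) \<noteq> 0" "cpoly (sar P j) (cis (real (z j) * \<omega>)) \<noteq> 0"
    using admissible_cpoly_cis_neq_0[OF assms] by auto
  then show "0 < (cmod (cpoly (sma P j) (cis (real (z j) * \<omega>)) / cpoly (sar P j) (cis (real (z j) * \<omega>))))\<^sup>2"
    by simp
qed

text \<open>Logarithmic divergence: the integral over [b - \<delta>, b - \<epsilon>] is at least c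
  ln(\<delta>/\<epsilon>), yet it is bounded by the integral \<open>H\<close> over
  \<open>S\<close>.\<close>

lemma not_set_integrable_inverse_pole:
  fixes f :: "real \<Rightarrow> real"
  assumes f: "set_integrable lborel S f" and f0: "\<And>x. x \<in> S \<Longrightarrow> 0 \<le> f x"
    and c: "0 < c" "0 < \<delta>" and sub: "{b - \<delta>..<b} \<subseteq> S"
    and ge: "\<And>x. x \<in> {b - \<delta>..<b} \<Longrightarrow> c / (b - x) \<le> f x"
  shows False
proof -
  define H where "H = (LBINT x:S. f x)"
  have bound: "c * (ln \<delta> - ln \<epsilon>) \<le> H" if \<epsilon>: "0 < \<epsilon>" "\<epsilon> < \<delta>" for \<epsilon>
  proof -
    let ?J = "{b - \<delta>..b - \<epsilon>}"
    have FTC: "has_bochner_integral lborel (\<lambda>x. indicator ?J x *\<^sub>R (c / (b - x))) (- c * ln (b - (b - \<epsilon>)) - (- c * ln (b - (b - \<delta>))))"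
    proof (rule has_bochner_integral_FTC_Icc)
      show "b - \<delta> \<le> b - \<epsilon>" using \<epsilon> by simp
      fix x assume x: "b - \<delta> \<le> x" "x \<le> b - \<epsilon>"
      then have "0 < b - x" using \<epsilon> by simp
      then have "((\<lambda>x. - c * ln (b - x)) has_real_derivative c / (b - x)) (at x within ?J)"
        by (auto intro!: derivative_eq_intros simp: field_simps)
      then show "((\<lambda>x. - c * ln (b - x)) has_vector_derivative c / (b - x)) (at x within ?J)"
        by (simp add: has_real_derivative_iff_has_vector_derivative)
    next
      show "continuous_on ?J (\<lambda>x. c / (b - x))"
        using \<epsilon> by (intro continuous_intros) auto
    qed
    have "(LINT x|lborel. indicator ?J x *\<^sub>R (c / (b - x))) \<le> H"
      unfolding H_def set_lebesgue_integral_def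
    proof (rule integral_mono)
      show "integrable lborel (\<lambda>x. indicator ?J x *\<^sub>R (c / (b - x)))" using FTC by (simp add: has_bochner_integral_iff)
      show "integrable lborel (\<lambda>x. indicator S x *\<^sub>R f x)" using f by (simp add: set_integrable_def)
      fix x show "indicator ?J x *\<^sub>R (c / (b - x)) \<le> indicator S x *\<^sub>R f x"
      proof (cases "x \<in> ?J")
        case True
        then have x: "x \<in> {b - \<delta>..<b}" using \<epsilon> by auto
        then have "x \<in> S" using sub by blast
        then show ?thesis using True ge[OF x] by simp
      next
        case False
        then show ?thesis using f0[of x] by (auto simp: indicator_def)
      qed
    qed
    then show ?thesis using has_bochner_integral_integral_eq[OF FTC] by (simp add: algebra_simps)
  qed
  have "0 \<le> H"
    unfolding H_def set_lebesgue_integral_def using f0 by (intro Bochner_Integration.integral_nonneg) (auto simp: indicator_def)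
  \<comment> \<open>Chosen so that c ln(\<delta>/\<epsilon>) = H + 1.\<close>
  define \<epsilon> where "\<epsilon> = \<delta> * exp (- (H + 1) / c)"
  have "0 < \<epsilon>" "\<epsilon> < \<delta>" using c \<open>0 \<le> H\<close> by (simp_all add: \<epsilon>_def field_simps)
  moreover have "ln \<epsilon> = ln \<delta> - (H + 1) / c" using c by (simp add: \<epsilon>_def ln_mult field_simps)
  ultimately have "c * ((H + 1) / c) \<le> H" using bound[of \<epsilon>] by simp
  then show False using c by simp
qed

text \<open>For \<open>m = 2\<close> every seasonal factor has a zero at the frequency \<open>\<pi>\<close>, where \<open>1 - B\<close> has none; so
  integrability of the spectral density there involves only the seasonal exponents.\<close>

lemma sum_smem_less_half:
  assumes adm: "admissible P" and c: "1 \<le> n_seas P" and z: "\<And>j. j \<in> {1..n_seas P} \<Longrightarrow> 0 < z j"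
    and int: "set_integrable lborel {-pi<..pi} (sarfima_density P (\<lambda>j. 2 * z j))"
  shows "(\<Sum>j=1..n_seas P. smem P j) < 1 / 2"
proof (rule ccontr)
  assume "\<not> ?thesis"
  then have D: "1 / 2 \<le> (\<Sum>j=1..n_seas P. smem P j)" by simp
  \<comment> \<open>These factors are continuous and positive at pi, where 1 - e^(i \<omega>) equals
    2.\<close>
  define G where "G \<omega> = short_mem_density P \<omega> * seasonal_ratio P (\<lambda>j. 2 * z j) \<omega> * cmod (1 - cis \<omega>) powr (- 2 * mem P)" for \<omega>
  \<comment> \<open>A common bound for all z_j: near pi, every seasonal base is at most 2 Z times
    the distance to pi.\<close>
  define Z where "Z = real (\<Sum>j=1..n_seas P. z j)"
  have zZ: "real (z j) \<le> Z" if "j \<in> {1..n_seas P}" for j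
    unfolding Z_def using that by (intro of_nat_mono member_le_sum) auto
  have Z: "1 \<le> Z" using zZ[of 1] z[of 1] c by simp
  have G0: "0 < G pi"
    unfolding G_def by (intro mult_pos_pos short_mem_density_pos seasonal_ratio_pos adm) simp
  have "isCont G pi"
  proof -
    have "isCont (short_mem_density P) pi" "isCont (seasonal_ratio P (\<lambda>j. 2 * z j)) pi"
      using continuous_on_short_mem_density[OF adm, of UNIV] continuous_on_seasonal_ratio[OF adm, of UNIV]
      by (auto simp: continuous_on_eq_continuous_at)
    moreover have "isCont cis pi"
      using continuous_on_cis[OF continuous_on_id, of UNIV] by (auto simp: continuous_on_eq_continuous_at)
    ultimately show ?thesis unfolding G_def[abs_def]
      by (intro continuous_intros) auto
  qed
  then have "eventually (\<lambda>\<omega>. G pi / 2 < G \<omega>) (at pi)"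
    using G0 by (intro order_tendstoD(1)) (auto simp: isCont_def)
  then obtain d where d: "0 < d" "\<And>\<omega>. \<omega> \<noteq> pi \<Longrightarrow> dist \<omega> pi < d \<Longrightarrow> G pi / 2 < G \<omega>"
    by (auto simp: eventually_at)
  \<comment> \<open>The first bound keeps \<open>G\<close> above half its value at pi, the second
    makes 2 Z u <= 1 for distances u up to \<delta>.\<close>
  define \<delta> where "\<delta> = min (d / 2) (1 / (2 * Z))"
  have \<delta>: "0 < \<delta>" "\<delta> < d" "\<delta> \<le> 1 / (2 * Z)" "\<delta> \<le> 1 / 2"
  proof -
    have "1 / (2 * Z) \<le> 1 / 2" "0 < 1 / (2 * Z)" using Z by (simp_all add: field_simps)
    then show "0 < \<delta>" "\<delta> < d" "\<delta> \<le> 1 / (2 * Z)" "\<delta> \<le> 1 / 2" using d(1) unfolding \<delta>_def by linarith+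
  qed
  show False
  proof (rule not_set_integrable_inverse_pole[OF int, of "G pi / 2 / (2 * Z)" \<delta> pi])
    show "0 \<le> sarfima_density P (\<lambda>j. 2 * z j) x" for x by (rule sarfima_density_nonneg[OF adm])
    show "0 < G pi / 2 / (2 * Z)" using G0 Z by simp
    show "0 < \<delta>" by fact
    show "{pi - \<delta>..<pi} \<subseteq> {-pi<..pi}" using \<delta>(4) pi_gt3 by auto
    fix x assume x: "x \<in> {pi - \<delta>..<pi}"
    define u where "u = pi - x"
    have u: "0 < u" "u \<le> \<delta>" "2 * Z * u \<le> 1"
    proof -
      show "0 < u" "u \<le> \<delta>" using x by (auto simp: u_def)
      then have "u \<le> 1 / (2 * Z)" using \<delta>(3) by linarith
      then show "2 * Z * u \<le> 1" using Z by (simp add: field_simps)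
    qed
    have G: "G pi / 2 \<le> G x"
      using d(2)[of x] x \<delta>(2) by (intro less_imp_le) (auto simp: dist_real_def)
    \<comment> \<open>The assumption to be refuted makes the exponent on the right at most -1, and
      the base is at most 1.\<close>
    have "(2 * Z * u) powr (- 1) \<le> (2 * Z * u) powr (- 2 * (\<Sum>j=1..n_seas P. smem P j))"
      using u Z D by (intro powr_mono') auto
    also have "\<dots> = (\<Prod>j=1..n_seas P. (2 * Z * u) powr (- 2 * smem P j))"
      using u Z by (simp add: powr_sum sum_distrib_left flip: sum_negf)
    also have "\<dots> \<le> (\<Prod>j=1..n_seas P. cmod (1 - cis (real (2 * z j) * x)) powr (- 2 * smem P j))"
    proof (intro prod_mono conjI)
      fix j assume j: "j \<in> {1..n_seas P}"
      have zu: "0 < real (z j) * u" "real (z j) * u \<le> Z * u"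
        using u z[OF j] zZ[OF j] by auto
      have "cmod (1 - cis (real (2 * z j) * x)) = 2 * \<bar>sin (real (z j) * x)\<bar>"
        by (simp add: norm_one_minus_cis abs_mult)
      \<comment> \<open>Reflection at pi changes the sine of an integer multiple by a sign
        only.\<close>
      also have "\<bar>sin (real (z j) * x)\<bar> = \<bar>sin (real (z j) * u)\<bar>"
        unfolding u_def by (simp add: algebra_simps sin_diff abs_mult sin_npi cos_npi)
      finally have e: "cmod (1 - cis (real (2 * z j) * x)) = 2 * \<bar>sin (real (z j) * u)\<bar>" .
      have "0 < sin (real (z j) * u)"
        using zu u(3) pi_gt3 by (intro sin_gt_zero) auto
      then have pos: "0 < cmod (1 - cis (real (2 * z j) * x))" unfolding e by simp
      have "cmod (1 - cis (real (2 * z j) * x)) \<le> 2 * Z * u"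
        unfolding e using abs_sin_x_le_abs_x[of "real (z j) * u"] zu by simp
      then show "(2 * Z * u) powr (- 2 * smem P j) \<le> cmod (1 - cis (real (2 * z j) * x)) powr (- 2 * smem P j)"
        using pos smem_bounds(1)[OF adm j] by (intro powr_mono2') auto
    qed simp
    finally have "(2 * Z * u) powr (- 1) \<le> (\<Prod>j=1..n_seas P. cmod (1 - cis (real (2 * z j) * x)) powr (- 2 * smem P j))" .
    then have "G pi / 2 * (2 * Z * u) powr (- 1) \<le> G x * (\<Prod>j=1..n_seas P. cmod (1 - cis (real (2 * z j) * x)) powr (- 2 * smem P j))"
      using G G0 by (intro mult_mono) auto
    moreover have "(2 * Z * u) powr (- 1) = 1 / (2 * Z * u)" using u Z by (simp add: powr_minus_divide)
    ultimately show "G pi / 2 / (2 * Z) / (pi - x) \<le> sarfima_density P (\<lambda>j. 2 * z j) x"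
      by (simp add: sarfima_density_def G_def u_def)
  qed
qed

subsection \<open>The limit of the aliased sums\<close>

lemma summable_alias_majorant:
  fixes a :: real
  assumes a: "1 < a"
  shows "summable (\<lambda>n. (real n / 2) powr (- a))"
proof -
  have "summable (\<lambda>n. (1 / 2) powr (- a) * real n powr (- a))"
    using a by (intro summable_mult) (simp add: summable_real_powr_iff)
  moreover have "(1 / 2) powr (- a) * real n powr (- a) = (real n / 2) powr (- a)" for n
    using powr_mult[of "1 / 2" "real n" "- a"] by simp
  ultimately show ?thesis by simp
qed

text \<open>\<open>int_decode\<close> runs through 0, -1, 1, -2, 2, ..., so |k| >= n/2. For k
  different from 0, |\<omega> + 2 k pi| >= 2 |k| pi - pi >= |k| pi. The term \<open>n = 0\<close> is
  kept apart since it belongs to k = 0, which has the pole.\<close>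

lemma alias_term_le:
  fixes a \<omega> :: real
  assumes a: "1 < a" and \<omega>: "\<omega> \<in> {-pi<..pi}" and n: "0 < n"
  shows "\<bar>\<omega> + 2 * of_int (int_decode n) * pi\<bar> powr (- a) \<le> (real n / 2) powr (- a)"
proof -
  define k where "k = int_decode n"
  have k: "real n / 2 \<le> \<bar>real_of_int k\<bar>"
    unfolding k_def int_decode_def sum_decode_def by (auto elim!: evenE oddE)
  then have "1 \<le> \<bar>k\<bar>" using n by (cases "k = 0") auto
  then have k1: "1 \<le> \<bar>real_of_int k\<bar>" by (simp flip: of_int_abs)
  have "2 * \<bar>of_int k\<bar> * pi \<le> \<bar>\<omega> + 2 * of_int k * pi\<bar> + \<bar>\<omega>\<bar>"
    using abs_triangle_ineq4[of "\<omega> + 2 * of_int k * pi" \<omega>] by (simp add: abs_mult)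
  moreover have "\<bar>\<omega>\<bar> \<le> 1 * pi" using \<omega> by auto
  moreover have "1 * pi \<le> \<bar>of_int k\<bar> * pi" using k1 by (intro mult_right_mono) auto
  ultimately have "\<bar>of_int k\<bar> * pi \<le> \<bar>\<omega> + 2 * of_int k * pi\<bar>" by linarith
  moreover have "\<bar>of_int k\<bar> * 1 \<le> \<bar>of_int k\<bar> * pi" using pi_gt3 by (intro mult_left_mono) auto
  ultimately have "real n / 2 \<le> \<bar>\<omega> + 2 * of_int k * pi\<bar>" using k by linarith
  then show ?thesis
    unfolding k_def[symmetric] using n a by (intro powr_mono2') auto
qed

lemma summable_alias_terms:
  fixes a \<omega> :: real
  assumes a: "1 < a" and \<omega>: "\<omega> \<in> {-pi<..pi}"
  shows "summable (\<lambda>n. \<bar>\<omega> + 2 * of_int (int_decode n) * pi\<bar> powr (- a))"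
  by (rule summable_comparison_test'[OF summable_alias_majorant[OF a], of 1])
    (use alias_term_le[OF a \<omega>] in auto)

lemma summable_on_alias_terms:
  fixes a \<omega> :: real
  assumes a: "1 < a" and \<omega>: "\<omega> \<in> {-pi<..pi}"
  shows "(\<lambda>k::int. \<bar>\<omega> + 2 * of_int k * pi\<bar> powr (- a)) summable_on UNIV"
proof -
  have "(\<lambda>n. \<bar>\<omega> + 2 * of_int (int_decode n) * pi\<bar> powr (- a)) summable_on UNIV"
    using summable_alias_terms[OF assms] by (intro norm_summable_imp_summable_on) simp
  then show ?thesis
    by (subst (asm) summable_on_reindex_bij_betw[OF bij_int_decode])
qed

lemma has_sum_int_sums:
  fixes f :: "int \<Rightarrow> real"
  assumes "(f has_sum S) UNIV"
  shows "(\<lambda>n. f (int_decode n)) sums S"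
  using assms by (intro has_sum_imp_sums) (subst has_sum_reindex_bij_betw[OF bij_int_decode])

lemma infsum_alias_eq_suminf:
  fixes a \<omega> :: real
  assumes "1 < a" "\<omega> \<in> {-pi<..pi}"
  shows "(\<Sum>\<^sub>\<infinity>k::int. \<bar>\<omega> + 2 * of_int k * pi\<bar> powr (- a)) = (\<Sum>n. \<bar>\<omega> + 2 * of_int (int_decode n) * pi\<bar> powr (- a))"
  using has_sum_int_sums[OF has_sum_infsum[OF summable_on_alias_terms[OF assms]]] by (simp add: sums_iff)

text \<open>Only the alias k = 0 is singular at \<omega> = 0; all others together are bounded
  uniformly in \<omega>.\<close>

lemma infsum_alias_le:
  fixes a \<omega> :: real
  assumes a: "1 < a" and \<omega>: "\<omega> \<in> {-pi<..pi}"
  shows "(\<Sum>\<^sub>\<infinity>k::int. \<bar>\<omega> + 2 * of_int k * pi\<bar> powr (- a)) \<le> \<bar>\<omega>\<bar> powr (- a) + (\<Sum>n. (real n / 2) powr (- a))"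
proof -
  have "int_decode 0 = 0" by (simp add: int_decode_def sum_decode_def)
  then have "(\<Sum>n. \<bar>\<omega> + 2 * of_int (int_decode n) * pi\<bar> powr (- a)) =
      \<bar>\<omega>\<bar> powr (- a) + (\<Sum>n. \<bar>\<omega> + 2 * of_int (int_decode (Suc n)) * pi\<bar> powr (- a))"
    using suminf_split_head[OF summable_alias_terms[OF a \<omega>]] by simp
  also have "(\<Sum>n. \<bar>\<omega> + 2 * of_int (int_decode (Suc n)) * pi\<bar> powr (- a)) \<le> (\<Sum>n. (real (Suc n) / 2) powr (- a))"
    using alias_term_le[OF a \<omega>] summable_alias_terms[OF a \<omega>] summable_alias_majorant[OF a]
    by (intro suminf_le) (auto simp: summable_Suc_iff[of "\<lambda>n. \<bar>\<omega> + 2 * of_int (int_decode n) * pi\<bar> powr (- a)"] summable_Suc_iff[of "\<lambda>n. (real n / 2) powr (- a)"] simp del: of_nat_Suc)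
  also have "(\<Sum>n. (real (Suc n) / 2) powr (- a)) = (\<Sum>n. (real n / 2) powr (- a))"
    using suminf_split_head[OF summable_alias_majorant[OF a]] by simp
  finally show ?thesis unfolding infsum_alias_eq_suminf[OF assms] by simp
qed

text \<open>As x/(2m) lies in [-pi/2, pi/2], the linear lower bound for the sine gives 2 m
  |sin(x/(2m))| >= |x|/2. This holds for all aliases uniformly in \<open>m\<close>, which yields the
  domination.\<close>

lemma scaled_sin_powr_le:
  fixes a x :: real
  assumes m: "0 < m" and x: "x / real m \<in> {-pi<..pi}" and a: "0 \<le> a"
  shows "\<bar>2 * real m * sin (x / (2 * real m))\<bar> powr (- a) \<le> 2 powr a * \<bar>x\<bar> powr (- a)"
proof (cases "x = 0")
  case False
  have "\<bar>x / real m\<bar> \<le> pi" using x by auto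
  then have "\<bar>x / (2 * real m)\<bar> \<le> pi / 2"
    by (simp add: abs_mult)
  from mult_left_mono[OF abs_sin_ge_half[OF this], of "2 * real m"]
  have ge: "\<bar>x\<bar> / 2 \<le> \<bar>2 * real m * sin (x / (2 * real m))\<bar>"
    using m by (simp add: abs_mult)
  then have "\<bar>2 * real m * sin (x / (2 * real m))\<bar> powr (- a) \<le> (\<bar>x\<bar> / 2) powr (- a)"
    using False a by (intro powr_mono2') auto
  also have "\<dots> = 2 powr a * \<bar>x\<bar> powr (- a)"
    by (simp add: powr_divide powr_minus field_simps)
  finally show ?thesis .
qed simp

text \<open>The factor \<open>m\<close> inside the sine normalizes the terms: for fixed k they
  converge to g(0) |\<omega> + 2 k pi|^(-a).\<close>

definition scaled_alias_sum :: "(real \<Rightarrow> real) \<Rightarrow> real \<Rightarrow> nat \<Rightarrow> real \<Rightarrow> real" where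
  "scaled_alias_sum g a m \<omega> = (\<Sum>k\<in>alias_range m \<omega>.
     \<bar>2 * real m * sin ((\<omega> + 2 * of_int k * pi) / (2 * real m))\<bar> powr (- a) * g ((\<omega> + 2 * of_int k * pi) / real m))"

lemma scaled_alias_sum_le:
  assumes a: "1 < a" and m: "0 < m" and \<omega>: "\<omega> \<in> {-pi<..pi}"
    and g: "\<And>x. 0 \<le> g x" "\<And>x. x \<in> {-pi<..pi} \<Longrightarrow> g x \<le> G"
  shows "scaled_alias_sum g a m \<omega> \<le> 2 powr a * G * (\<Sum>\<^sub>\<infinity>k::int. \<bar>\<omega> + 2 * of_int k * pi\<bar> powr (- a))"
proof -
  have "scaled_alias_sum g a m \<omega> \<le> (\<Sum>k\<in>alias_range m \<omega>. 2 powr a * \<bar>\<omega> + 2 * of_int k * pi\<bar> powr (- a) * G)"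
    unfolding scaled_alias_sum_def
    using alias_range_iff[OF m] \<omega> a g by (intro sum_mono mult_mono scaled_sin_powr_le[OF m]) auto
  also have "\<dots> = 2 powr a * G * (\<Sum>k\<in>alias_range m \<omega>. \<bar>\<omega> + 2 * of_int k * pi\<bar> powr (- a))"
    by (simp add: sum_distrib_left mult_ac)
  also have "\<dots> \<le> 2 powr a * G * (\<Sum>\<^sub>\<infinity>k::int. \<bar>\<omega> + 2 * of_int k * pi\<bar> powr (- a))"
    using g(1)[of 0] g(2)[of 0]
    by (intro mult_left_mono finite_sum_le_infsum summable_on_alias_terms a \<omega>) auto
  finally show ?thesis .
qed

lemma tendsto_scaled_sin: "(\<lambda>m. 2 * real m * sin (x / (2 * real m))) \<longlonglongrightarrow> x"
proof (cases "x = 0")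
  case False
  then show ?thesis by real_asymp
qed simp

text \<open>Tannery's theorem: the finite sums become series over the enumerated integers, with
  zeros outside the alias range, and the terms are dominated by a multiple of the limiting
  series.\<close>

lemma scaled_alias_sum_tendsto:
  assumes a: "1 < a" and \<omega>: "\<omega> \<in> {-pi<..pi}" "\<omega> \<noteq> 0"
    and g: "continuous_on UNIV g" "\<And>x. 0 \<le> g x" "\<And>x. x \<in> {-pi<..pi} \<Longrightarrow> g x \<le> G"
  shows "(\<lambda>m. scaled_alias_sum g a m \<omega>) \<longlonglongrightarrow> g 0 * (\<Sum>\<^sub>\<infinity>k::int. \<bar>\<omega> + 2 * of_int k * pi\<bar> powr (- a))"
proof -
  define x where "x n = \<omega> + 2 * of_int (int_decode n) * pi" for n
  define T where "T n m = (if int_decode n \<in> alias_range m \<omega> then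
     \<bar>2 * real m * sin (x n / (2 * real m))\<bar> powr (- a) * g (x n / real m) else 0)" for n m
  have G0: "0 \<le> G" using g(2)[of 0] g(3)[of 0] by simp
  \<comment> \<open>A zero would put \<omega> at a multiple of 2 pi. Nonzero limits are needed for
    continuity of \<open>powr\<close> with a negative exponent.\<close>
  have x0: "x n \<noteq> 0" for n
  proof
    assume "x n = 0"
    then have e: "\<omega> = - 2 * of_int (int_decode n) * pi" by (simp add: x_def)
    have "\<bar>of_int (int_decode n)\<bar> * (2 * pi) = \<bar>\<omega>\<bar>" unfolding e by (simp add: abs_mult)
    also have "\<dots> < 1 * (2 * pi)" using \<omega>(1) by auto
    finally have "\<bar>real_of_int (int_decode n)\<bar> < 1" by (simp add: mult_less_cancel_right)
    then have "int_decode n = 0" by linarith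
    with e \<omega>(2) show False by simp
  qed
  have "(\<lambda>m. \<Sum>n. T n m) \<longlonglongrightarrow> (\<Sum>n. g 0 * \<bar>x n\<bar> powr (- a))"
  proof (rule tannerys_theorem[THEN conjunct2, THEN conjunct2])
    show "(\<lambda>m. T n m) \<longlonglongrightarrow> g 0 * \<bar>x n\<bar> powr (- a)" for n
    proof (rule Lim_transform_eventually)
      have "isCont g 0" using g(1) by (simp add: continuous_on_eq_continuous_at)
      moreover have "(\<lambda>m. x n / real m) \<longlonglongrightarrow> 0" by real_asymp
      ultimately have t1: "(\<lambda>m. g (x n / real m)) \<longlonglongrightarrow> g 0" by (rule isCont_tendsto_compose)
      have t2: "(\<lambda>m. \<bar>2 * real m * sin (x n / (2 * real m))\<bar> powr (- a)) \<longlonglongrightarrow> \<bar>x n\<bar> powr (- a)"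
        using x0[of n] by (intro tendsto_intros tendsto_scaled_sin) auto
      show "(\<lambda>m. \<bar>2 * real m * sin (x n / (2 * real m))\<bar> powr (- a) * g (x n / real m)) \<longlonglongrightarrow> g 0 * \<bar>x n\<bar> powr (- a)"
        unfolding mult.commute[of "g 0"] by (rule tendsto_mult[OF t2 t1])
      \<comment> \<open>Every fixed k belongs to the alias range once \<open>m\<close> is
        large.\<close>
      have "eventually (\<lambda>m. \<bar>x n\<bar> < real m * pi) sequentially" by real_asymp
      then show "eventually (\<lambda>m. \<bar>2 * real m * sin (x n / (2 * real m))\<bar> powr (- a) * g (x n / real m) = T n m) sequentially"
        using eventually_gt_at_top[of 0]
      proof eventually_elim
        case (elim m)
        have "- pi < x n / real m" "x n / real m \<le> pi"
          using elim by (auto simp: field_simps)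
        then have "int_decode n \<in> alias_range m \<omega>"
          using alias_range_iff[OF elim(2), of \<omega> "int_decode n"] \<omega>(1) by (simp add: x_def)
        then show ?case by (simp add: T_def)
      qed
    qed
    have T_le: "norm (T n m) \<le> G * 2 powr a * \<bar>x n\<bar> powr (- a)" if m: "0 < m" for n m
    proof (cases "int_decode n \<in> alias_range m \<omega>")
      case True
      then have xm: "x n / real m \<in> {-pi<..pi}"
        using alias_range_iff[OF m, of \<omega> "int_decode n"] \<omega>(1) by (simp add: x_def)
      have "\<bar>2 * real m * sin (x n / (2 * real m))\<bar> powr (- a) * g (x n / real m) \<le> 2 powr a * \<bar>x n\<bar> powr (- a) * G"
        using a g xm by (intro mult_mono scaled_sin_powr_le[OF m]) auto
      then show ?thesis using True g(2) by (simp add: T_def abs_mult mult_ac)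
    next
      case False
      then show ?thesis using G0 by (simp add: T_def)
    qed
    show "eventually (\<lambda>(n, m). norm (T n m) \<le> G * 2 powr a * \<bar>x n\<bar> powr (- a)) (at_top \<times>\<^sub>F sequentially)"
    proof (rule eventually_mono[OF eventually_prodI[OF always_eventually[of "\<lambda>_. True"] eventually_gt_at_top[of 0]]])
      fix nm :: "nat \<times> nat" assume "True \<and> 0 < snd nm"
      then show "case nm of (n, m) \<Rightarrow> norm (T n m) \<le> G * 2 powr a * \<bar>x n\<bar> powr (- a)"
        using T_le by (cases nm) auto
    qed simp
    show "summable (\<lambda>n. G * 2 powr a * \<bar>x n\<bar> powr (- a))"
      unfolding x_def by (intro summable_mult summable_alias_terms a \<omega>)
  qed simp
  moreover have "(\<Sum>n. T n m) = scaled_alias_sum g a m \<omega>" for m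
  proof -
    let ?t = "\<lambda>k. \<bar>2 * real m * sin ((\<omega> + 2 * of_int k * pi) / (2 * real m))\<bar> powr (- a) * g ((\<omega> + 2 * of_int k * pi) / real m)"
    have "(?t has_sum scaled_alias_sum g a m \<omega>) (alias_range m \<omega>)"
      unfolding scaled_alias_sum_def by (rule has_sum_finite) simp
    then have "((\<lambda>k. if k \<in> alias_range m \<omega> then ?t k else 0) has_sum scaled_alias_sum g a m \<omega>) UNIV"
      by (subst (asm) has_sum_cong_neutral[where T = UNIV and g = "\<lambda>k. if k \<in> alias_range m \<omega> then ?t k else 0"]) auto
    from has_sum_int_sums[OF this] show ?thesis
      unfolding T_def x_def by (simp add: sums_iff)
  qed
  moreover have "(\<Sum>n. g 0 * \<bar>x n\<bar> powr (- a)) = g 0 * (\<Sum>\<^sub>\<infinity>k::int. \<bar>\<omega> + 2 * of_int k * pi\<bar> powr (- a))"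
    unfolding infsum_alias_eq_suminf[OF a \<omega>(1)] x_def
    by (rule suminf_mult[OF summable_alias_terms[OF a \<omega>(1)]])
  ultimately show ?thesis by simp
qed

subsection \<open>The limit of the normalized spectral densities\<close>

text \<open>The part independent of \<open>m\<close> that, apart from powers of 2, the aggregated
  densities share with the limit kernel.\<close>

definition kernel_factor :: "sarfima_params \<Rightarrow> nat \<Rightarrow> (nat \<Rightarrow> nat) \<Rightarrow> real \<Rightarrow> real" where
  "kernel_factor P r z \<omega> = \<bar>sin (\<omega> / 2)\<bar> ^ (2 * r + 2) *
     (\<Prod>j=1..n_seas P. \<bar>sin (real (z j) * \<omega> / 2)\<bar> powr (- 2 * smem P j)) * seasonal_ratio P z \<omega>"

lemma kernel_factor_nonneg: "0 \<le> kernel_factor P r z \<omega>"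
  unfolding kernel_factor_def by (intro mult_nonneg_nonneg prod_nonneg seasonal_ratio_nonneg) auto

lemma measurable_kernel_factor [measurable]: "kernel_factor P r z \<in> borel_measurable borel"
  unfolding kernel_factor_def[abs_def] by measurable

lemma limit_kernel_eq:
  "limit_kernel P r z \<omega> = kernel_factor P r z \<omega> * (\<Sum>\<^sub>\<infinity>k::int. \<bar>\<omega> + 2 * of_int k * pi\<bar> powr (- (2 * real r + 2 * mem P + 2)))"
proof -
  have e: "- 2 * real r - 2 * mem P - 2 = - (2 * real r + 2 * mem P + 2)" by simp
  show ?thesis unfolding limit_kernel_def kernel_factor_def e ..
qed

text \<open>Putting \<open>m\<close> into the sines costs m^a with a = 2r + 2d + 2, and the
  prefactor 1/m lowers this to m^(a-1). All of \<open>m\<close> outside the rescaled sum, and all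
  powers of 2, become a constant that normalization removes.\<close>

lemma agg_density_eq:
  assumes m: "0 < m"
  shows "agg_density P r z m \<omega> = real m powr (2 * real r + 2 * mem P + 1) *
    (2 ^ (2 * r + 2) * 2 powr (- 2 * (\<Sum>j=1..n_seas P. smem P j)) *
     (kernel_factor P r z \<omega> * scaled_alias_sum (short_mem_density P) (2 * real r + 2 * mem P + 2) m \<omega>))"
proof -
  define a where "a = 2 * real r + 2 * mem P + 2"
  have s: "\<bar>2 * sin y\<bar> powr (- a) = real m powr a * \<bar>2 * real m * sin y\<bar> powr (- a)" for y
  proof -
    have "\<bar>2 * real m * sin y\<bar> powr (- a) = real m powr (- a) * \<bar>2 * sin y\<bar> powr (- a)"
      using powr_mult[of "real m" "\<bar>2 * sin y\<bar>" "- a"] m by (simp add: abs_mult mult_ac)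
    then show ?thesis using m by (simp add: powr_minus)
  qed
  have p: "(\<Prod>j=1..n_seas P. \<bar>2 * sin (real (z j) * \<omega> / 2)\<bar> powr (- 2 * smem P j)) =
     2 powr (- 2 * (\<Sum>j=1..n_seas P. smem P j)) * (\<Prod>j=1..n_seas P. \<bar>sin (real (z j) * \<omega> / 2)\<bar> powr (- 2 * smem P j))"
  proof -
    have "(\<Prod>j=1..n_seas P. \<bar>2 * sin (real (z j) * \<omega> / 2)\<bar> powr (- 2 * smem P j)) =
      (\<Prod>j=1..n_seas P. 2 powr (- 2 * smem P j)) * (\<Prod>j=1..n_seas P. \<bar>sin (real (z j) * \<omega> / 2)\<bar> powr (- 2 * smem P j))"
      by (simp add: abs_mult powr_mult prod.distrib)
    also have "(\<Prod>j=1..n_seas P. (2::real) powr (- 2 * smem P j)) = 2 powr (\<Sum>j=1..n_seas P. - 2 * smem P j)"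
      by (rule powr_sum[symmetric]) auto
    finally show ?thesis by (simp add: sum_distrib_left)
  qed
  have e: "- 2 * real r - 2 * mem P - 2 = - a" by (simp add: a_def)
  have sum: "(\<Sum>k\<in>alias_range m \<omega>. \<bar>2 * sin ((\<omega> + 2 * of_int k * pi) / (2 * real m))\<bar> powr (- a) *
        short_mem_density P ((\<omega> + 2 * of_int k * pi) / real m)) = real m powr a * scaled_alias_sum (short_mem_density P) a m \<omega>"
    unfolding scaled_alias_sum_def sum_distrib_left s by (simp only: mult.assoc)
  have q: "\<bar>2 * sin (\<omega> / 2)\<bar> ^ n = 2 ^ n * \<bar>sin (\<omega> / 2)\<bar> ^ n" for n
    by (simp add: abs_mult power_mult_distrib)
  have "agg_density P r z m \<omega> = (1 / real m * real m powr a) *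
    (2 ^ (2 * r + 2) * 2 powr (- 2 * (\<Sum>j=1..n_seas P. smem P j)) * (kernel_factor P r z \<omega> * scaled_alias_sum (short_mem_density P) a m \<omega>))"
    unfolding agg_density_def e sum p q kernel_factor_def by (simp only: mult_ac)
  also have "1 / real m * real m powr a = real m powr (a - 1)"
    using m by (simp add: powr_diff)
  also have "a - 1 = 2 * real r + 2 * mem P + 1" by (simp add: a_def)
  finally show ?thesis unfolding a_def .
qed

context
  fixes P :: sarfima_params and r :: nat and z :: "nat \<Rightarrow> nat"
  assumes adm: "admissible P" and c: "1 \<le> n_seas P" and z: "\<And>j. j \<in> {1..n_seas P} \<Longrightarrow> 0 < z j"
    and D: "(\<Sum>j=1..n_seas P. smem P j) < 1 / 2"
begin

lemma exponent_gt_1: "1 < 2 * real r + 2 * mem P + 2"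
proof -
  have "0 \<le> mem P + (\<Sum>j=1..n_seas P. smem P j)" using adm by (simp add: admissible_def)
  then show ?thesis using D by simp
qed

lemma measurable_limit_kernel: "(\<lambda>\<omega>. indicator {-pi<..pi} \<omega> *\<^sub>R limit_kernel P r z \<omega>) \<in> borel_measurable borel"
proof -
  let ?a = "2 * real r + 2 * mem P + 2"
  have "(\<lambda>\<omega>. indicator {-pi<..pi} \<omega> *\<^sub>R limit_kernel P r z \<omega>) =
    (\<lambda>\<omega>. indicator {-pi<..pi} \<omega> *\<^sub>R (kernel_factor P r z \<omega> * (\<Sum>n. \<bar>\<omega> + 2 * of_int (int_decode n) * pi\<bar> powr (- ?a))))"
  proof
    fix \<omega>
    show "indicator {-pi<..pi} \<omega> *\<^sub>R limit_kernel P r z \<omega> =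
      indicator {-pi<..pi} \<omega> *\<^sub>R (kernel_factor P r z \<omega> * (\<Sum>n. \<bar>\<omega> + 2 * of_int (int_decode n) * pi\<bar> powr (- ?a)))"
    proof (cases "\<omega> \<in> {-pi<..pi}")
      case True
      show ?thesis unfolding limit_kernel_eq infsum_alias_eq_suminf[OF exponent_gt_1 True] ..
    qed simp
  qed
  also have "\<dots> \<in> borel_measurable borel" by measurable
  finally show ?thesis .
qed

lemma set_integrable_limit_kernel: "set_integrable lborel {-pi<..pi} (limit_kernel P r z)"
proof -
  \<comment> \<open>The singularity that remains at frequency 0 is treated as one more seasonal
    factor, with index 0, period 1 and exponent 2 max(0, d). The total exponent is below 1 by
    admissibility if d >= 0, and by \<open>D\<close> if d < 0.\<close>
  define d where "d = max 0 (mem P)"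
  define z' where "z' j = (if j = 0 then 1 else z j)" for j
  define e where "e j = (if j = 0 then 2 * d else 2 * smem P j)" for j
  let ?a = "2 * real r + 2 * mem P + 2"
  have split: "{0..n_seas P} = insert 0 {1..n_seas P}" by auto
  have "(\<Sum>j=0..n_seas P. e j) = 2 * d + 2 * (\<Sum>j=1..n_seas P. smem P j)"
    unfolding split by (subst sum.insert) (auto simp: e_def sum_distrib_left)
  also have "\<dots> < 1"
    using D adm by (simp add: d_def admissible_def max_def)
  finally have sum: "(\<Sum>j=0..n_seas P. e j) < 1" .
  have e0: "0 \<le> e j" if "j \<in> {0..n_seas P}" for j
    using smem_bounds(1)[OF adm, of j] that by (auto simp: e_def d_def)
  have zp: "0 < z' j" if "j \<in> {0..n_seas P}" for j
    using z[of j] that by (auto simp: z'_def)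
  obtain B where B: "\<And>\<omega>. \<omega> \<in> {-pi..pi} \<Longrightarrow> seasonal_ratio P z \<omega> \<le> B"
  proof -
    have "bounded (seasonal_ratio P z ` {-pi..pi})"
      by (intro compact_imp_bounded compact_continuous_image continuous_on_seasonal_ratio adm) simp
    then obtain B where "\<And>\<omega>. \<omega> \<in> {-pi..pi} \<Longrightarrow> norm (seasonal_ratio P z \<omega>) \<le> B"
      unfolding bounded_iff by blast
    then show ?thesis using that[of B] by fastforce
  qed
  \<comment> \<open>Uniform bound for the aliases other than k = 0.\<close>
  define C where "C = (\<Sum>n. (real n / 2) powr (- ?a))"
  have C: "0 \<le> C" unfolding C_def by (intro suminf_nonneg summable_alias_majorant exponent_gt_1) auto
  define Q where "Q \<omega> = (\<Prod>j=0..n_seas P. \<bar>sin (real (z' j) * \<omega> / 2)\<bar> powr (- e j))" for \<omega>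
  have Q: "set_integrable lborel {-pi<..pi} Q"
    unfolding Q_def[abs_def] by (rule set_integrable_prod_abs_sin_powr) (auto intro: e0 zp sum)
  have Q_eq: "Q \<omega> = \<bar>sin (\<omega> / 2)\<bar> powr (- 2 * d) * (\<Prod>j=1..n_seas P. \<bar>sin (real (z j) * \<omega> / 2)\<bar> powr (- 2 * smem P j))" for \<omega>
    unfolding Q_def split by (subst prod.insert) (auto simp: z'_def e_def intro!: prod.cong)
  define K where "K = (max 1 (pi powr (- 2 * mem P)) + C) * B"
  have bound: "limit_kernel P r z \<omega> \<le> K * Q \<omega>" if \<omega>: "\<omega> \<in> {-pi<..pi}" for \<omega>
  proof (cases "\<omega> = 0")
    case True
    have "0 \<le> B" using B[of 0] seasonal_ratio_nonneg[of P z 0] by simp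
    then have "0 \<le> K" using C by (simp add: K_def)
    moreover have "0 \<le> Q \<omega>" by (simp add: Q_def prod_nonneg)
    ultimately show ?thesis using True by (simp add: limit_kernel_def)
  next
    case False
    define S where "S = \<bar>sin (\<omega> / 2)\<bar>"
    have "sin (\<omega> / 2) \<noteq> 0"
    proof (cases "0 < \<omega>")
      case True
      then have "0 < sin (\<omega> / 2)" using \<omega> by (intro sin_gt_zero) auto
      then show ?thesis by simp
    next
      case neg: False
      then have "0 < sin (- \<omega> / 2)" using \<omega> False by (intro sin_gt_zero) auto
      then show ?thesis by simp
    qed
    then have S: "0 < S" "S \<le> 1" by (auto simp: S_def)
    have Sw: "S \<le> \<bar>\<omega>\<bar>" unfolding S_def using abs_sin_x_le_abs_x[of "\<omega> / 2"] by simp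
    have w: "0 < \<bar>\<omega>\<bar>" "\<bar>\<omega>\<bar> \<le> pi" using False \<omega> by auto
    have S1: "1 \<le> S powr (- 2 * d)"
      using powr_mono'[of "- 2 * d" 0 S] S by (simp add: d_def)
    \<comment> \<open>Since S <= |\<omega>|, the front factor absorbs the order 2r + 2 of the
      pole.\<close>
    have "S ^ (2 * r + 2) * \<bar>\<omega>\<bar> powr (- ?a) \<le> \<bar>\<omega>\<bar> ^ (2 * r + 2) * \<bar>\<omega>\<bar> powr (- ?a)"
      using S Sw by (intro mult_right_mono power_mono) auto
    also have "\<dots> = \<bar>\<omega>\<bar> powr (- 2 * mem P)"
    proof -
      have "\<bar>\<omega>\<bar> ^ (2 * r + 2) = \<bar>\<omega>\<bar> powr real (2 * r + 2)" using w(1) by (simp only: powr_realpow)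
      then show ?thesis by (simp add: powr_add[symmetric])
    qed
    \<comment> \<open>For d >= 0 the power is decreasing and S <= |\<omega>| suffices; for d < 0 it
      is increasing and bounded by its value at pi. The maximum covers both cases.\<close>
    also have "\<dots> \<le> max 1 (pi powr (- 2 * mem P)) * S powr (- 2 * d)"
    proof (cases "0 \<le> mem P")
      case True
      then have "\<bar>\<omega>\<bar> powr (- 2 * mem P) \<le> S powr (- 2 * d)"
        using S Sw by (auto simp: d_def intro!: powr_mono2')
      also have "\<dots> \<le> max 1 (pi powr (- 2 * mem P)) * S powr (- 2 * d)"
        using mult_right_mono[of 1 "max 1 (pi powr (- 2 * mem P))" "S powr (- 2 * d)"] by simp
      finally show ?thesis .
    next
      case False
      then have "\<bar>\<omega>\<bar> powr (- 2 * mem P) \<le> pi powr (- 2 * mem P)"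
        using w by (intro powr_mono2) auto
      also have "\<dots> \<le> max 1 (pi powr (- 2 * mem P)) * 1" by simp
      also have "\<dots> \<le> max 1 (pi powr (- 2 * mem P)) * S powr (- 2 * d)"
        using S1 by (intro mult_left_mono) auto
      finally show ?thesis .
    qed
    finally have b1: "S ^ (2 * r + 2) * \<bar>\<omega>\<bar> powr (- ?a) \<le> max 1 (pi powr (- 2 * mem P)) * S powr (- 2 * d)" .
    have "S ^ (2 * r + 2) * C \<le> S powr (- 2 * d) * C"
    proof (rule mult_right_mono[OF _ C])
      have "S ^ (2 * r + 2) \<le> 1" using S by (intro power_le_one) auto
      then show "S ^ (2 * r + 2) \<le> S powr (- 2 * d)" using S1 by linarith
    qed
    with b1 have b2: "S ^ (2 * r + 2) * (\<bar>\<omega>\<bar> powr (- ?a) + C) \<le> (max 1 (pi powr (- 2 * mem P)) + C) * S powr (- 2 * d)"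
      by (simp add: algebra_simps)
    let ?p = "\<Prod>j=1..n_seas P. \<bar>sin (real (z j) * \<omega> / 2)\<bar> powr (- 2 * smem P j)"
    have p0: "0 \<le> ?p" by (intro prod_nonneg) auto
    have "limit_kernel P r z \<omega> \<le> kernel_factor P r z \<omega> * (\<bar>\<omega>\<bar> powr (- ?a) + C)"
      unfolding limit_kernel_eq C_def
      by (intro mult_left_mono infsum_alias_le exponent_gt_1 \<omega> kernel_factor_nonneg)
    also have "\<dots> = (S ^ (2 * r + 2) * (\<bar>\<omega>\<bar> powr (- ?a) + C)) * (?p * seasonal_ratio P z \<omega>)"
      by (simp only: kernel_factor_def S_def mult_ac)
    also have "\<dots> \<le> ((max 1 (pi powr (- 2 * mem P)) + C) * S powr (- 2 * d)) * (?p * B)"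
    proof (rule mult_mono[OF b2])
      show "?p * seasonal_ratio P z \<omega> \<le> ?p * B" using B[of \<omega>] \<omega> p0 by (intro mult_left_mono) auto
      show "0 \<le> (max 1 (pi powr (- 2 * mem P)) + C) * S powr (- 2 * d)" using C by simp
      show "0 \<le> ?p * seasonal_ratio P z \<omega>" using p0 seasonal_ratio_nonneg by (rule mult_nonneg_nonneg)
    qed
    also have "\<dots> = K * Q \<omega>"
      by (simp only: K_def Q_eq S_def mult_ac)
    finally show ?thesis .
  qed
  show ?thesis
  proof (rule set_integrable_bound)
    show "set_integrable lborel {-pi<..pi} (\<lambda>\<omega>. K * Q \<omega>)"
      using Q by (rule set_integrable_mult_right)
    show "set_borel_measurable lborel {-pi<..pi} (limit_kernel P r z)"
      using measurable_limit_kernel by (simp add: set_borel_measurable_def)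
    have "0 \<le> limit_kernel P r z \<omega>" for \<omega>
      unfolding limit_kernel_eq by (intro mult_nonneg_nonneg kernel_factor_nonneg infsum_nonneg) auto
    then show "AE \<omega> in lborel. \<omega> \<in> {-pi<..pi} \<longrightarrow> norm (limit_kernel P r z \<omega>) \<le> norm (K * Q \<omega>)"
      using bound by (intro AE_I2) fastforce
  qed
qed

lemma limit_kernel_nonneg: "0 \<le> limit_kernel P r z \<omega>"
  unfolding limit_kernel_eq by (intro mult_nonneg_nonneg kernel_factor_nonneg infsum_nonneg) auto

lemma limit_kernel_pos:
  assumes \<omega>: "\<omega> \<in> {-pi<..pi}" "cis \<omega> \<noteq> 1" "\<And>j. j \<in> {1..n_seas P} \<Longrightarrow> cis (real (z j) * \<omega>) \<noteq> 1"
  shows "0 < limit_kernel P r z \<omega>"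
proof -
  have s: "sin (t / 2) \<noteq> 0" if "cis t \<noteq> 1" for t
    using that norm_one_minus_cis[of t] by auto
  have "0 < kernel_factor P r z \<omega>"
    unfolding kernel_factor_def using s[OF \<omega>(2)] s[OF \<omega>(3)]
    by (intro mult_pos_pos prod_pos seasonal_ratio_pos adm) auto
  moreover have "0 < (\<Sum>\<^sub>\<infinity>k::int. \<bar>\<omega> + 2 * of_int k * pi\<bar> powr (- (2 * real r + 2 * mem P + 2)))"
  proof -
    have "\<omega> \<noteq> 0" using \<omega>(2) by auto
    then have "0 < (\<Sum>k\<in>{0::int}. \<bar>\<omega> + 2 * of_int k * pi\<bar> powr (- (2 * real r + 2 * mem P + 2)))" by simp
    also have "\<dots> \<le> (\<Sum>\<^sub>\<infinity>k::int. \<bar>\<omega> + 2 * of_int k * pi\<bar> powr (- (2 * real r + 2 * mem P + 2)))"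
      by (intro finite_sum_le_infsum summable_on_alias_terms exponent_gt_1 \<omega>) auto
    finally show ?thesis .
  qed
  ultimately show ?thesis unfolding limit_kernel_eq by (rule mult_pos_pos)
qed

text \<open>The kernel is positive outside a null set and the interval has positive measure; this
  makes the normalization constant meaningful.\<close>

lemma integral_limit_kernel_pos: "0 < (LBINT \<omega>:{-pi<..pi}. limit_kernel P r z \<omega>)"
proof -
  let ?f = "\<lambda>\<omega>. indicator {-pi<..pi} \<omega> *\<^sub>R limit_kernel P r z \<omega>"
  have i: "integrable lborel ?f"
    using set_integrable_limit_kernel by (simp add: set_integrable_def)
  have f0: "AE \<omega> in lborel. 0 \<le> ?f \<omega>" by (intro AE_I2) (simp add: limit_kernel_nonneg)
  have "integral\<^sup>L lborel ?f \<noteq> 0"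
  proof
    assume "integral\<^sup>L lborel ?f = 0"
    then have "AE \<omega> in lborel. ?f \<omega> = 0"
      using integral_nonneg_eq_0_iff_AE[OF i f0] by simp
    moreover have "AE \<omega> in lborel. cis \<omega> \<noteq> 1"
      using AE_cis_neq_1[of 1] by simp
    moreover have "AE \<omega> in lborel. \<forall>j\<in>{1..n_seas P}. cis (real (z j) * \<omega>) \<noteq> 1"
      using z by (intro AE_finite_allI AE_cis_neq_1) auto
    ultimately have "AE \<omega> in lborel. \<omega> \<notin> {-pi<..pi}"
    proof eventually_elim
      case (elim \<omega>)
      then show ?case using limit_kernel_pos[of \<omega>] by auto
    qed
    then have "emeasure lborel {-pi<..pi} = 0"
      by (subst (asm) AE_iff_measurable[of "{-pi<..pi}"]) auto
    then show False by simp
  qed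
  moreover have "0 \<le> integral\<^sup>L lborel ?f" by (intro integral_nonneg_AE f0)
  ultimately show ?thesis by (simp add: set_lebesgue_integral_def)
qed

text \<open>Numerator and denominator lose their common power of \<open>m\<close> first; the
  remaining limits both carry the factor \<open>short_mem_density P 0\<close>, so the short memory
  part disappears from the quotient.\<close>

lemma normalized_agg_density_tendsto:
  assumes \<omega>: "\<omega> \<in> {-pi<..pi}" "\<omega> \<noteq> 0"
  shows "(\<lambda>m. agg_density P r z m \<omega> / (LBINT u:{-pi<..pi}. agg_density P r z m u))
    \<longlonglongrightarrow> limit_kernel P r z \<omega> / (LBINT u:{-pi<..pi}. limit_kernel P r z u)"
proof -
  let ?a = "2 * real r + 2 * mem P + 2"
  let ?g = "short_mem_density P"
  define E where "E m \<omega> = kernel_factor P r z \<omega> * scaled_alias_sum ?g ?a m \<omega>" for m \<omega>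
  define C where "C = 2 ^ (2 * r + 2) * 2 powr (- 2 * (\<Sum>j=1..n_seas P. smem P j))"
  have C: "C \<noteq> 0" by (simp add: C_def)
  have agg: "agg_density P r z m \<omega> = (real m powr (2 * real r + 2 * mem P + 1) * C) * E m \<omega>" if "0 < m" for m \<omega>
    using agg_density_eq[OF that] by (simp add: C_def E_def)
  obtain G where G: "\<And>x. x \<in> {-pi<..pi} \<Longrightarrow> ?g x \<le> G"
  proof -
    have "bounded (?g ` {-pi..pi})"
      by (intro compact_imp_bounded compact_continuous_image continuous_on_short_mem_density adm) simp
    then obtain B where B: "\<And>\<omega>. \<omega> \<in> {-pi..pi} \<Longrightarrow> norm (?g \<omega>) \<le> B"
      unfolding bounded_iff by blast
    show ?thesis
    proof (rule that[of B])
      fix x assume "x \<in> {-pi<..pi}"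
      then show "?g x \<le> B" using B[of x] by simp
    qed
  qed
  note g0 = short_mem_density_nonneg[OF adm]
  have lim: "(\<lambda>m. E m \<omega>) \<longlonglongrightarrow> ?g 0 * limit_kernel P r z \<omega>" if "\<omega> \<in> {-pi<..pi}" "\<omega> \<noteq> 0" for \<omega>
  proof -
    have "(\<lambda>m. E m \<omega>) \<longlonglongrightarrow> kernel_factor P r z \<omega> * (?g 0 * (\<Sum>\<^sub>\<infinity>k::int. \<bar>\<omega> + 2 * of_int k * pi\<bar> powr (- ?a)))"
      unfolding E_def by (intro tendsto_mult_left scaled_alias_sum_tendsto[where G = G] exponent_gt_1 that continuous_on_short_mem_density adm g0 G)
    then show ?thesis by (simp add: limit_kernel_eq mult_ac)
  qed
  have E0: "0 \<le> E m \<omega>" for m \<omega>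
    unfolding E_def scaled_alias_sum_def by (intro mult_nonneg_nonneg kernel_factor_nonneg sum_nonneg g0) auto
  have E_le: "E m \<omega> \<le> 2 powr ?a * G * limit_kernel P r z \<omega>" if "0 < m" "\<omega> \<in> {-pi<..pi}" for m \<omega>
  proof -
    have "E m \<omega> \<le> kernel_factor P r z \<omega> * (2 powr ?a * G * (\<Sum>\<^sub>\<infinity>k::int. \<bar>\<omega> + 2 * of_int k * pi\<bar> powr (- ?a)))"
      unfolding E_def by (intro mult_left_mono scaled_alias_sum_le exponent_gt_1 that g0 G kernel_factor_nonneg)
    then show ?thesis by (simp add: limit_kernel_eq mult_ac)
  qed
  have Em: "E m \<in> borel_measurable borel" if "0 < m" for m
  proof -
    have "E m = (\<lambda>\<omega>. agg_density P r z m \<omega> / (real m powr (2 * real r + 2 * mem P + 1) * C))"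
      using that C by (simp add: agg[OF that] fun_eq_iff)
    then show ?thesis by simp
  qed
  \<comment> \<open>The index is shifted because the domination is available for positive
    \<open>m\<close> only.\<close>
  have "(\<lambda>m. LBINT \<omega>:{-pi<..pi}. E (Suc m) \<omega>) \<longlonglongrightarrow> (LBINT \<omega>:{-pi<..pi}. ?g 0 * limit_kernel P r z \<omega>)"
    unfolding set_lebesgue_integral_def
  proof (rule integral_dominated_convergence[where w = "\<lambda>\<omega>. 2 powr ?a * G * (indicator {-pi<..pi} \<omega> *\<^sub>R limit_kernel P r z \<omega>)"])
    have "(\<lambda>\<omega>. ?g 0 * (indicator {-pi<..pi} \<omega> *\<^sub>R limit_kernel P r z \<omega>)) \<in> borel_measurable lborel"
      using measurable_limit_kernel by simp
    then show "(\<lambda>\<omega>. indicator {-pi<..pi} \<omega> *\<^sub>R (?g 0 * limit_kernel P r z \<omega>)) \<in> borel_measurable lborel"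
      by (simp add: mult_ac)
    show "(\<lambda>\<omega>. indicator {-pi<..pi} \<omega> *\<^sub>R E (Suc m) \<omega>) \<in> borel_measurable lborel" for m
      using Em[of "Suc m"] by simp
    show "integrable lborel (\<lambda>\<omega>. 2 powr ?a * G * (indicator {-pi<..pi} \<omega> *\<^sub>R limit_kernel P r z \<omega>))"
      using set_integrable_limit_kernel unfolding set_integrable_def by (rule integrable_mult_right)
    show "AE \<omega> in lborel. (\<lambda>m. indicator {-pi<..pi} \<omega> *\<^sub>R E (Suc m) \<omega>) \<longlonglongrightarrow> indicator {-pi<..pi} \<omega> *\<^sub>R (?g 0 * limit_kernel P r z \<omega>)"
      using AE_lborel_singleton[of 0]
    proof eventually_elim
      case (elim \<omega>)
      then show ?case
        using LIMSEQ_Suc[OF lim[of \<omega>]] by (cases "\<omega> \<in> {-pi<..pi}") auto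
    qed
    show "AE \<omega> in lborel. norm (indicator {-pi<..pi} \<omega> *\<^sub>R E (Suc m) \<omega>) \<le> 2 powr ?a * G * (indicator {-pi<..pi} \<omega> *\<^sub>R limit_kernel P r z \<omega>)" for m
      using E_le[of "Suc m"] E0 by (intro AE_I2) (auto simp: indicator_def)
  qed
  then have "(\<lambda>m. E (Suc m) \<omega> / (LBINT \<omega>:{-pi<..pi}. E (Suc m) \<omega>)) \<longlonglongrightarrow>
      ?g 0 * limit_kernel P r z \<omega> / (LBINT \<omega>:{-pi<..pi}. ?g 0 * limit_kernel P r z \<omega>)"
    using short_mem_density_pos[OF adm, of 0] integral_limit_kernel_pos
    by (intro tendsto_divide LIMSEQ_Suc[OF lim[OF \<omega>]]) auto
  moreover have "agg_density P r z (Suc m) \<omega> / (LBINT u:{-pi<..pi}. agg_density P r z (Suc m) u) =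
      E (Suc m) \<omega> / (LBINT \<omega>:{-pi<..pi}. E (Suc m) \<omega>)" for m
    using C by (simp add: agg del: of_nat_Suc)
  ultimately have "(\<lambda>m. agg_density P r z (Suc m) \<omega> / (LBINT u:{-pi<..pi}. agg_density P r z (Suc m) u))
    \<longlonglongrightarrow> limit_kernel P r z \<omega> / (LBINT u:{-pi<..pi}. limit_kernel P r z u)"
    using short_mem_density_pos[OF adm, of 0] by simp
  then show ?thesis by (rule LIMSEQ_imp_Suc)
qed

end

theorem theorem1:
  fixes P :: sarfima_params and z R :: "nat \<Rightarrow> nat" and r :: nat
  assumes "1 \<le> n_seas P"
    and "admissible P"
    and "\<forall>j\<in>{1..n_seas P}. 0 < z j"
    and "strict_mono_on {1..n_seas P} z"
  shows
    "(\<forall>(m::nat) (M::'a measure) \<epsilon> Y.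
        2 \<le> m \<longrightarrow> integrated_sarfima M P r R (\<lambda>j. m * z j) \<epsilon> Y \<longrightarrow>
        has_spectral_density M (backshift_poly (diff_poly (n_seas P) r R z) (aggregate m Y))
          (agg_density P r z m))
     \<and>
     (\<forall>(M :: nat \<Rightarrow> 'a measure) \<epsilon> Y.
        (\<forall>m\<ge>2. integrated_sarfima (M m) P r R (\<lambda>j. m * z j) (\<epsilon> m) (Y m)) \<longrightarrow>
        (\<forall>\<omega>\<in>{-pi<..pi}.
           (\<lambda>k::int. \<bar>\<omega> + 2 * of_int k * pi\<bar> powr (- 2 * real r - 2 * mem P - 2)) summable_on UNIV) \<and>
        set_integrable lborel {-pi<..pi} (limit_kernel P r z) \<and>
        (\<exists>K::real.
           (LBINT \<omega>:{-pi<..pi}. K * limit_kernel P r z \<omega>) = 1 \<and>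
           (\<forall>\<omega>\<in>{-pi<..pi}.
              \<omega> \<noteq> 0 \<longrightarrow> (\<forall>j\<in>{1..n_seas P}. real (z j) * \<omega> \<notin> range (\<lambda>k::int. 2 * pi * of_int k)) \<longrightarrow>
              (\<lambda>m. agg_density P r z m \<omega> / (LBINT u:{-pi<..pi}. agg_density P r z m u))
                \<longlonglongrightarrow> K * limit_kernel P r z \<omega>)))"
proof (intro conjI allI impI)
  fix m :: nat and M :: "'a measure" and \<epsilon> Y
  assume "2 \<le> m" "integrated_sarfima M P r R (\<lambda>j. m * z j) \<epsilon> Y"
  then show "has_spectral_density M (backshift_poly (diff_poly (n_seas P) r R z) (aggregate m Y)) (agg_density P r z m)"
    using assms(3) by (intro has_spectral_density_agg) auto
next
  fix M :: "nat \<Rightarrow> 'a measure" and \<epsilon> Y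
  assume Y: "\<forall>m\<ge>2. integrated_sarfima (M m) P r R (\<lambda>j. m * z j) (\<epsilon> m) (Y m)"
  note adm = assms(2)
  have z: "0 < z j" if "j \<in> {1..n_seas P}" for j using assms(3) that by blast
  \<comment> \<open>Of all the given processes only the one for \<open>m = 2\<close> is used in this
    part, to bound the sum of the seasonal memory parameters.\<close>
  define U where "U = backshift_poly (diff_poly (n_seas P) r R (\<lambda>j. 2 * z j)) (Y 2)"
  have st: "stationary_sarfima (M 2) P (\<lambda>j. 2 * z j) (\<epsilon> 2) U"
    using Y by (auto simp: integrated_sarfima_def U_def)
  then have "has_spectral_density (M 2) U (sarfima_density P (\<lambda>j. 2 * z j))"
    by (rule has_spectral_density_stationary_sarfima)
  then have D: "(\<Sum>j=1..n_seas P. smem P j) < 1 / 2"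
    by (intro sum_smem_less_half[OF adm assms(1) z]) (auto simp: has_spectral_density_def)
  have e: "- 2 * real r - 2 * mem P - 2 = - (2 * real r + 2 * mem P + 2)" by simp
  have a: "1 < 2 * real r + 2 * mem P + 2"
    by (rule exponent_gt_1[OF adm assms(1) z D])
  show "\<forall>\<omega>\<in>{-pi<..pi}. (\<lambda>k::int. \<bar>\<omega> + 2 * of_int k * pi\<bar> powr (- 2 * real r - 2 * mem P - 2)) summable_on UNIV"
    unfolding e using summable_on_alias_terms[OF a] by blast
  show "set_integrable lborel {-pi<..pi} (limit_kernel P r z)"
    by (rule set_integrable_limit_kernel[OF adm assms(1) z D])
  let ?L = "LBINT \<omega>:{-pi<..pi}. limit_kernel P r z \<omega>"
  have L: "0 < ?L" by (rule integral_limit_kernel_pos[OF adm assms(1) z D])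
  show "\<exists>K::real. (LBINT \<omega>:{-pi<..pi}. K * limit_kernel P r z \<omega>) = 1 \<and>
     (\<forall>\<omega>\<in>{-pi<..pi}. \<omega> \<noteq> 0 \<longrightarrow> (\<forall>j\<in>{1..n_seas P}. real (z j) * \<omega> \<notin> range (\<lambda>k::int. 2 * pi * of_int k)) \<longrightarrow>
        (\<lambda>m. agg_density P r z m \<omega> / (LBINT u:{-pi<..pi}. agg_density P r z m u)) \<longlonglongrightarrow> K * limit_kernel P r z \<omega>)"
  proof (intro exI[of _ "1 / ?L"] conjI ballI impI)
    show "(LBINT \<omega>:{-pi<..pi}. 1 / ?L * limit_kernel P r z \<omega>) = 1"
      using L by simp
    fix \<omega> assume "\<omega> \<in> {-pi<..pi}" "\<omega> \<noteq> 0"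
    then have "(\<lambda>m. agg_density P r z m \<omega> / (LBINT u:{-pi<..pi}. agg_density P r z m u)) \<longlonglongrightarrow> limit_kernel P r z \<omega> / ?L"
      using normalized_agg_density_tendsto[OF adm assms(1) _ D] z by blast
    then show "(\<lambda>m. agg_density P r z m \<omega> / (LBINT u:{-pi<..pi}. agg_density P r z m u)) \<longlonglongrightarrow> 1 / ?L * limit_kernel P r z \<omega>"
      by simp
  qed
qed

end
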